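(* Let $\mathcal X$ be a compact metric space, $a<b$ reals, $T\ge1$, $\mathcal C\subseteq[a,b]^T$ nonempty compact, $\rho_{\mathcal X}$ a Borel probability measure on $\mathcal X$ and, for $t=1,\dots,T$, $\rho_t$ a Borel probability measure on $\mathcal X\times[a,b]$ with $d\rho_t(x,y)=d\rho_t(y|x)\,d\rho_{\mathcal X}(x)$. Let $k:\mathcal X\times\mathcal X\to\mathbb R$ be a continuous universal reproducing kernel with RKHS $\mathcal G$, and let $\ell:[a,b]\times[a,b]\to\mathbb R$ be SELF with $\ell(y,y')=\langle\psi(y),V\psi(y')\rangle_{\mathcal H}$. For $N=(n_1,\dots,n_T)$, let $(x_{it},y_{it})_{i=1}^{n_t}$ be sampled independently from $\rho_t$ for each $t$, let $\lambda_t=n_t^{-1/4}$, and let $\widehat f_N:\mathcal X\to\mathcal C$ be the estimator $$\widehat f_N(x)=\operatorname*{argmin}_{c\in\mathcal C}\sum_{t=1}^T\sum_{i=1}^{n_t}\alpha_{it}(x)\ell(c_t,y_{it}),\qquad(\alpha_{1t}(x),\dots,\alpha_{n_tt}(x))^\top=(K_t+n_t\lambda_tI)^{-1}K_{tx},$$ where $(K_t)_{ij}=k(x_{it},x_{jt})$ and $(K_{tx})_i=k(x,x_{it})$. Let $n_0=\min_{1\le t\le T}n_t$ and $\mathcal E(f)=\frac1T\sum_{t=1}^T\int\ell(f_t(x),y)\,d\rho_t(x,y)$. Then, with probability $1$, $$\lim_{n_0\to+\infty}\mathcal E(\widehat f_N)=\inf_{f:\mathcal X\to\mathcal C}\mathcal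 E(f),$$ where the infimum is over measurable $f$.
   Context: Definition (SELF): Let $\mathcal{Y}$ be a compact set. A function $\ell:\mathcal{Y}\times\mathcal{Y}\to\mathbb{R}$ is a Structure Encoding Loss Function (SELF) if there exist a continuous feature map $\psi:\mathcal{Y}\to\mathcal{H}$, with $\mathcal{H}$ a reproducing kernel Hilbert space on $\mathcal{Y}$, and a continuous linear operator $V:\mathcal{H}\to\mathcal{H}$ such that $\ell(y,y')=\langle\psi(y),V\psi(y')\rangle_{\mathcal H}$ for all $y,y'\in\mathcal{Y}$. A continuous kernel on a compact $\mathcal X$ is universal if its RKHS is dense in $C(\mathcal X)$ (e.g. the Gaussian kernel). For $c\in\mathbb R^T$, $c_t$ is its $t$-th coordinate. *)

theory Defs
  imports "HOL-Probability.Probability"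
begin

definition pd_kernel :: "('x \<Rightarrow> 'x \<Rightarrow> real) \<Rightarrow> bool" where
  "pd_kernel k \<longleftrightarrow> (\<forall>x y. k x y = k y x) \<and>
     (\<forall>(n::nat) (xs::nat \<Rightarrow> 'x) (c::nat \<Rightarrow> real).
        0 \<le> (\<Sum>i<n. \<Sum>j<n. c i * c j * k (xs i) (xs j)))"

text \<open>Continuous universal kernel on the (compact) space UNIV: the span of the
  kernel sections k(x,.), which is dense in the RKHS, is uniformly dense in C(X).\<close>
definition universal_kernel :: "('x::topological_space \<Rightarrow> 'x \<Rightarrow> real) \<Rightarrow> bool" where
  "universal_kernel k \<longleftrightarrow> continuous_on UNIV (\<lambda>(x,y). k x y) \<and>
     (\<forall>f. continuous_on UNIV f \<longrightarrow>
        (\<forall>e>0. \<exists>(n::nat) (c::nat \<Rightarrow> real) (xs::nat \<Rightarrow> 'x).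
           \<forall>x. \<bar>f x - (\<Sum>i<n. c i * k (xs i) x)\<bar> < e))"

text \<open>A Hilbert space 'h is (isometric to) an RKHS on Y via evl: elements are
  functions on Y (evl injective on Y) with bounded linear point evaluations.\<close>
definition is_rkhs_on :: "'y set \<Rightarrow> ('h::real_normed_vector \<Rightarrow> 'y \<Rightarrow> real) \<Rightarrow> bool" where
  "is_rkhs_on Y evl \<longleftrightarrow> (\<forall>y\<in>Y. bounded_linear (\<lambda>h. evl h y)) \<and>
     (\<forall>h. (\<forall>y\<in>Y. evl h y = 0) \<longrightarrow> h = 0)"

definition SELF :: "'y::topological_space set \<Rightarrow> ('y \<Rightarrow> 'y \<Rightarrow> real) \<Rightarrow>
    ('y \<Rightarrow> 'h::{real_inner,complete_space}) \<Rightarrow> ('h \<Rightarrow> 'h) \<Rightarrow> ('h \<Rightarrow> 'y \<Rightarrow> real) \<Rightarrow> bool" where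
  "SELF Y l psi V evl \<longleftrightarrow> is_rkhs_on Y evl \<and> continuous_on Y psi \<and> bounded_linear V \<and>
     (\<forall>y\<in>Y. \<forall>y'\<in>Y. l y y' = psi y \<bullet> V (psi y'))"

text \<open>Kernel ridge regression weights alpha(x) = (K + n lam I)^{-1} K_x for sample points
  xs 0, ..., xs (n-1): the unique solution of the linear system (padded by 0).\<close>
definition krr_weights :: "('x \<Rightarrow> 'x \<Rightarrow> real) \<Rightarrow> nat \<Rightarrow> real \<Rightarrow> (nat \<Rightarrow> 'x) \<Rightarrow> 'x \<Rightarrow> nat \<Rightarrow> real" where
  "krr_weights k n lam xs x = (THE \<alpha>.
     (\<forall>i<n. (\<Sum>j<n. (k (xs i) (xs j) + (if i = j then real n * lam else 0)) * \<alpha> j) = k x (xs i))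
     \<and> (\<forall>j\<ge>n. \<alpha> j = 0))"

definition mtl_objective :: "('x \<Rightarrow> 'x \<Rightarrow> real) \<Rightarrow> (real \<Rightarrow> real \<Rightarrow> real) \<Rightarrow> ('t::finite \<Rightarrow> nat) \<Rightarrow>
    ('t \<Rightarrow> nat \<Rightarrow> 'o \<Rightarrow> 'x \<times> real) \<Rightarrow> 'o \<Rightarrow> 'x \<Rightarrow> real^'t \<Rightarrow> real" where
  "mtl_objective k l n Z w x c =
     (\<Sum>t\<in>UNIV. \<Sum>i<n t.
        krr_weights k (n t) (real (n t) powr (-1/4)) (\<lambda>j. fst (Z t j w)) x i * l (c $ t) (snd (Z t i w)))"

definition mtl_risk :: "('t::finite \<Rightarrow> ('x \<times> real) measure) \<Rightarrow> (real \<Rightarrow> real \<Rightarrow> real) \<Rightarrow>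
    ('x \<Rightarrow> real^'t) \<Rightarrow> real" where
  "mtl_risk \<rho> l f = (1 / real CARD('t)) * (\<Sum>t\<in>UNIV. \<integral>z. l (f (fst z) $ t) (snd z) \<partial>(\<rho> t))"

end

theory Submission
  imports Defs "HOL-Real_Asymp.Real_Asymp"
begin

text \<open>Since \<open>\<ell>(c, y) = \<langle>\<psi>(c), V \<psi>(y)\<rangle>\<close>, the objective minimised by the estimator is a kernel ridge
  regression of \<open>\<psi>(y)\<close>, and comparing minimisers bounds the excess risk by
  \<open>sup\<^sub>h \<bar>\<integral> (\<Sum>\<^sub>i \<alpha>\<^sub>i(x) \<ell>(h(x), y\<^sub>i) - \<ell>(h(x), y)) d\<rho>\<^sub>t\<bar>\<close> over measurable \<open>h\<close>, separately for each task.
  The range of \<open>\<psi>\<close> is compact, so \<open>\<psi>\<close> is a step function with vector values up to a uniformly small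
  remainder. The remainder is harmless because ridge regression is stable in mean square. For the
  scalar indicator responses, the risk of the regressor converges to the infimum over all bounded
  measurable functions by universality, and near minimality of the risk makes the residual almost
  orthogonal to all bounded functions of \<open>x\<close>. Both points rest on the uniform deviation of
  empirical second moments over RKHS balls; a Cholesky expansion \<open>k(x, y) = \<Sum>\<^sub>m e\<^sub>m(x) e\<^sub>m(y)\<close> reduces it
  to variances of scalar sums, and the deviation is almost surely \<open>o(n\<^sup>-\<^sup>1\<^sup>/\<^sup>4) = o(\<lambda>)\<close>.\<close>

text \<open>The estimator depends on the sample and couples the tasks through \<open>C\<close>, so a
  bound for one fixed predictor is useless: a single null set must serve all measurable
  \<open>h\<close>. Hence the target is not convergence to the conditional mean of \<psi>(y) given x
  but near orthogonality of the residual to all bounded functions of x, with the threshold for n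
  chosen before the test function. No conditional expectation and no vector-valued regression
  function appear. The RKHS is not constructed either: combinations of kernel sections are handled
  through their square-summable coefficients in the feature expansion, whose square sum is the
  squared RKHS norm. The exponent 1/4: for responses bounded by U, the squared norm of the regressor
  is only known to be at most U^2 / \<lambda>, so a Gram deviation \<Delta> costs \<Delta> /
  \<lambda> in the risk, whereas the penalty of a fixed competitor costs a multiple of \<lambda>. So
  \<lambda> must vanish while \<Delta> = o(\<lambda>). Since fluctuations have mean-square size
  n^(-1/2), there is room to get this almost surely from second moments alone. Each task has its own
  almost sure threshold, so the sample sizes may grow at unrelated speeds.\<close>

section \<open>Ridge systems\<close>

text \<open>Gram-Schmidt by induction on the support of \<open>r\<close>: the components along one
  unit vector form a scalar instance of the hypothesis, and the orthogonal remainder has smaller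
  support. This later turns a scalar stability bound into one for vectors of
  \<open>'h\<close>.\<close>

lemma psd_form_inner_nonneg:
  fixes N :: "'i \<Rightarrow> 'i \<Rightarrow> real" and r :: "'i \<Rightarrow> 'h::real_inner"
  assumes I: "finite I"
    and psd: "\<And>c. 0 \<le> (\<Sum>i\<in>I. \<Sum>j\<in>I. N i j * (c i * c j))"
  shows "0 \<le> (\<Sum>i\<in>I. \<Sum>j\<in>I. N i j * (r i \<bullet> r j))"
proof -
  have "0 \<le> (\<Sum>i\<in>I. \<Sum>j\<in>I. N i j * (r i \<bullet> r j))"
    if "finite A" "\<And>i. i \<notin> A \<Longrightarrow> r i = 0" for A and r :: "'i \<Rightarrow> 'h"
    using that
  proof (induction A arbitrary: r rule: finite_induct)
    case empty
    then show ?case by simp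
  next
    case (insert a A)
    \<comment> \<open>If \<open>r a = 0\<close> then \<open>e = 0\<close>, and the same split
      remains valid with nothing removed.\<close>
    define e where "e = r a /\<^sub>R norm (r a)"
    define r' where "r' i = r i - (r i \<bullet> e) *\<^sub>R e" for i
    have ra: "r a = (r a \<bullet> e) *\<^sub>R e"
      by (cases "r a = 0") (auto simp: e_def dot_square_norm power2_eq_square field_simps)
    have r'0: "r' i = 0" if "i \<notin> A" for i
      using that insert.prems[of i] ra by (cases "i = a") (auto simp: r'_def)
    have ee: "e \<bullet> e = 1 \<or> e = 0"
      by (cases "r a = 0") (auto simp: e_def dot_square_norm power2_eq_square)
    have split: "r i \<bullet> r j = (r i \<bullet> e) * (r j \<bullet> e) + r' i \<bullet> r' j" for i j
      using ee by (auto simp: r'_def inner_diff_left inner_diff_right inner_commute algebra_simps)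
    have "(\<Sum>i\<in>I. \<Sum>j\<in>I. N i j * (r i \<bullet> r j)) =
        (\<Sum>i\<in>I. \<Sum>j\<in>I. N i j * ((r i \<bullet> e) * (r j \<bullet> e))) + (\<Sum>i\<in>I. \<Sum>j\<in>I. N i j * (r' i \<bullet> r' j))"
      by (simp only: split distrib_left sum.distrib)
    then show ?case
      using psd[of "\<lambda>i. r i \<bullet> e"] insert.IH[of r'] r'0 by simp
  qed
  from this[OF I, of "\<lambda>i. if i \<in> I then r i else 0"] show ?thesis
    by (simp cong: sum.cong_simp)
qed

text \<open>Bordering: the leading block is solved for the right-hand side and for the last column,
  and the last unknown is then found by dividing by the Schur complement.\<close>

lemma positive_definite_solvable:
  fixes A :: "nat \<Rightarrow> nat \<Rightarrow> real"
  assumes "\<And>i j. A i j = A j i"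
    and "\<And>c. \<exists>i<n. c i \<noteq> 0 \<Longrightarrow> 0 < (\<Sum>i<n. \<Sum>j<n. A i j * (c i * c j))"
  shows "\<exists>c. \<forall>i<n. (\<Sum>j<n. A i j * c j) = b i"
  using assms
proof (induction n arbitrary: b)
  case 0
  then show ?case by simp
next
  case (Suc n)
  have pos: "0 < (\<Sum>i<n. \<Sum>j<n. A i j * (c i * c j))" if "\<exists>i<n. c i \<noteq> 0" for c
  proof -
    have "\<exists>i<Suc n. (if i < n then c i else 0) \<noteq> 0" using that by (auto intro: less_SucI)
    from Suc.prems(2)[OF this] show ?thesis by (simp cong: sum.cong_simp)
  qed
  obtain p where p: "\<forall>i<n. (\<Sum>j<n. A i j * p j) = b i" using Suc.IH[OF Suc.prems(1) pos] by blast
  obtain q where q: "\<forall>i<n. (\<Sum>j<n. A i j * q j) = A i n"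
    using Suc.IH[OF Suc.prems(1) pos, of "\<lambda>i. A i n"] by blast
  \<comment> \<open>The Schur complement of the leading block. It is positive because it is the
    value of the form at \<open>c\<close>, that is, at q extended by -1.\<close>
  define s where "s = A n n - (\<Sum>j<n. A n j * q j)"
  define c where "c i = (if i < n then q i else -1)" for i
  have sum_c: "(\<Sum>j<Suc n. A i j * c j) = (\<Sum>j<n. A i j * q j) - A i n" for i
    by (simp add: c_def)
  have "0 < (\<Sum>i<Suc n. \<Sum>j<Suc n. A i j * (c i * c j))"
  proof (rule Suc.prems(2))
    show "\<exists>i<Suc n. c i \<noteq> 0" by (intro exI[of _ n]) (simp add: c_def)
  qed
  also have "\<dots> = (\<Sum>i<Suc n. c i * (\<Sum>j<Suc n. A i j * c j))"
    unfolding sum_distrib_left by (intro sum.cong refl) (simp add: ac_simps)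
  also have "\<dots> = s"
    unfolding sum_c by (simp add: q c_def s_def)
  finally have s: "s > 0" .
  \<comment> \<open>The value of the last unknown after elimination of the others.\<close>
  define t where "t = (b n - (\<Sum>j<n. A n j * p j)) / s"
  define d where "d i = (if i < n then p i - t * q i else t)" for i
  have sum_d: "(\<Sum>j<Suc n. A i j * d j) = (\<Sum>j<n. A i j * p j) - t * (\<Sum>j<n. A i j * q j) + A i n * t" for i
    by (simp add: d_def right_diff_distrib sum_subtractf sum_distrib_left ac_simps)
  have "(\<Sum>j<Suc n. A i j * d j) = b i" if "i < Suc n" for i
  proof (cases "i < n")
    case True
    then show ?thesis unfolding sum_d using p q by simp
  next
    case False
    then have [simp]: "i = n" using that by simp
    have "t * s = b n - (\<Sum>j<n. A n j * p j)" using s by (simp add: t_def)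
    then show ?thesis unfolding sum_d by (simp add: s_def algebra_simps)
  qed
  then show ?case by blast
qed

lemma pd_kernelD: "pd_kernel k \<Longrightarrow> 0 \<le> (\<Sum>i<n. \<Sum>j<n. c i * c j * k (xs i) (xs j))"
  for n :: nat
  by (simp add: pd_kernel_def)

lemma pd_kernel_sym: "pd_kernel k \<Longrightarrow> k x y = k y x"
  by (simp add: pd_kernel_def)

text \<open>Adding \<open>n * lam\<close> on the diagonal makes a positive semidefinite kernel
  matrix definite. Existence and uniqueness together are what lets the \<open>THE\<close> in
  \<open>krr_weights\<close> be unfolded.\<close>

lemma ridge_system:
  fixes lam :: real and xs :: "nat \<Rightarrow> 'x" and n :: nat
  assumes k: "pd_kernel k" and "0 < lam" "0 < n"
  defines "A \<equiv> \<lambda>i j. k (xs i) (xs j) + (if i = j then real n * lam else 0)"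
  shows "\<exists>c. \<forall>i<n. (\<Sum>j<n. A i j * c j) = b i"
    and "\<lbrakk>\<And>i. i < n \<Longrightarrow> (\<Sum>j<n. A i j * c j) = 0; i < n\<rbrakk> \<Longrightarrow> c i = 0"
proof -
  have pos: "0 < (\<Sum>i<n. \<Sum>j<n. A i j * (c i * c j))" if c: "\<exists>i<n. c i \<noteq> 0" for c
  proof -
    have "(\<Sum>i<n. \<Sum>j<n. A i j * (c i * c j)) =
        (\<Sum>i<n. \<Sum>j<n. c i * c j * k (xs i) (xs j)) + (\<Sum>i<n. real n * lam * (c i)\<^sup>2)"
    proof -
      have "A i j * (c i * c j) = c i * c j * k (xs i) (xs j) + (if i = j then real n * lam * (c i)\<^sup>2 else 0)"
        for i j by (simp add: A_def algebra_simps power2_eq_square)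
      then show ?thesis by (simp add: sum.distrib)
    qed
    moreover have "0 < (\<Sum>i<n. real n * lam * (c i)\<^sup>2)"
    proof -
      obtain i where "i < n" "c i \<noteq> 0" using c by blast
      then show ?thesis using \<open>0 < lam\<close> \<open>0 < n\<close> by (intro sum_pos2[of _ i]) auto
    qed
    ultimately show ?thesis using pd_kernelD[OF k, where n=n and c=c and xs=xs] by linarith
  qed
  have sym: "A i j = A j i" for i j
    using pd_kernel_sym[OF k] by (auto simp: A_def)
  show "\<exists>c. \<forall>i<n. (\<Sum>j<n. A i j * c j) = b i"
    by (rule positive_definite_solvable[OF sym pos])
  show "c i = 0" if z: "\<And>i. i < n \<Longrightarrow> (\<Sum>j<n. A i j * c j) = 0" and "i < n"
  proof (rule ccontr)
    assume "c i \<noteq> 0"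
    then have "0 < (\<Sum>i<n. \<Sum>j<n. A i j * (c i * c j))" using pos \<open>i < n\<close> by blast
    also have "\<dots> = (\<Sum>i<n. c i * (\<Sum>j<n. A i j * c j))"
      unfolding sum_distrib_left by (intro sum.cong refl) (simp add: ac_simps)
    also have "\<dots> = 0" using z by simp
    finally show False by simp
  qed
qed

lemma krr_weights_system:
  assumes k: "pd_kernel k" and lam: "0 < lam" and n: "0 < n" and i: "i < n"
  shows "(\<Sum>j<n. (k (xs i) (xs j) + (if i = j then real n * lam else 0)) * krr_weights k n lam xs x j) = k x (xs i)"
proof -
  let ?A = "\<lambda>i j. k (xs i) (xs j) + (if i = j then real n * lam else 0)"
  let ?Q = "\<lambda>\<alpha>. (\<forall>i<n. (\<Sum>j<n. ?A i j * \<alpha> j) = k x (xs i)) \<and> (\<forall>j\<ge>n. \<alpha> j = 0)"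
  obtain c where c: "\<forall>i<n. (\<Sum>j<n. ?A i j * c j) = k x (xs i)"
    using ridge_system(1)[OF k lam n, where xs=xs and b="\<lambda>i. k x (xs i)"] by blast
  have "\<exists>!\<alpha>. ?Q \<alpha>"
  proof
    show "?Q (\<lambda>j. if j < n then c j else 0)" using c by (auto cong: sum.cong_simp)
    fix \<beta> assume \<beta>: "?Q \<beta>"
    have "\<beta> j - c j = 0" if "j < n" for j
      using ridge_system(2)[OF k lam n, where c="\<lambda>j. \<beta> j - c j" and i=j and xs=xs] \<beta> c that
      by (simp add: right_diff_distrib sum_subtractf)
    then show "\<beta> = (\<lambda>j. if j < n then c j else 0)" using \<beta> by (auto simp: fun_eq_iff)
  qed
  from theI'[OF this] show ?thesis using i unfolding krr_weights_def by blast
qed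

text \<open>The representer form of the kernel ridge regressor: \<open>(K + n \<lambda> I) c = u\<close> and, \<open>K\<close> being
  symmetric, \<open>\<langle>\<alpha>(x), u\<rangle> = \<langle>K\<^sub>x, c\<rangle>\<close>.\<close>

lemma krr_representer:
  fixes u :: "nat \<Rightarrow> real"
  assumes k: "pd_kernel k" and lam: "0 < lam" and n: "0 < n"
  obtains c where "\<And>x. (\<Sum>i<n. krr_weights k n lam xs x i * u i) = (\<Sum>j<n. c j * k x (xs j))"
    and "\<And>i. i < n \<Longrightarrow> (\<Sum>j<n. c j * k (xs i) (xs j)) + real n * lam * c i = u i"
proof -
  let ?A = "\<lambda>i j. k (xs i) (xs j) + (if i = j then real n * lam else 0)"
  obtain c where c: "\<forall>i<n. (\<Sum>j<n. ?A i j * c j) = u i"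
    using ridge_system(1)[OF k lam n, where xs=xs] by blast
  show ?thesis
  proof
    fix x
    have "(\<Sum>i<n. krr_weights k n lam xs x i * u i) =
        (\<Sum>i<n. \<Sum>j<n. krr_weights k n lam xs x i * (?A i j * c j))"
      using c by (simp flip: sum_distrib_left)
    also have "\<dots> = (\<Sum>j<n. \<Sum>i<n. krr_weights k n lam xs x i * (?A i j * c j))"
      by (rule sum.swap)
    also have "\<dots> = (\<Sum>j<n. c j * (\<Sum>i<n. ?A j i * krr_weights k n lam xs x i))"
      unfolding sum_distrib_left
      by (intro sum.cong refl) (auto simp: pd_kernel_sym[OF k] ac_simps)
    also have "\<dots> = (\<Sum>j<n. c j * k x (xs j))"
      using krr_weights_system[OF k lam n] by (intro sum.cong refl arg_cong2[where f="(*)"]) simp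
    finally show "(\<Sum>i<n. krr_weights k n lam xs x i * u i) = (\<Sum>j<n. c j * k x (xs j))" .
  next
    fix i assume "i < n"
    have "?A i j * c j = c j * k (xs i) (xs j) + (if i = j then real n * lam * c i else 0)" for j
      by (simp add: algebra_simps)
    then show "(\<Sum>j<n. c j * k (xs i) (xs j)) + real n * lam * c i = u i"
      using c[rule_format, OF \<open>i < n\<close>] \<open>i < n\<close> by (simp add: sum.distrib)
  qed
qed

text \<open>The i-th weight is the regressor for the i-th unit response vector, and the representer
  form exhibits it as a finite combination of kernel sections.\<close>

lemma krr_weights_continuous:
  fixes k :: "'x::topological_space \<Rightarrow> 'x \<Rightarrow> real"
  assumes k: "pd_kernel k" and lam: "0 < lam" and n: "0 < n" and i: "i < n"
    and cont: "\<And>y. continuous_on UNIV (\<lambda>x. k x y)"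
  shows "continuous_on UNIV (\<lambda>x. krr_weights k n lam xs x i)"
proof -
  obtain c where c: "\<And>x. (\<Sum>m<n. krr_weights k n lam xs x m * (if m = i then 1 else 0)) = (\<Sum>j<n. c j * k x (xs j))"
    and "\<And>m. m < n \<Longrightarrow> (\<Sum>j<n. c j * k (xs m) (xs j)) + real n * lam * c m = (if m = i then 1 else 0)"
    by (rule krr_representer[OF k lam n, where u="\<lambda>m. if m = i then 1 else 0" and xs=xs]) (rule that)
  have "(\<lambda>x. krr_weights k n lam xs x i) = (\<lambda>x. \<Sum>j<n. c j * k x (xs j))"
    using i by (simp add: fun_eq_iff if_distrib[of "(*) _"] flip: c cong: if_cong)
  then show ?thesis by (simp only:) (intro continuous_intros cont)
qed

section \<open>Feature expansion of a continuous kernel\<close>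

lemma compact_UNIV_dense_sequence:
  assumes "compact (UNIV :: 'x::metric_space set)"
  obtains z :: "nat \<Rightarrow> 'x::metric_space" where "\<And>x e. 0 < e \<Longrightarrow> \<exists>j. dist x (z j) < e"
proof -
  have "\<forall>n. \<exists>F::'x set. finite F \<and> UNIV \<subseteq> (\<Union>x\<in>F. ball x (1 / real (Suc n)))"
    using assms unfolding compact_eq_totally_bounded by simp
  then obtain F :: "nat \<Rightarrow> 'x set"
    where F: "\<And>n. finite (F n)" "\<And>n. UNIV \<subseteq> (\<Union>x\<in>F n. ball x (1 / real (Suc n)))"
    by metis
  define D where "D = (\<Union>n. F n)"
  have D: "countable D" using F by (auto simp: D_def intro: countable_finite)
  have dense: "\<exists>y\<in>D. dist x y < e" if "0 < e" for x and e :: real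
  proof -
    obtain n where "1 / real (Suc n) < e" using nat_approx_posE[OF \<open>0 < e\<close>] by blast
    moreover obtain y where "y \<in> F n" "dist y x < 1 / real (Suc n)"
      using subsetD[OF F(2)[of n] UNIV_I[of x]] by (auto simp del: of_nat_Suc)
    ultimately show ?thesis by (auto simp: D_def dist_commute intro!: bexI[of _ y])
  qed
  have "D \<noteq> {}" using dense[of 1 undefined] by auto
  show ?thesis
  proof
    fix x :: 'x and e :: real assume "0 < e"
    from dense[OF this] obtain y where y: "y \<in> D" "dist x y < e" by blast
    have "\<exists>j. from_nat_into D j = y" using from_nat_into_surj[OF D y(1)] .
    then show "\<exists>j. dist x (from_nat_into D j) < e" using y by auto
  qed
qed

section \<open>Cauchy-Schwarz and Schur complements for positive definite kernels\<close>

lemma pd_kernel_finite_sum: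
  fixes xs :: "'i \<Rightarrow> 'x"
  assumes k: "pd_kernel k" and I: "finite I"
  shows "0 \<le> (\<Sum>i\<in>I. \<Sum>j\<in>I. c i * c j * k (xs i) (xs j))"
proof -
  obtain f where f: "bij_betw f {..<card I} I"
    using I by (metis bij_betw_from_nat_into_finite)
  have "(\<Sum>i\<in>I. \<Sum>j\<in>I. c i * c j * k (xs i) (xs j)) =
      (\<Sum>i<card I. \<Sum>j<card I. c (f i) * c (f j) * k (xs (f i)) (xs (f j)))"
    using f by (simp add: sum.reindex_bij_betw[OF f, symmetric])
  also have "\<dots> \<ge> 0"
    using k unfolding pd_kernel_def by (elim conjE allE)
  finally show ?thesis .
qed

lemma pd_kernel_diag: "pd_kernel k \<Longrightarrow> 0 \<le> k x x"
  using pd_kernel_finite_sum[of k "{()}" "\<lambda>_. 1" "\<lambda>_. x"] by simp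

lemma pd_kernel_Cauchy_Schwarz:
  assumes k: "pd_kernel k"
  shows "(k x y)\<^sup>2 \<le> k x x * k y y"
proof -
  have sym: "k y x = k x y" using k by (simp add: pd_kernel_def)
  have q: "0 \<le> s\<^sup>2 * k x x + 2 * s * t * k x y + t\<^sup>2 * k y y" for s t
    using pd_kernel_finite_sum[OF k, of UNIV "\<lambda>b. if b then s else t" "\<lambda>b. if b then x else y"] sym
    by (simp add: UNIV_bool power2_eq_square algebra_simps)
  show ?thesis
  proof (cases "k y y = 0")
    case True
    have "k x y = 0"
    proof (rule ccontr)
      assume "k x y \<noteq> 0"
      \<comment> \<open>With \<open>k y y = 0\<close> the form is affine in \<open>t\<close>, and
        this \<open>t\<close> makes it equal to -1.\<close>
      then show False using q[of 1 "- (k x x + 1) / (2 * k x y)"] True by (simp add: field_simps)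
    qed
    then show ?thesis using True by simp
  next
    case False
    then have pos: "k y y > 0" using pd_kernel_diag[OF k, of y] by simp
    have "0 \<le> (k y y)\<^sup>2 * k x x + 2 * k y y * (- k x y) * k x y + (- k x y)\<^sup>2 * k y y"
      by (rule q)
    also have "\<dots> = k y y * (k x x * k y y - (k x y)\<^sup>2)"
      by (simp add: power2_eq_square algebra_simps)
    finally show ?thesis using pos by (simp add: zero_le_mult_iff)
  qed
qed

text \<open>One step of the Cholesky decomposition with pivot \<open>z\<close>; if the pivot vanishes, so does the
  whole row \<open>k z\<close>, and \<open>x / 0 = 0\<close> makes the step trivial.\<close>

definition pivot_fun :: "('x \<Rightarrow> 'x \<Rightarrow> real) \<Rightarrow> 'x \<Rightarrow> 'x \<Rightarrow> real" where
  "pivot_fun k z x = k z x / sqrt (k z z)"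

definition schur_kernel :: "('x \<Rightarrow> 'x \<Rightarrow> real) \<Rightarrow> 'x \<Rightarrow> 'x \<Rightarrow> 'x \<Rightarrow> real" where
  "schur_kernel k z x y = k x y - pivot_fun k z x * pivot_fun k z y"

text \<open>The form of the Schur kernel at given points is the form of \<open>k\<close> at these
  points together with \<open>z\<close>, minimised over the weight of \<open>z\<close>.\<close>

lemma pd_kernel_schur:
  assumes k: "pd_kernel k"
  shows "pd_kernel (schur_kernel k z)"
proof -
  have sym: "k x y = k y x" for x y using k by (simp add: pd_kernel_def)
  have pos: "0 \<le> (\<Sum>i<n. \<Sum>j<n. c i * c j * schur_kernel k z (xs i) (xs j))"
    for n :: nat and c and xs :: "nat \<Rightarrow> 'a"
  proof (cases "k z z = 0")
    case True
    then show ?thesis using k by (simp add: schur_kernel_def pivot_fun_def pd_kernel_def)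
  next
    case False
    then have zz: "k z z > 0" using pd_kernel_diag[OF k, of z] by simp
    define s where "s = (\<Sum>i<n. c i * k z (xs i))"
    \<comment> \<open>\<open>- s / k z z\<close> is the minimising weight of the added point
      \<open>z\<close>, which is stored at index \<open>n\<close>.\<close>
    define d where "d i = (if i < n then c i else - s / k z z)" for i
    define y where "y i = (if i < n then xs i else z)" for i
    have "0 \<le> (\<Sum>i<Suc n. \<Sum>j<Suc n. d i * d j * k (y i) (y j))"
      using k unfolding pd_kernel_def by (elim conjE allE)
    also have "\<dots> = (\<Sum>i<n. \<Sum>j<n. c i * c j * k (xs i) (xs j))
        + 2 * (- s / k z z) * s + (s / k z z)\<^sup>2 * k z z"
    proof -
      have split: "(\<Sum>i<Suc n. \<Sum>j<Suc n. f i j) =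
          (\<Sum>i<n. \<Sum>j<n. f i j) + (\<Sum>i<n. f i n) + (\<Sum>j<n. f n j) + f n n" for f :: "nat \<Rightarrow> nat \<Rightarrow> real"
        by (simp add: sum.distrib)
      have "(\<Sum>i<n. d i * d n * k (y i) (y n)) = - s / k z z * (\<Sum>i<n. c i * k z (xs i))"
        unfolding sum_distrib_left by (intro sum.cong refl) (simp add: d_def y_def sym[of "xs _" z] ac_simps)
      moreover have "(\<Sum>j<n. d n * d j * k (y n) (y j)) = - s / k z z * (\<Sum>i<n. c i * k z (xs i))"
        unfolding sum_distrib_left by (intro sum.cong refl) (simp add: d_def y_def ac_simps)
      ultimately show ?thesis
        unfolding split s_def[symmetric] by (simp add: d_def y_def power2_eq_square)
    qed
    also have "\<dots> = (\<Sum>i<n. \<Sum>j<n. c i * c j * k (xs i) (xs j)) - s * s / k z z"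
      using zz by (simp add: power2_eq_square field_simps)
    also have "s * s / k z z = (\<Sum>i<n. \<Sum>j<n. c i * c j * (pivot_fun k z (xs i) * pivot_fun k z (xs j)))"
      using zz by (simp add: s_def pivot_fun_def sum_product sum_divide_distrib real_sqrt_mult_self ac_simps)
    finally show ?thesis
      by (simp add: schur_kernel_def right_diff_distrib sum_subtractf)
  qed
  then show ?thesis unfolding pd_kernel_def
    by (auto simp: schur_kernel_def sym[of _ _])
qed

text \<open>A pivot step annihilates the row of its pivot and leaves earlier annihilated rows at
  zero, because their entry against the new pivot is zero as well. For a vanishing pivot,
  Cauchy-Schwarz shows that the row was zero already.\<close>

lemma schur_kernel_zero:
  assumes k: "pd_kernel k" and "k w x = 0 \<or> w = z" and "w \<noteq> z \<Longrightarrow> k z w = 0"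
  shows "schur_kernel k z w x = 0"
proof (cases "w = z")
  case True
  have "k z x = 0" if "k z z = 0"
    using pd_kernel_Cauchy_Schwarz[OF k, of z x] that by simp
  then show ?thesis using True pd_kernel_diag[OF k, of z]
    by (auto simp: schur_kernel_def pivot_fun_def)
next
  case False
  then show ?thesis using assms by (auto simp: schur_kernel_def pivot_fun_def)
qed

text \<open>The pivots run through a dense sequence. The residual kernel \<open>K m\<close> vanishes
  in the rows of the pivots used so far, so \<open>K m x x\<close> is the squared residual distance
  from \<open>x\<close> to any of them. Pivoting only decreases these distances, and continuity of
  \<open>k\<close> makes them small for a pivot near \<open>x\<close>. Cauchy-Schwarz then treats
  the off-diagonal. The expansion plays the part of Mercer's theorem without eigenfunctions or a
  reference measure.\<close>

proposition pd_kernel_features: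
  fixes k :: "'x::metric_space \<Rightarrow> 'x \<Rightarrow> real"
  assumes comp: "compact (UNIV :: 'x set)" and k: "pd_kernel k"
    and cont: "continuous_on UNIV (\<lambda>(x, y). k x y)"
  obtains e :: "nat \<Rightarrow> 'x \<Rightarrow> real"
  where "\<And>m. continuous_on UNIV (e m)" and "\<And>x y. (\<lambda>m. e m x * e m y) sums k x y"
proof -
  obtain z :: "nat \<Rightarrow> 'x" where z: "\<And>x e. 0 < e \<Longrightarrow> \<exists>j. dist x (z j) < e"
    using compact_UNIV_dense_sequence[OF comp] by blast
  define K where "K = rec_nat k (\<lambda>m K. schur_kernel K (z m))"
  have K0: "K 0 = k" and KS: "K (Suc m) = schur_kernel (K m) (z m)" for m
    by (simp_all add: K_def)
  define e where "e m = pivot_fun (K m) (z m)" for m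
  have pd: "pd_kernel (K m)" for m
    by (induction m) (auto simp: K0 KS k pd_kernel_schur)
  have KSx: "K (Suc m) x y = K m x y - e m x * e m y" for m x y
    by (simp add: KS schur_kernel_def e_def)
  have K_eq: "K m x y = k x y - (\<Sum>i<m. e i x * e i y)" for m x y
    by (induction m) (auto simp: K0 KSx)
  have kc: "continuous_on UNIV (k x)" for x
    using continuous_on_compose2[OF cont, of UNIV "\<lambda>y. (x, y)"] by (simp add: continuous_on_Pair)
  have e_cont: "continuous_on UNIV (e m)" if "continuous_on UNIV (K m (z m))" for m
    using that unfolding e_def pivot_fun_def divide_inverse by (rule continuous_on_mult_right)
  have Kc: "continuous_on UNIV (K m x)" for m x
  proof (induction m arbitrary: x)
    case 0
    then show ?case by (simp add: K0 kc)
  next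
    case (Suc m)
    then show ?case unfolding KSx by (intro continuous_intros e_cont)
  qed
  have ec: "continuous_on UNIV (e m)" for m by (rule e_cont[OF Kc])
  have Kz: "K m (z j) x = 0" if "j < m" for m j x
    using that
  proof (induction m arbitrary: x)
    case 0
    then show ?case by simp
  next
    case (Suc m)
    have j: "j < m \<or> j = m" using Suc.prems by auto
    have "K m (z m) (z j) = K m (z j) (z m)" using pd[of m] by (simp add: pd_kernel_def)
    then show ?case unfolding KS
      using Suc.IH pd[of m] j by (intro schur_kernel_zero) auto
  qed
  have diag: "(\<lambda>m. K m x x) \<longlonglongrightarrow> 0" for x
  proof (rule LIMSEQ_I)
    fix r :: real assume "0 < r"
    \<comment> \<open>The squared RKHS distance between the kernel sections at \<open>x\<close> and
      \<open>y\<close>.\<close>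
    have "continuous_on UNIV (\<lambda>y. k x x - 2 * k x y + k y y)"
      by (intro continuous_intros kc continuous_on_compose2[OF cont, of UNIV "\<lambda>y. (y, y)", simplified])
    then have "((\<lambda>y. k x x - 2 * k x y + k y y) \<longlongrightarrow> k x x - 2 * k x x + k x x) (at x)"
      unfolding continuous_on_def by blast
    then have "\<forall>\<^sub>F y in at x. k x x - 2 * k x y + k y y < r"
      using \<open>0 < r\<close> by (intro order_tendstoD(2)) auto
    then obtain d where d: "d > 0" "\<And>y. y \<noteq> x \<Longrightarrow> dist y x < d \<Longrightarrow> k x x - 2 * k x y + k y y < r"
      unfolding eventually_at by auto
    obtain j where "dist x (z j) < d" using z d(1) by blast
    \<comment> \<open>The punctured neighbourhood excludes \<open>z j = x\<close>, where the
      distance is 0.\<close>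
    then have j: "k x x - 2 * k x (z j) + k (z j) (z j) < r"
      using d(2)[of "z j"] \<open>0 < r\<close> by (cases "z j = x") (auto simp: dist_commute)
    have "norm (K m x x - 0) < r" if "j < m" for m
    proof -
      have sym: "K m x (z j) = 0" using Kz[OF that] pd[of m] by (simp add: pd_kernel_def)
      have "K m x x = K m x x - 2 * K m x (z j) + K m (z j) (z j)"
        using sym Kz[OF that] by simp
      also have "\<dots> = k x x - 2 * k x (z j) + k (z j) (z j) - (\<Sum>i<m. (e i x - e i (z j))\<^sup>2)"
        unfolding K_eq power2_diff by (simp add: sum.distrib sum_subtractf sum_distrib_left power2_eq_square ac_simps)
      also have "\<dots> \<le> k x x - 2 * k x (z j) + k (z j) (z j)"
        by (simp add: sum_nonneg)
      finally have "K m x x \<le> k x x - 2 * k x (z j) + k (z j) (z j)" .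
      then show ?thesis using j pd_kernel_diag[OF pd, of m x] by simp
    qed
    then show "\<exists>no. \<forall>n\<ge>no. norm (K n x x - 0) < r" by (meson Suc_le_lessD)
  qed
  show ?thesis
  proof (rule that[OF ec])
    fix x y
    have "(\<lambda>m. K m x y) \<longlonglongrightarrow> 0"
    proof (rule Lim_null_comparison)
      show "\<forall>\<^sub>F m in sequentially. norm (K m x y) \<le> sqrt (K m x x * K m y y)"
        using pd_kernel_Cauchy_Schwarz[OF pd] by (auto intro!: always_eventually real_le_rsqrt)
      show "(\<lambda>m. sqrt (K m x x * K m y y)) \<longlonglongrightarrow> 0"
        using tendsto_real_sqrt[OF tendsto_mult[OF diag[of x] diag[of y]]] by simp
    qed
    then have "(\<lambda>m. k x y - K m x y) \<longlonglongrightarrow> k x y - 0" by (intro tendsto_intros)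
    then show "(\<lambda>m. e m x * e m y) sums k x y" by (simp add: sums_def K_eq)
  qed
qed

section \<open>A strong law with rate for square-summable families\<close>

text \<open>Extracts the sample of one task from the family indexed by pairs of task and
  number.\<close>

lemma (in prob_space) indep_vars_reindex:
  assumes "inj f" and "indep_vars N X (range f)"
  shows "indep_vars (\<lambda>j. N (f j)) (\<lambda>j. X (f j)) UNIV"
  unfolding indep_vars_def2
proof (intro conjI ballI)
  show "random_variable (N (f j)) (X (f j))" for j
    using assms(2) by (auto simp: indep_vars_def2)
  have *: "indep_sets (\<lambda>i. {X i -` A \<inter> space M |A. A \<in> sets (N i)}) (range f)"
    using assms(2) by (auto simp: indep_vars_def2)
  show "indep_sets (\<lambda>j. {X (f j) -` A \<inter> space M |A. A \<in> sets (N (f j))}) UNIV"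
  proof (rule indep_setsI)
    show "{X (f i) -` A \<inter> space M |A. A \<in> sets (N (f i))} \<subseteq> events" for i
      using * unfolding indep_sets_def by blast
    fix A J assume J: "J \<noteq> {}" "finite J" and A: "\<forall>j\<in>J. A j \<in> {X (f j) -` A \<inter> space M |A. A \<in> sets (N (f j))}"
    have "prob (\<Inter>i\<in>f ` J. A (inv f i)) = (\<Prod>i\<in>f ` J. prob (A (inv f i)))"
      using J A \<open>inj f\<close> by (intro indep_setsD[OF *]) auto
    then show "prob (\<Inter>j\<in>J. A j) = (\<Prod>j\<in>J. prob (A j))"
      using \<open>inj f\<close> by (simp add: prod.reindex inj_on_def)
  qed
qed

lemma (in prob_space) second_moment_sum_indep:
  fixes X :: "nat \<Rightarrow> 'a \<Rightarrow> real"
  assumes indep: "indep_vars (\<lambda>_. borel) X UNIV"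
    and bound: "\<And>i w. w \<in> space M \<Longrightarrow> \<bar>X i w\<bar> \<le> B"
    and mean: "\<And>i. expectation (X i) = 0" and sq: "\<And>i. expectation (\<lambda>w. (X i w)\<^sup>2) \<le> v"
  shows "expectation (\<lambda>w. (\<Sum>i<n. X i w)\<^sup>2) \<le> real n * v"
proof (induction n)
  case 0
  then show ?case by simp
next
  case (Suc n)
  have [measurable]: "random_variable borel (X i)" for i
    using indep by (auto simp: indep_vars_def)
  have bS: "\<bar>\<Sum>i<n. X i w\<bar> \<le> real n * B" if "w \<in> space M" for n w
    using order_trans[OF sum_abs sum_bounded_above[of "{..<n}" "\<lambda>i. \<bar>X i w\<bar>" B]] bound[OF that] by simp
  have [simp]: "integrable M (X n)"
    by (rule integrable_const_bound[of _ B]) (auto simp: bound)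
  have [simp]: "integrable M (\<lambda>w. \<Sum>i<n. X i w)"
    by (rule integrable_const_bound[of _ "real n * B"]) (auto simp: bS)
  have B0: "0 \<le> B" using bound not_empty by (force intro: order_trans[OF abs_ge_zero])
  have [simp]: "integrable M (\<lambda>w. (X n w)\<^sup>2)"
    using power_mono[OF bound abs_ge_zero, of _ n 2]
    by (intro integrable_const_bound[of _ "B\<^sup>2"]) auto
  have [simp]: "integrable M (\<lambda>w. (\<Sum>i<n. X i w)\<^sup>2)"
    using power_mono[OF bS abs_ge_zero, of _ n 2]
    by (intro integrable_const_bound[of _ "(real n * B)\<^sup>2"]) auto
  have "indep_var borel (X n) borel (\<lambda>w. \<Sum>i<n. X i w)"
    using indep by (intro indep_vars_sum indep_vars_subset[OF indep]) auto
  then have prod: "expectation (\<lambda>w. X n w * (\<Sum>i<n. X i w)) = 0"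
    and [simp]: "integrable M (\<lambda>w. X n w * (\<Sum>i<n. X i w))"
    by (simp_all add: indep_var_lebesgue_integral indep_var_integrable mean)
  have "expectation (\<lambda>w. (\<Sum>i<Suc n. X i w)\<^sup>2) =
      expectation (\<lambda>w. (\<Sum>i<n. X i w)\<^sup>2 + 2 * (X n w * (\<Sum>i<n. X i w)) + (X n w)\<^sup>2)"
    by (intro Bochner_Integration.integral_cong refl) (simp add: power2_eq_square algebra_simps)
  also have "\<dots> = expectation (\<lambda>w. (\<Sum>i<n. X i w)\<^sup>2) + expectation (\<lambda>w. (X n w)\<^sup>2)"
    using prod by simp
  finally show ?case using Suc.IH sq[of n] by (simp add: algebra_simps)
qed

text \<open>The third powers are sparse enough for Chebyshev's inequality to be summable at the rate
  \<open>n\<^sup>3\<^sup>/\<^sup>4\<close> and dense enough for the partial sums in between to be controlled trivially.\<close>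

lemma cube_interval:
  fixes n :: nat
  obtains m where "m ^ 3 \<le> n" "n < (Suc m) ^ 3"
proof -
  define m where "m = Max {m. m ^ 3 \<le> n}"
  have fin: "finite {m. m ^ 3 \<le> n}"
  proof (rule finite_subset)
    have "m \<le> m ^ 3" for m :: nat by (cases "m = 0") (auto simp: self_le_power)
    then show "{m. m ^ 3 \<le> n} \<subseteq> {..n}" using order_trans by fastforce
  qed simp
  have "m \<in> {m. m ^ 3 \<le> n}" unfolding m_def by (rule Max_in[OF fin]) (auto intro: exI[of _ 0])
  moreover have "\<not> Suc m ^ 3 \<le> n"
    using Max_ge[OF fin, of "Suc m"] by (auto simp: m_def[symmetric])
  ultimately show ?thesis using that by auto
qed

text \<open>A strong law in the sequence space l2, read coordinatewise: the pointwise bound on the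
  square sums bounds the total variance of all coordinates by \<open>B\<^sup>2\<close>, so the
  number of coordinates never enters. The threshold \<open>m\<close> precedes \<open>J\<close>,
  which makes the bound uniform over finite sets of coordinates.\<close>

proposition (in prob_space) l2_strong_law_rate:
  fixes W :: "nat \<Rightarrow> 'b \<Rightarrow> real" and Z :: "nat \<Rightarrow> 'a \<Rightarrow> 'b"
  assumes indep: "indep_vars (\<lambda>_. \<rho>) Z UNIV" and distr: "\<And>i. distr M \<rho> (Z i) = \<rho>"
    and W[measurable]: "\<And>p. W p \<in> borel_measurable \<rho>"
    and bound: "\<And>z J. z \<in> space \<rho> \<Longrightarrow> finite J \<Longrightarrow> (\<Sum>p\<in>J. (W p z)\<^sup>2) \<le> B\<^sup>2" and B: "0 \<le> B"
  shows "AE w in M. \<forall>\<eta>>0. \<exists>m. \<forall>n\<ge>m. \<forall>J. finite J \<longrightarrow>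
    L2_set (\<lambda>p. \<Sum>i<n. W p (Z i w) - (\<integral>z. W p z \<partial>\<rho>)) J \<le> \<eta> * real n powr (3/4)"
proof -
  have Z[measurable]: "Z i \<in> measurable M \<rho>" for i
    using indep by (auto simp: indep_vars_def)
  interpret \<rho>: prob_space \<rho>
    using prob_space_distr[OF Z[of 0]] by (simp add: distr)
  define \<mu> where "\<mu> p = (\<integral>z. W p z \<partial>\<rho>)" for p
  define \<xi> where "\<xi> p i w = W p (Z i w) - \<mu> p" for p i w
  define S where "S p n w = (\<Sum>i<n. \<xi> p i w)" for p n w
  have Wb: "\<bar>W p z\<bar> \<le> B" if "z \<in> space \<rho>" for p z
    using bound[OF that, of "{p}"] B by (simp add: abs_le_square_iff[symmetric])
  have Wi[simp]: "integrable \<rho> (W p)" for p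
    by (rule \<rho>.integrable_const_bound[of _ B]) (auto simp: Wb)
  have W2i[simp]: "integrable \<rho> (\<lambda>z. (W p z)\<^sup>2)" for p
    by (rule \<rho>.integrable_const_bound[of _ "B\<^sup>2"]) (use bound[of _ "{p}"] in auto)
  have \<mu>b: "\<bar>\<mu> p\<bar> \<le> B" for p
    using order_trans[OF integral_abs_bound[of \<rho> "W p"] \<rho>.integral_le_const[of "\<lambda>z. \<bar>W p z\<bar>" B]] by (simp add: \<mu>_def Wb)
  define v where "v p = (\<integral>z. (W p z)\<^sup>2 \<partial>\<rho>)" for p
  have v0: "0 \<le> v p" for p by (simp add: v_def)
  have sum_v: "(\<Sum>p\<in>J. v p) \<le> B\<^sup>2" if "finite J" for J
  proof -
    have "(\<Sum>p\<in>J. v p) = (\<integral>z. (\<Sum>p\<in>J. (W p z)\<^sup>2) \<partial>\<rho>)" by (simp add: v_def)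
    also have "\<dots> \<le> B\<^sup>2" using bound[OF _ that] by (intro \<rho>.integral_le_const) auto
    finally show ?thesis .
  qed
  have \<mu>v: "(\<mu> p)\<^sup>2 \<le> v p" for p
    using \<rho>.variance_positive[of "W p"] \<rho>.variance_eq[of "W p"] by (simp add: \<mu>_def v_def)
  have \<xi>m[measurable]: "\<xi> p i \<in> borel_measurable M" for p i
    unfolding \<xi>_def by measurable
  have moment: "expectation (\<lambda>w. (S p n w)\<^sup>2) \<le> real n * v p" for p n
    unfolding S_def
  proof (rule second_moment_sum_indep)
    show "indep_vars (\<lambda>_. borel) (\<xi> p) UNIV"
      unfolding \<xi>_def by (rule indep_vars_compose2[OF indep, where Y="\<lambda>_ z. W p z - \<mu> p"]) measurable
    show "\<bar>\<xi> p i w\<bar> \<le> B + B" if "w \<in> space M" for i w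
      using Wb[OF measurable_space[OF Z that], of p i] \<mu>b[of p] by (simp add: \<xi>_def)
    have int: "expectation (\<lambda>w. g (Z i w)) = (\<integral>z. g z \<partial>\<rho>)" if [measurable]: "g \<in> borel_measurable \<rho>"
      for g :: "'b \<Rightarrow> real" and i
      using integral_distr[OF Z that, of i] by (simp add: distr)
    show "expectation (\<xi> p i) = 0" for i
      using int[of "\<lambda>z. W p z - \<mu> p" i] by (simp add: \<xi>_def[abs_def] \<mu>_def \<rho>.prob_space)
    have "expectation (\<lambda>w. (\<xi> p i w)\<^sup>2) = v p - (\<mu> p)\<^sup>2" for i
      using int[of "\<lambda>z. (W p z - \<mu> p)\<^sup>2" i] \<rho>.variance_eq[of "W p"] by (simp add: \<xi>_def \<mu>_def v_def)
    then show "expectation (\<lambda>w. (\<xi> p i w)\<^sup>2) \<le> v p" for i by simp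
  qed
  have Sm[measurable]: "S p n \<in> borel_measurable M" for p n unfolding S_def by measurable
  have Sb: "\<bar>S p n w\<bar> \<le> real n * (B + B)" if "w \<in> space M" for p n w
  proof -
    have "\<bar>\<xi> p i w\<bar> \<le> B + B" for i
      using Wb[OF measurable_space[OF Z that], of p i] \<mu>b[of p] by (simp add: \<xi>_def)
    then have "(\<Sum>i<n. \<bar>\<xi> p i w\<bar>) \<le> real n * (B + B)"
      using sum_bounded_above[of "{..<n}" "\<lambda>i. \<bar>\<xi> p i w\<bar>" "B + B"] by simp
    then show ?thesis unfolding S_def using sum_abs[of "\<lambda>i. \<xi> p i w" "{..<n}"] by linarith
  qed
  have S2i: "integrable M (\<lambda>w. (S p n w)\<^sup>2)" for p n
    using power_mono[OF Sb abs_ge_zero, of _ p n 2]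
    by (intro integrable_const_bound[of _ "(real n * (B + B))\<^sup>2"]) auto
  \<comment> \<open>At n = m^3 the squared target n^(3/2) is m^(9/2), and the second moment of order
    m^3 leaves the summable m^(-3/2). For n = m^q summability requires q > 2, and gaps of order
    m^(q-1) stay below n^(3/4) only if q < 4, so 3 is the only integer choice.\<close>
  define c where "c m = real m powr (-9/2)" for m :: nat
  have nn: "(\<integral>\<^sup>+w. ennreal (c m * (S p (m^3) w)\<^sup>2) \<partial>M) \<le> ennreal (real m powr (-3/2) * v p)" for m p
  proof -
    have "(\<integral>\<^sup>+w. ennreal (c m * (S p (m^3) w)\<^sup>2) \<partial>M) = ennreal (c m * expectation (\<lambda>w. (S p (m^3) w)\<^sup>2))"
      using S2i by (subst nn_integral_eq_integral) (auto simp: c_def)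
    also have "\<dots> \<le> ennreal (c m * (real (m ^ 3) * v p))"
      by (intro ennreal_leI mult_left_mono moment) (simp add: c_def)
    also have "c m * (real (m ^ 3) * v p) = real m powr (-3/2) * v p"
    proof (cases "m = 0")
      case False
      then have "real m ^ 3 = real m powr 3" by (simp add: powr_numeral)
      then have "c m * real m ^ 3 = real m powr (-9/2) * real m powr 3" by (simp only: c_def)
      also have "\<dots> = real m powr (-3/2)" by (simp only: powr_add[symmetric]) simp
      finally have "c m * real m ^ 3 = real m powr (-3/2)" .
      then show ?thesis by (simp add: ac_simps)
    qed (simp add: c_def)
    finally show ?thesis .
  qed
  \<comment> \<open>With values in \<open>ennreal\<close>, both sums can be exchanged with the
    integral before any convergence is known.\<close>
  define G where "G m w = (\<Sum>p. ennreal (c m * (S p (m^3) w)\<^sup>2))" for m w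
  have "(\<integral>\<^sup>+w. (\<Sum>m. G m w) \<partial>M) = (\<Sum>m. \<Sum>p. (\<integral>\<^sup>+w. ennreal (c m * (S p (m^3) w)\<^sup>2) \<partial>M))"
    unfolding G_def by (simp add: nn_integral_suminf)
  also have "\<dots> \<le> (\<Sum>m. \<Sum>p. ennreal (real m powr (-3/2) * v p))"
    by (intro suminf_le nn) auto
  also have "\<dots> \<le> (\<Sum>m. ennreal (real m powr (-3/2) * B\<^sup>2))"
  proof (intro suminf_le)
    fix m
    have "summable v" using sum_v by (intro summableI_nonneg_bounded[where x="B\<^sup>2"] v0) auto
    then have "(\<Sum>p. ennreal (real m powr (-3/2) * v p)) = ennreal (real m powr (-3/2) * (\<Sum>p. v p))"
      using v0 by (subst suminf_ennreal2) (auto simp: suminf_mult)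
    also have "\<dots> \<le> ennreal (real m powr (-3/2) * B\<^sup>2)"
      using sum_v \<open>summable v\<close> by (intro ennreal_leI mult_left_mono suminf_le_const) auto
    finally show "(\<Sum>p. ennreal (real m powr (-3/2) * v p)) \<le> ennreal (real m powr (-3/2) * B\<^sup>2)" .
  qed auto
  also have "\<dots> < \<infinity>"
  proof -
    have "summable (\<lambda>m. real m powr (-3/2) * B\<^sup>2)"
      by (intro summable_mult2) (simp add: summable_real_powr_iff)
    then show ?thesis by (subst suminf_ennreal2) auto
  qed
  finally have "(\<integral>\<^sup>+w. (\<Sum>m. G m w) \<partial>M) \<noteq> \<infinity>" by simp
  then have "AE w in M. (\<Sum>m. G m w) \<noteq> \<infinity>"
    by (intro nn_integral_noteq_infinite) (auto simp: G_def)
  then show ?thesis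
  proof (rule AE_mp, intro AE_I2 impI allI)
    fix w and \<eta> :: real
    assume w: "w \<in> space M" and fin: "(\<Sum>m. G m w) \<noteq> \<infinity>" and \<eta>: "0 < \<eta>"
    let ?N = "\<lambda>n. L2_set (\<lambda>p. S p n w)"
    define g where "g m = enn2real (G m w)" for m
    have "G m w \<le> (\<Sum>m. G m w)" for m
      using sum_le_suminf[of "\<lambda>m. G m w" "{m}"] by simp
    then have "G m w < top" for m
      using fin by (metis infinity_ennreal_def le_less_trans less_top)
    then have g: "ennreal (g m) = G m w" for m
      by (simp add: g_def)
    \<comment> \<open>This takes the place of Borel-Cantelli: the normalised squared norms along the
      cubes have a finite sum for almost every \<open>w\<close>, hence tend to 0.\<close>
    have "summable g"
      by (rule summable_suminf_not_top) (use fin in \<open>simp_all add: g, simp add: g_def\<close>)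
    then have "\<forall>\<^sub>F m in sequentially. g m < (\<eta> / 2)\<^sup>2"
      using \<eta> by (intro order_tendstoD(2)[OF summable_LIMSEQ_zero]) simp_all
    then have ev1: "\<forall>\<^sub>F m in sequentially. G m w < ennreal ((\<eta> / 2)\<^sup>2)"
    proof (rule eventually_mono)
      show "G m w < ennreal ((\<eta> / 2)\<^sup>2)" if "g m < (\<eta> / 2)\<^sup>2" for m
        unfolding g[symmetric] using \<eta> that by (intro ennreal_lessI) simp_all
    qed
    have cube: "?N (m ^ 3) J \<le> \<eta> / 2 * real m powr (9/4)"
      if "G m w < ennreal ((\<eta> / 2)\<^sup>2)" "finite J" "m > 0" for m J
    proof -
      have "ennreal (\<Sum>p\<in>J. c m * (S p (m^3) w)\<^sup>2) = (\<Sum>p\<in>J. ennreal (c m * (S p (m^3) w)\<^sup>2))"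
        by (rule sum_ennreal[symmetric]) (simp add: c_def)
      also have "\<dots> \<le> G m w"
        unfolding G_def using \<open>finite J\<close> by (intro sum_le_suminf) simp_all
      also have "\<dots> \<le> ennreal ((\<eta> / 2)\<^sup>2)" using that by simp
      finally have "c m * (\<Sum>p\<in>J. (S p (m^3) w)\<^sup>2) \<le> (\<eta> / 2)\<^sup>2"
        by (subst (asm) ennreal_le_iff) (auto simp: sum_distrib_left)
      then have "(\<Sum>p\<in>J. (S p (m^3) w)\<^sup>2) \<le> (\<eta> / 2)\<^sup>2 * real m powr (9/2)"
        using \<open>m > 0\<close> by (simp add: c_def powr_minus field_simps)
      also have "real m powr (9/2) = (real m powr (9/4))\<^sup>2"
        by (simp add: power2_eq_square flip: powr_add)
      finally have "(\<Sum>p\<in>J. (S p (m^3) w)\<^sup>2) \<le> (\<eta> / 2 * real m powr (9/4))\<^sup>2"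
        by (simp only: power_mult_distrib)
      moreover have "0 \<le> \<eta> / 2 * real m powr (9/4)" using \<eta> by simp
      ultimately show ?thesis unfolding L2_set_def by (intro real_le_lsqrt)
    qed
    have step: "L2_set (\<lambda>p. \<xi> p i w) J \<le> 2 * B" if "finite J" for i J
    proof -
      have z: "Z i w \<in> space \<rho>" using measurable_space[OF Z w] .
      have "L2_set (\<lambda>p. W p (Z i w) + - \<mu> p) J \<le> L2_set (\<lambda>p. W p (Z i w)) J + L2_set (\<lambda>p. - \<mu> p) J"
        by (rule L2_set_triangle_ineq)
      moreover have "L2_set (\<lambda>p. W p (Z i w)) J \<le> B"
        using bound[OF z that] B by (auto simp: L2_set_def intro!: real_le_lsqrt sum_nonneg)
      moreover have "L2_set (\<lambda>p. - \<mu> p) J \<le> B"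
        using order_trans[OF sum_mono[OF \<mu>v] sum_v[OF that]] B
        by (auto simp: L2_set_def intro!: real_le_lsqrt sum_nonneg)
      ultimately show ?thesis by (simp add: \<xi>_def)
    qed
    have incr: "?N (n + d) J \<le> ?N n J + real d * (2 * B)" if "finite J" for n d J
    proof (induction d)
      case (Suc d)
      have "?N (n + Suc d) J \<le> ?N (n + d) J + L2_set (\<lambda>p. \<xi> p (n + d) w) J"
        using L2_set_triangle_ineq[of "\<lambda>p. S p (n + d) w" "\<lambda>p. \<xi> p (n + d) w" J] by (simp add: S_def)
      then show ?case using Suc step[OF that, of "n + d"] by (simp add: algebra_simps)
    qed simp
    \<comment> \<open>14 is 7 times 2: fewer than 7 m^2 increments, each of norm at most
      \<open>2 * B\<close>, follow the cube m^3 before the next one, and m^2 = o(m^(9/4)).\<close>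
    have ev2: "\<forall>\<^sub>F m in sequentially. 14 * B * real m ^ 2 \<le> \<eta> / 2 * real m powr (9/4)"
      using \<eta> by real_asymp
    from eventually_conj[OF ev1 eventually_conj[OF ev2 eventually_gt_at_top[of 0]]]
    obtain m0 where m0: "\<And>m. m \<ge> m0 \<Longrightarrow> G m w < ennreal ((\<eta> / 2)\<^sup>2)"
      "\<And>m. m \<ge> m0 \<Longrightarrow> 14 * B * real m ^ 2 \<le> \<eta> / 2 * real m powr (9/4)" "\<And>m. m \<ge> m0 \<Longrightarrow> 0 < m"
      unfolding eventually_sequentially by blast
    have "?N n J \<le> \<eta> * real n powr (3/4)" if n: "n \<ge> m0 ^ 3" and J: "finite J" for n J
    proof -
      obtain m where m: "m ^ 3 \<le> n" "n < (Suc m) ^ 3" by (rule cube_interval)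
      have "m0 \<le> m"
      proof (rule ccontr)
        assume "\<not> m0 \<le> m"
        then have "Suc m ^ 3 \<le> m0 ^ 3" by (intro power_mono) auto
        then show False using n m(2) by linarith
      qed
      note m' = m0[OF this]
      have "n - m ^ 3 \<le> 7 * m ^ 2"
      proof -
        have "n \<le> m ^ 3 + 3 * m ^ 2 + 3 * m" using m(2) by (simp add: power2_eq_square power3_eq_cube algebra_simps)
        moreover have "m \<le> m ^ 2" using m'(3) by (simp add: self_le_power)
        ultimately show ?thesis by linarith
      qed
      then have "real (n - m ^ 3) * (2 * B) \<le> real (7 * m ^ 2) * (2 * B)"
        using B by (intro mult_right_mono) (simp_all only: of_nat_le_iff)
      also have "\<dots> = 14 * B * real m ^ 2" by simp
      finally have "?N n J \<le> \<eta> / 2 * real m powr (9/4) + 14 * B * real m ^ 2"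
        using incr[OF J, of "m ^ 3" "n - m ^ 3"] m(1) cube[OF m'(1) J m'(3)]
        unfolding le_add_diff_inverse[OF m(1)] by linarith
      also have "\<dots> \<le> \<eta> * real m powr (9/4)" using m'(2) by simp
      also have "real m powr (9/4) = real (m ^ 3) powr (3/4)"
        using m'(3) by (simp add: powr_powr flip: powr_numeral)
      also have "\<eta> * \<dots> \<le> \<eta> * real n powr (3/4)"
        using of_nat_mono[OF m(1), where 'a=real] \<eta> by (intro mult_left_mono powr_mono2) simp_all
      finally show ?thesis .
    qed
    then show "\<exists>m. \<forall>n\<ge>m. \<forall>J. finite J \<longrightarrow>
        L2_set (\<lambda>p. \<Sum>i<n. W p (Z i w) - (\<integral>z. W p z \<partial>\<rho>)) J \<le> \<eta> * real n powr (3/4)"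
      unfolding S_def \<xi>_def \<mu>_def by blast
  qed
qed

text \<open>The l2 law for all products \<open>F m * F m'\<close>, enumerated by
  \<open>prod_decode\<close>. Their squares sum to the square of the sum of the
  \<open>(F m)\<^sup>2\<close>, so the bound on the features carries over.\<close>

corollary (in prob_space) gram_strong_law_rate:
  fixes F :: "nat \<Rightarrow> 'b \<Rightarrow> real" and Z :: "nat \<Rightarrow> 'a \<Rightarrow> 'b"
  assumes indep: "indep_vars (\<lambda>_. \<rho>) Z UNIV" and distr: "\<And>i. distr M \<rho> (Z i) = \<rho>"
    and F[measurable]: "\<And>p. F p \<in> borel_measurable \<rho>"
    and bound: "\<And>z L. z \<in> space \<rho> \<Longrightarrow> (\<Sum>m<L. (F m z)\<^sup>2) \<le> B"
  shows "AE w in M. \<forall>\<eta>>0. \<exists>n0. \<forall>n\<ge>n0. \<forall>L.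
    L2_set (\<lambda>(m, m'). \<Sum>i<n. F m (Z i w) * F m' (Z i w) - (\<integral>z. F m z * F m' z \<partial>\<rho>)) ({..<L} \<times> {..<L})
      \<le> \<eta> * real n powr (3/4)"
proof -
  define W where "W p z = (case prod_decode p of (m, m') \<Rightarrow> F m z * F m' z)" for p z
  have "Z 0 \<in> measurable M \<rho>" using indep by (auto simp: indep_vars_def)
  then obtain z where "z \<in> space \<rho>" using not_empty measurable_space[of "Z 0" M \<rho>] by blast
  then have B: "0 \<le> B" using bound[of z 0] by simp
  have [measurable]: "W p \<in> borel_measurable \<rho>" for p
    unfolding W_def by (cases "prod_decode p") simp
  have Wb: "(\<Sum>p\<in>J. (W p z)\<^sup>2) \<le> B\<^sup>2" if z: "z \<in> space \<rho>" and J: "finite J" for z J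
  proof -
    have "finite (fst ` prod_decode ` J \<union> snd ` prod_decode ` J)" using J by simp
    then obtain L where L: "fst ` prod_decode ` J \<union> snd ` prod_decode ` J \<subseteq> {..<L}"
      using finite_nat_iff_bounded by blast
    have "(\<Sum>p\<in>J. (W p z)\<^sup>2) = (\<Sum>(m, m')\<in>prod_decode ` J. (F m z)\<^sup>2 * (F m' z)\<^sup>2)"
      by (simp add: sum.reindex[OF inj_on_subset[OF inj_prod_decode subset_UNIV]] W_def
          power_mult_distrib case_prod_unfold)
    also have "\<dots> \<le> (\<Sum>(m, m')\<in>{..<L} \<times> {..<L}. (F m z)\<^sup>2 * (F m' z)\<^sup>2)"
    proof (rule sum_mono2)
      show "prod_decode ` J \<subseteq> {..<L} \<times> {..<L}"
      proof
        fix p assume "p \<in> prod_decode ` J"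
        then have "fst p \<in> fst ` prod_decode ` J" "snd p \<in> snd ` prod_decode ` J" by blast+
        then show "p \<in> {..<L} \<times> {..<L}" using L by (auto simp: mem_Times_iff simp del: image_image)
      qed
    qed auto
    also have "\<dots> = (\<Sum>m<L. (F m z)\<^sup>2)\<^sup>2"
      by (simp add: power2_eq_square sum_product flip: sum.cartesian_product)
    also have "\<dots> \<le> B\<^sup>2"
      using bound[OF z] by (intro power_mono sum_nonneg) auto
    finally show ?thesis .
  qed
  have "AE w in M. \<forall>\<eta>>0. \<exists>m. \<forall>n\<ge>m. \<forall>J. finite J \<longrightarrow>
      L2_set (\<lambda>p. \<Sum>i<n. W p (Z i w) - (\<integral>z. W p z \<partial>\<rho>)) J \<le> \<eta> * real n powr (3/4)"
    by (rule l2_strong_law_rate[OF indep distr _ Wb B]) simp_all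
  then show ?thesis
  proof (rule AE_mp, intro AE_I2 impI allI)
    fix w and \<eta> :: real
    assume \<eta>: "0 < \<eta>" and *: "\<forall>\<eta>>0. \<exists>m. \<forall>n\<ge>m. \<forall>J. finite J \<longrightarrow>
      L2_set (\<lambda>p. \<Sum>i<n. W p (Z i w) - (\<integral>z. W p z \<partial>\<rho>)) J \<le> \<eta> * real n powr (3/4)"
    then obtain n0 where n0: "\<And>n J. n \<ge> n0 \<Longrightarrow> finite J \<Longrightarrow>
      L2_set (\<lambda>p. \<Sum>i<n. W p (Z i w) - (\<integral>z. W p z \<partial>\<rho>)) J \<le> \<eta> * real n powr (3/4)" by blast
    show "\<exists>n0. \<forall>n\<ge>n0. \<forall>L.
      L2_set (\<lambda>(m, m'). \<Sum>i<n. F m (Z i w) * F m' (Z i w) - (\<integral>z. F m z * F m' z \<partial>\<rho>)) ({..<L} \<times> {..<L})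
        \<le> \<eta> * real n powr (3/4)"
    proof (intro exI[of _ n0] allI impI)
      fix n L assume "n0 \<le> n"
      have "L2_set (\<lambda>(m, m'). \<Sum>i<n. F m (Z i w) * F m' (Z i w) - (\<integral>z. F m z * F m' z \<partial>\<rho>)) ({..<L} \<times> {..<L})
        = L2_set (\<lambda>p. \<Sum>i<n. W p (Z i w) - (\<integral>z. W p z \<partial>\<rho>)) (prod_encode ` ({..<L} \<times> {..<L}))"
        unfolding L2_set_def
        by (simp add: sum.reindex[OF inj_on_subset[OF inj_prod_encode subset_UNIV]] W_def[abs_def] case_prod_unfold)
      also have "\<dots> \<le> \<eta> * real n powr (3/4)" by (rule n0[OF \<open>n0 \<le> n\<close>]) simp
      finally show "L2_set (\<lambda>(m, m'). \<Sum>i<n. F m (Z i w) * F m' (Z i w) - (\<integral>z. F m z * F m' z \<partial>\<rho>)) ({..<L} \<times> {..<L})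
        \<le> \<eta> * real n powr (3/4)" .
    qed
  qed
qed

section \<open>Approximation by continuous functions\<close>

lemma abs_diff_indicator_le_1: "0 \<le> y \<Longrightarrow> y \<le> 1 \<Longrightarrow> \<bar>y - indicator A x\<bar> \<le> (1::real)"
  by (auto simp: indicator_def abs_le_iff)

text \<open>Dynkin induction from open sets, whose indicators are limits of truncated multiples of
  the distance to the complement. Keeping the values in [0, 1] provides the dominating function and
  survives complements and unions.\<close>

lemma indicator_L1_approx_continuous:
  fixes M :: "'x::metric_space measure"
  assumes "prob_space M" and sets: "sets M = sets borel" and A: "A \<in> sets borel" and e: "0 < e"
  shows "\<exists>g. continuous_on UNIV g \<and> (\<forall>x. g x \<in> {0..1}) \<and> (\<integral>x. \<bar>g x - indicator A x\<bar> \<partial>M) < (e::real)"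
proof -
  interpret prob_space M by fact
  have [simp]: "space M = UNIV" using sets_eq_imp_space_eq[OF sets] by simp
  have [measurable]: "g \<in> borel_measurable M" if "continuous_on UNIV g" for g :: "'x \<Rightarrow> real"
    using borel_measurable_continuous_onI[OF that] by (simp add: measurable_cong_sets[OF sets])
  have [measurable]: "B \<in> sets M" if "B \<in> sets borel" for B using that sets by simp
  have "Int_stable {S::'x set. open S}" by (auto intro!: Int_stableI)
  moreover have "{S::'x set. open S} \<subseteq> Pow UNIV" by simp
  moreover have "A \<in> sigma_sets UNIV {S::'x set. open S}"
    using A by (simp add: borel_def)
  ultimately show ?thesis
    using e
  proof (induction A arbitrary: e rule: sigma_sets_induct_disjoint)
    case (basic U e)
    then have [measurable]: "U \<in> sets borel" by simp
    show ?case
    \<comment> \<open>The distance to the empty set is 0 by convention, so the whole space needs its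
      own witness.\<close>
    proof (cases "- U = {}")
      case True
      then have "U = UNIV" by auto
      then show ?thesis using basic by (intro exI[of _ "\<lambda>_. 1"]) auto
    next
      case False
      define g where "g n x = min 1 (real n * infdist x (- U))" for n x
      have gc: "continuous_on UNIV (g n)" for n
        unfolding g_def by (intro continuous_intros)
      have gb: "g n x \<in> {0..1}" for n x by (simp add: g_def infdist_nonneg)
      have lim: "(\<lambda>n. \<bar>g n x - indicator U x\<bar>) \<longlonglongrightarrow> 0" for x
      proof (cases "x \<in> U")
        case True
        then have "infdist x (- U) \<noteq> 0"
          using basic False by (simp add: in_closed_iff_infdist_zero[symmetric] closed_Compl)
        then have pos: "infdist x (- U) > 0" using infdist_nonneg[of x "- U"] by simp
        obtain n0 :: nat where n0: "1 / infdist x (- U) < real n0" using reals_Archimedean2 by blast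
        have "g n x = 1" if "n \<ge> n0" for n
        proof -
          have "1 / infdist x (- U) < real n" using n0 that by linarith
          then show ?thesis using pos by (simp add: g_def field_simps)
        qed
        then have "\<forall>\<^sub>F n in sequentially. \<bar>g n x - indicator U x\<bar> = 0"
          using True by (auto simp: eventually_sequentially)
        then show ?thesis by (rule tendsto_eventually)
      next
        case False
        then show ?thesis by (simp add: g_def)
      qed
      have "(\<lambda>n. \<integral>x. \<bar>g n x - indicator U x\<bar> \<partial>M) \<longlonglongrightarrow> (\<integral>x. 0 \<partial>M)"
      proof (rule integral_dominated_convergence[where w="\<lambda>_. 1"])
        show "AE x in M. (\<lambda>n. \<bar>g n x - indicator U x\<bar>) \<longlonglongrightarrow> 0" by (simp add: lim)
        show "AE x in M. norm \<bar>g n x - indicator U x\<bar> \<le> 1" for n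
          using gb[of n] by (intro AE_I2) (simp add: abs_diff_indicator_le_1)
        show "(\<lambda>x. \<bar>g n x - indicator U x\<bar>) \<in> borel_measurable M" for n
          using gc[of n] by measurable
      qed auto
      then have "\<forall>\<^sub>F n in sequentially. (\<integral>x. \<bar>g n x - indicator U x\<bar> \<partial>M) < e"
        using basic by (intro order_tendstoD(2)) auto
      then obtain n where "(\<integral>x. \<bar>g n x - indicator U x\<bar> \<partial>M) < e"
        by (auto simp: eventually_sequentially)
      then show ?thesis using gc gb by blast
    qed
  next
    case (empty e)
    then show ?case by (intro exI[of _ "\<lambda>_. 0"]) auto
  next
    case (compl B e)
    then obtain g where g: "continuous_on UNIV g" "\<forall>x. g x \<in> {0..1}" "(\<integral>x. \<bar>g x - indicator B x\<bar> \<partial>M) < e"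
      by blast
    have "(\<integral>x. \<bar>(1 - g x) - indicator (UNIV - B) x\<bar> \<partial>M) = (\<integral>x. \<bar>g x - indicator B x\<bar> \<partial>M)"
      by (intro Bochner_Integration.integral_cong refl) (auto simp: indicator_def)
    then show ?case using g by (intro exI[of _ "\<lambda>x. 1 - g x"]) (auto intro!: continuous_intros)
  next
    case (union B e)
    have Bm[measurable]: "B i \<in> sets borel" for i
      using union(2) by (auto simp: borel_def)
    have lim: "(\<lambda>n. \<integral>x. \<bar>(\<Sum>i<n. indicator (B i) x) - indicator (\<Union> (range B)) x :: real\<bar> \<partial>M) \<longlonglongrightarrow> (\<integral>x. 0 \<partial>M)"
    proof (rule integral_dominated_convergence[where w="\<lambda>_. 1"])
      have ind: "(\<Sum>i<n. indicator (B i) x) = (indicator (\<Union>i<n. B i) x :: real)" for n x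
        using union(1) by (intro indicator_UN_disjoint[symmetric]) (auto intro: disjoint_family_on_mono)
      show "AE x in M. (\<lambda>n. \<bar>(\<Sum>i<n. indicator (B i) x) - indicator (\<Union> (range B)) x\<bar>) \<longlonglongrightarrow> (0::real)"
      proof (intro AE_I2)
        fix x
        have "(\<lambda>n. indicator (\<Union>i<n. B i) x - indicator (\<Union> (range B)) x :: real) \<longlonglongrightarrow> 0"
          by (intro LIM_zero LIMSEQ_indicator_UN)
        then show "(\<lambda>n. \<bar>(\<Sum>i<n. indicator (B i) x) - indicator (\<Union> (range B)) x\<bar>) \<longlonglongrightarrow> (0::real)"
          unfolding ind by (rule tendsto_rabs_zero)
      qed
      show "AE x in M. norm \<bar>(\<Sum>i<n. indicator (B i) x) - indicator (\<Union> (range B)) x :: real\<bar> \<le> 1" for n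
        unfolding ind by (auto simp: indicator_def)
    qed auto
    then have "\<forall>\<^sub>F n in sequentially. (\<integral>x. \<bar>(\<Sum>i<n. indicator (B i) x) - indicator (\<Union> (range B)) x :: real\<bar> \<partial>M) < e / 2"
      using \<open>0 < e\<close> by (intro order_tendstoD(2)[OF lim]) auto
    then obtain n where n: "(\<integral>x. \<bar>(\<Sum>i<n. indicator (B i) x) - indicator (\<Union> (range B)) x :: real\<bar> \<partial>M) < e / 2"
      by (auto simp: eventually_sequentially)
    have "\<exists>g. continuous_on UNIV g \<and> (\<forall>x. g x \<in> {0..1}) \<and> (\<integral>x. \<bar>g x - indicator (B i) x\<bar> \<partial>M) < e / (2 * (real n + 1))" for i
      using \<open>0 < e\<close> by (intro union(3)) auto
    then obtain g where gc: "\<And>i. continuous_on UNIV (g i)" and gb: "\<And>i x. g i x \<in> {0..1}"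
      and g: "\<And>i. (\<integral>x. \<bar>g i x - indicator (B i) x\<bar> \<partial>M) < e / (2 * (real n + 1))" by metis
    \<comment> \<open>Truncation at 1 restores the range and cannot increase the distance to an
      indicator.\<close>
    define h where "h x = min 1 (\<Sum>i<n. g i x)" for x
    have hc: "continuous_on UNIV h" unfolding h_def by (intro continuous_intros gc)
    have hb: "h x \<in> {0..1}" for x using gb by (auto simp: h_def intro!: sum_nonneg)
    have [measurable]: "g i \<in> borel_measurable M" "h \<in> borel_measurable M" for i using gc hc by simp_all
    have [simp]: "integrable M (\<lambda>x. \<bar>g i x - indicator (B i) x\<bar>)" for i
      using gb[of i] by (intro integrable_const_bound[of _ 1]) (auto simp: abs_diff_indicator_le_1)
    have ind: "integrable M (indicat_real D)" if "D \<in> sets borel" for D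
      using that by (intro integrable_const_bound[of _ 1]) auto
    have [simp]: "integrable M (\<lambda>x. \<bar>(\<Sum>i<n. indicator (B i) x) - indicator (\<Union> (range B)) x :: real\<bar>)"
      by (intro integrable_abs Bochner_Integration.integrable_diff Bochner_Integration.integrable_sum ind) measurable
    have pw: "\<bar>h x - indicator (\<Union> (range B)) x\<bar> \<le>
        (\<Sum>i<n. \<bar>g i x - indicator (B i) x\<bar>) + \<bar>(\<Sum>i<n. indicator (B i) x) - indicator (\<Union> (range B)) x\<bar>" for x
    proof -
      have "\<bar>h x - indicator (\<Union> (range B)) x\<bar> \<le> \<bar>(\<Sum>i<n. g i x) - indicator (\<Union> (range B)) x\<bar>"
        using sum_nonneg[of "{..<n}" "\<lambda>i. g i x"] gb by (auto simp: h_def indicator_def)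
      also have "\<dots> = \<bar>(\<Sum>i<n. g i x - indicator (B i) x) + ((\<Sum>i<n. indicator (B i) x) - indicator (\<Union> (range B)) x)\<bar>"
        by (simp add: sum_subtractf)
      finally show ?thesis
        using sum_abs[of "\<lambda>i. g i x - indicator (B i) x" "{..<n}"] by linarith
    qed
    have "(\<integral>x. \<bar>h x - indicator (\<Union> (range B)) x\<bar> \<partial>M) \<le>
      (\<integral>x. (\<Sum>i<n. \<bar>g i x - indicator (B i) x\<bar>) + \<bar>(\<Sum>i<n. indicator (B i) x) - indicator (\<Union> (range B)) x :: real\<bar> \<partial>M)"
    proof (rule integral_mono)
      show "integrable M (\<lambda>x. \<bar>h x - indicator (\<Union> (range B)) x\<bar>)"
        using hb by (intro integrable_const_bound[of _ 1]) (auto simp: abs_diff_indicator_le_1)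
    qed (use pw in auto)
    also have "\<dots> = (\<Sum>i<n. \<integral>x. \<bar>g i x - indicator (B i) x\<bar> \<partial>M) +
       (\<integral>x. \<bar>(\<Sum>i<n. indicator (B i) x) - indicator (\<Union> (range B)) x :: real\<bar> \<partial>M)"
      by simp
    also have "(\<Sum>i<n. \<integral>x. \<bar>g i x - indicator (B i) x\<bar> \<partial>M) \<le> real n * (e / (2 * (real n + 1)))"
      using sum_bounded_above[of "{..<n}" "\<lambda>i. \<integral>x. \<bar>g i x - indicator (B i) x\<bar> \<partial>M" "e / (2 * (real n + 1))"] less_imp_le[OF g] by simp
    also have "\<dots> \<le> e / 2" using \<open>0 < e\<close> by (simp add: field_simps)
    finally show ?case using n hc hb by (intro exI[of _ h]) auto
  qed
qed

text \<open>Rescaled to [0, 1], \<open>q\<close> is within 1 / N of an average of N indicators of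
  superlevel sets, and each indicator is replaced by a continuous function.\<close>

lemma L1_approx_continuous:
  fixes M :: "'x::metric_space measure" and q :: "'x \<Rightarrow> real"
  assumes "prob_space M" and sets: "sets M = sets borel" and q[measurable]: "q \<in> borel_measurable borel"
    and qb: "\<And>x. \<bar>q x\<bar> \<le> B" and B: "0 < B" and e: "0 < e"
  shows "\<exists>g. continuous_on UNIV g \<and> (\<forall>x. \<bar>g x\<bar> \<le> B) \<and> (\<integral>x. \<bar>g x - q x\<bar> \<partial>M) < e"
proof -
  interpret prob_space M by fact
  have mM: "measurable M N = measurable borel N" for N :: "real measure"
    by (rule measurable_cong_sets[OF sets refl])
  \<comment> \<open>Then the discretisation error \<open>2 * B / N\<close> is below
    \<open>e / 2\<close>. The other half is the average of N indicator errors, each below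
    \<open>e / (4 * B)\<close>, scaled by \<open>2 * B\<close>.\<close>
  obtain N :: nat where N: "4 * B / e < real N" using reals_Archimedean2 by blast
  then have N0: "0 < real N" using B e by (smt (verit) divide_pos_pos)
  define s where "s x = (q x + B) / (2 * B)" for x
  have s01: "0 \<le> s x" "s x \<le> 1" for x
    using qb[of x] B by (simp_all add: s_def field_simps abs_le_iff)
  define A where "A j = {x. real j \<le> s x * real N}" for j :: nat
  have A: "A j \<in> sets borel" for j unfolding A_def s_def by measurable
  have "\<exists>g. continuous_on UNIV g \<and> (\<forall>x. g x \<in> {0..1}) \<and> (\<integral>x. \<bar>g x - indicator (A j) x\<bar> \<partial>M) < e / (4 * B)" for j
    using indicator_L1_approx_continuous[OF \<open>prob_space M\<close> sets A[of j], of "e / (4 * B)"] B e by simp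
  then obtain g where gc: "\<And>i. continuous_on UNIV (g i)" and gb: "\<And>i x. g i x \<in> {0..1}"
    and g: "\<And>i. (\<integral>x. \<bar>g i x - indicator (A i) x\<bar> \<partial>M) < e / (4 * B)" by metis
  have [measurable]: "g i \<in> borel_measurable M" for i
    using borel_measurable_continuous_onI[OF gc] by (simp add: mM)
  have [measurable]: "A i \<in> sets M" "q \<in> borel_measurable M" for i using A sets mM by auto
  define h where "h x = 2 * B / real N * (\<Sum>j\<in>{1..N}. g j x) - B" for x
  have hc: "continuous_on UNIV h" unfolding h_def by (intro continuous_intros gc)
  then have [measurable]: "h \<in> borel_measurable M"
    using borel_measurable_continuous_onI[OF hc] by (simp add: mM)
  have hb: "\<bar>h x\<bar> \<le> B" for x
  proof -
    have "0 \<le> (\<Sum>j\<in>{1..N}. g j x)" "(\<Sum>j\<in>{1..N}. g j x) \<le> real N"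
      using gb sum_bounded_above[of "{1..N}" "\<lambda>j. g j x" 1] by (auto intro!: sum_nonneg)
    then have "0 \<le> 2 * B / real N * (\<Sum>j\<in>{1..N}. g j x)" "2 * B / real N * (\<Sum>j\<in>{1..N}. g j x) \<le> 2 * B"
      using B N0 by (simp_all add: field_simps)
    then show ?thesis by (simp add: h_def abs_le_iff)
  qed
  text \<open>Layer-cake discretisation: \<open>\<lfloor>s N\<rfloor>\<close> counts the levels \<open>j / N\<close> below \<open>s\<close>.\<close>
  have count: "\<bar>(\<Sum>j\<in>{1..N}. indicator (A j) x) - s x * real N\<bar> \<le> 1" for x
  proof -
    define f where "f = nat \<lfloor>s x * real N\<rfloor>"
    have sN: "0 \<le> s x * real N" "s x * real N \<le> real N" using s01[of x] N0 by (simp_all add: mult_left_le_one_le)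
    have fl: "real f \<le> s x * real N" "s x * real N < real f + 1"
      using sN unfolding f_def by (simp_all add: le_nat_floor)
    have le: "real j \<le> s x * real N \<longleftrightarrow> j \<le> f" for j
    proof
      assume "real j \<le> s x * real N"
      then have "real j < real (f + 1)" using fl(2) by simp
      then show "j \<le> f" unfolding of_nat_less_iff by simp
    next
      assume "j \<le> f"
      then have "real j \<le> real f" by simp
      then show "real j \<le> s x * real N" using fl(1) by linarith
    qed
    have "f \<le> N"
      using order_trans[OF fl(1) sN(2)] by simp
    then have "{1..N} \<inter> {j. x \<in> A j} = {1..f}"
      unfolding A_def by (auto simp: le)
    then have "(\<Sum>j\<in>{1..N}. indicator (A j) x) = real f"
      by (simp add: indicator_def sum.If_cases)
    then show ?thesis using fl by (simp add: abs_le_iff)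
  qed
  have pw: "\<bar>h x - q x\<bar> \<le> 2 * B / real N * (\<Sum>j\<in>{1..N}. \<bar>g j x - indicator (A j) x\<bar>) + 2 * B / real N" for x
  proof -
    have "q x = 2 * B / real N * (s x * real N) - B" using B N0 by (simp add: s_def)
    then have "h x - q x = 2 * B / real N * ((\<Sum>j\<in>{1..N}. g j x) - s x * real N)"
      by (simp add: h_def right_diff_distrib)
    also have "\<dots> = 2 * B / real N * ((\<Sum>j\<in>{1..N}. g j x - indicator (A j) x) + ((\<Sum>j\<in>{1..N}. indicator (A j) x) - s x * real N))"
      by (simp add: sum_subtractf)
    finally have "\<bar>h x - q x\<bar> = 2 * B / real N * \<bar>(\<Sum>j\<in>{1..N}. g j x - indicator (A j) x) + ((\<Sum>j\<in>{1..N}. indicator (A j) x) - s x * real N)\<bar>"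
      using B N0 by (simp add: abs_mult)
    moreover have "\<bar>(\<Sum>j\<in>{1..N}. g j x - indicator (A j) x) + ((\<Sum>j\<in>{1..N}. indicator (A j) x) - s x * real N)\<bar>
        \<le> (\<Sum>j\<in>{1..N}. \<bar>g j x - indicator (A j) x\<bar>) + 1"
      using count[of x] sum_abs[of "\<lambda>j. g j x - indicator (A j) x" "{1..N}"] by linarith
    then have "2 * B / real N * \<bar>(\<Sum>j\<in>{1..N}. g j x - indicator (A j) x) + ((\<Sum>j\<in>{1..N}. indicator (A j) x) - s x * real N)\<bar>
        \<le> 2 * B / real N * ((\<Sum>j\<in>{1..N}. \<bar>g j x - indicator (A j) x\<bar>) + 1)"
      using B by (intro mult_left_mono) auto
    ultimately show ?thesis by (simp add: distrib_left)
  qed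
  have [simp]: "integrable M (\<lambda>x. \<bar>g i x - indicator (A i) x\<bar>)" for i
    using gb[of i] by (intro integrable_const_bound[of _ 1]) (auto simp: abs_diff_indicator_le_1)
  have "(\<integral>x. \<bar>h x - q x\<bar> \<partial>M) \<le> (\<integral>x. 2 * B / real N * (\<Sum>j\<in>{1..N}. \<bar>g j x - indicator (A j) x\<bar>) + 2 * B / real N \<partial>M)"
  proof (rule integral_mono)
    have "\<bar>h x - q x\<bar> \<le> 2 * B" for x using hb[of x] qb[of x] by linarith
    then show "integrable M (\<lambda>x. \<bar>h x - q x\<bar>)"
      by (intro integrable_const_bound[of _ "2 * B"]) auto
  qed (use pw in \<open>auto simp: prob_space\<close>)
  also have "\<dots> = 2 * B / real N * (\<Sum>j\<in>{1..N}. \<integral>x. \<bar>g j x - indicator (A j) x\<bar> \<partial>M) + 2 * B / real N"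
    by (simp add: prob_space)
  also have "\<dots> \<le> 2 * B / real N * (real N * (e / (4 * B))) + 2 * B / real N"
  proof -
    have "(\<Sum>j\<in>{1..N}. \<integral>x. \<bar>g j x - indicator (A j) x\<bar> \<partial>M) \<le> real N * (e / (4 * B))"
      using sum_bounded_above[of "{1..N}" "\<lambda>j. \<integral>x. \<bar>g j x - indicator (A j) x\<bar> \<partial>M" "e / (4 * B)"] less_imp_le[OF g] by simp
    then show ?thesis using B N0 by (intro add_right_mono mult_left_mono) auto
  qed
  also have "\<dots> < e"
    using B N0 N e by (simp add: field_simps)
  finally show ?thesis using hc hb by blast
qed

section \<open>Deviation and risk\<close>

text \<open>For a finite combination of features, empirical minus population second moment is the
  quadratic form of the Gram deviation at the coefficients, hence at most its Hilbert-Schmidt norm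
  times the squared coefficient norm. Dominated convergence passes to infinite combinations. As
  \<open>\<Delta>\<close> does not depend on \<open>d\<close>, the bound is uniform over RKHS balls
  and applies to functions chosen from the sample.\<close>

lemma quadratic_deviation:
  fixes F :: "nat \<Rightarrow> 'b \<Rightarrow> real"
  assumes "prob_space \<rho>" and F[measurable]: "\<And>m. F m \<in> borel_measurable \<rho>" and H[measurable]: "H \<in> borel_measurable \<rho>"
    and bound: "\<And>z L. z \<in> space \<rho> \<Longrightarrow> (\<Sum>m<L. (F m z)\<^sup>2) \<le> B"
    and zs: "\<And>i. zs i \<in> space \<rho>" and n: "0 < n"
    and dev: "\<And>L. L2_set (\<lambda>(m, m'). \<Sum>i<n. F m (zs i) * F m' (zs i) - (\<integral>z. F m z * F m' z \<partial>\<rho>)) ({..<L} \<times> {..<L}) \<le> real n * \<Delta>"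
    and d: "(\<lambda>m. (d m)\<^sup>2) sums s" and dF: "\<And>z. z \<in> space \<rho> \<Longrightarrow> (\<lambda>m. d m * F m z) sums H z"
  shows "\<bar>(\<Sum>i<n. (H (zs i))\<^sup>2) / real n - (\<integral>z. (H z)\<^sup>2 \<partial>\<rho>)\<bar> \<le> \<Delta> * s"
proof -
  interpret prob_space \<rho> by fact
  define h where "h L z = (\<Sum>m<L. d m * F m z)" for L z
  have hm[measurable]: "h L \<in> borel_measurable \<rho>" for L unfolding h_def by measurable
  have B: "0 \<le> B" using bound[OF zs[of 0], of 0] by simp
  have dL: "(\<Sum>m<L. (d m)\<^sup>2) \<le> s" for L
    using sum_le_suminf[OF sums_summable[OF d], of "{..<L}"] sums_unique[OF d] by simp
  have s: "0 \<le> s" using dL[of 0] by simp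
  have hB: "(h L z)\<^sup>2 \<le> s * B" if "z \<in> space \<rho>" for L z
  proof -
    have "(h L z)\<^sup>2 \<le> (\<Sum>m<L. (d m)\<^sup>2) * (\<Sum>m<L. (F m z)\<^sup>2)"
      unfolding h_def by (rule Cauchy_Schwarz_ineq_sum)
    also have "\<dots> \<le> s * B"
      using dL bound[OF that] s by (intro mult_mono sum_nonneg) auto
    finally show ?thesis .
  qed
  have Fb: "\<bar>F m z\<bar> \<le> sqrt B" if "z \<in> space \<rho>" for m z
  proof -
    have "(F m z)\<^sup>2 \<le> (\<Sum>i<Suc m. (F i z)\<^sup>2)" by (intro member_le_sum) auto
    then show ?thesis using bound[OF that, of "Suc m"] by (intro real_le_rsqrt) (simp only: power2_abs)
  qed
  have FFb: "\<bar>F m z * F m' z\<bar> \<le> B" if "z \<in> space \<rho>" for m m' z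
    using mult_mono[OF Fb[OF that, of m] Fb[OF that, of m']] B by (simp add: abs_mult)
  have FFi[simp]: "integrable \<rho> (\<lambda>z. F m z * F m' z)" for m m'
    by (rule integrable_const_bound[of _ B]) (auto simp: FFb)
  have fin: "\<bar>(\<Sum>i<n. (h L (zs i))\<^sup>2) / real n - (\<integral>z. (h L z)\<^sup>2 \<partial>\<rho>)\<bar> \<le> \<Delta> * s" for L
  proof -
    let ?I = "{..<L} \<times> {..<L}"
    let ?D = "\<lambda>(m, m'). \<Sum>i<n. F m (zs i) * F m' (zs i) - (\<integral>z. F m z * F m' z \<partial>\<rho>)"
    let ?d = "\<lambda>(m, m'). d m * d m'"
    have sq: "(h L z)\<^sup>2 = (\<Sum>(m, m')\<in>?I. d m * d m' * (F m z * F m' z))" for z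
      by (simp add: h_def power2_eq_square sum_product ac_simps flip: sum.cartesian_product)
    have "(\<Sum>i<n. (h L (zs i))\<^sup>2) - real n * (\<integral>z. (h L z)\<^sup>2 \<partial>\<rho>) = (\<Sum>i<n. (h L (zs i))\<^sup>2 - (\<integral>z. (h L z)\<^sup>2 \<partial>\<rho>))"
      by (simp add: sum_subtractf)
    also have "\<dots> = (\<Sum>i<n. \<Sum>(m, m')\<in>?I. d m * d m' * (F m (zs i) * F m' (zs i) - (\<integral>z. F m z * F m' z \<partial>\<rho>)))"
      unfolding sq by (simp add: case_prod_unfold right_diff_distrib sum_subtractf)
    also have "\<dots> = (\<Sum>p\<in>?I. ?d p * ?D p)"
      by (subst sum.swap) (auto simp: sum_distrib_left intro!: sum.cong)
    finally have eq: "(\<Sum>i<n. (h L (zs i))\<^sup>2) - real n * (\<integral>z. (h L z)\<^sup>2 \<partial>\<rho>) = (\<Sum>p\<in>?I. ?d p * ?D p)" .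
    have "\<bar>\<Sum>p\<in>?I. ?d p * ?D p\<bar> \<le> (\<Sum>p\<in>?I. \<bar>?d p\<bar> * \<bar>?D p\<bar>)"
      by (rule order_trans[OF sum_abs]) (simp add: abs_mult)
    also have "\<dots> \<le> L2_set ?d ?I * L2_set ?D ?I"
      by (rule L2_set_mult_ineq)
    \<comment> \<open>The Hilbert-Schmidt norm of the rank-one matrix built from
      \<open>d\<close>.\<close>
    also have "L2_set ?d ?I = (\<Sum>m<L. (d m)\<^sup>2)"
    proof -
      have "(\<Sum>p\<in>?I. (?d p)\<^sup>2) = (\<Sum>m<L. (d m)\<^sup>2)\<^sup>2"
        by (simp add: power2_eq_square sum_product case_prod_unfold sum.cartesian_product ac_simps)
      then show ?thesis by (simp add: L2_set_def sum_nonneg)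
    qed
    also have "(\<Sum>m<L. (d m)\<^sup>2) * L2_set ?D ?I \<le> s * (real n * \<Delta>)"
      using dL dev s by (intro mult_mono) auto
    finally have "\<bar>(\<Sum>i<n. (h L (zs i))\<^sup>2) - real n * (\<integral>z. (h L z)\<^sup>2 \<partial>\<rho>)\<bar> \<le> real n * (\<Delta> * s)"
      using eq by (simp add: ac_simps)
    moreover have "(\<Sum>i<n. (h L (zs i))\<^sup>2) - real n * (\<integral>z. (h L z)\<^sup>2 \<partial>\<rho>) =
        real n * ((\<Sum>i<n. (h L (zs i))\<^sup>2) / real n - (\<integral>z. (h L z)\<^sup>2 \<partial>\<rho>))"
      using n by (simp add: field_simps)
    ultimately show ?thesis using n by (simp add: abs_mult)
  qed
  have lim: "(\<lambda>L. h L z) \<longlonglongrightarrow> H z" if "z \<in> space \<rho>" for z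
    using dF[OF that] by (simp add: sums_def h_def)
  have "(\<lambda>L. \<integral>z. (h L z)\<^sup>2 \<partial>\<rho>) \<longlonglongrightarrow> (\<integral>z. (H z)\<^sup>2 \<partial>\<rho>)"
  proof (rule integral_dominated_convergence[where w="\<lambda>_. s * B"])
    show "AE z in \<rho>. (\<lambda>L. (h L z)\<^sup>2) \<longlonglongrightarrow> (H z)\<^sup>2" by (intro AE_I2 tendsto_intros lim)
    show "AE z in \<rho>. norm ((h L z)\<^sup>2) \<le> s * B" for L by (intro AE_I2) (simp add: hB)
  qed auto
  then have "(\<lambda>L. \<bar>(\<Sum>i<n. (h L (zs i))\<^sup>2) / real n - (\<integral>z. (h L z)\<^sup>2 \<partial>\<rho>)\<bar>) \<longlonglongrightarrow>
      \<bar>(\<Sum>i<n. (H (zs i))\<^sup>2) / real n - (\<integral>z. (H z)\<^sup>2 \<partial>\<rho>)\<bar>"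
    using n by (intro tendsto_intros lim zs) auto
  then show ?thesis
    by (rule LIMSEQ_le_const2) (auto simp: fin)
qed

lemma squared_risk_diff_le:
  fixes f g u :: "'b \<Rightarrow> real"
  assumes "prob_space \<rho>" and [measurable]: "u \<in> borel_measurable \<rho>" "f \<in> borel_measurable \<rho>" "g \<in> borel_measurable \<rho>"
    and u: "\<And>z. \<bar>u z\<bar> \<le> U" and f: "\<And>z. \<bar>f z\<bar> \<le> B" and g: "\<And>z. \<bar>g z\<bar> \<le> B"
  shows "\<bar>(\<integral>z. (u z - f z)\<^sup>2 \<partial>\<rho>) - (\<integral>z. (u z - g z)\<^sup>2 \<partial>\<rho>)\<bar> \<le> 2 * (U + B) * (\<integral>z. \<bar>f z - g z\<bar> \<partial>\<rho>)"
proof -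
  interpret prob_space \<rho> by fact
  have i: "integrable \<rho> (\<lambda>z. (u z - h z)\<^sup>2)" if [measurable]: "h \<in> borel_measurable \<rho>" and h: "\<And>z. \<bar>h z\<bar> \<le> B" for h
  proof (rule integrable_const_bound[of _ "(U + B)\<^sup>2"])
    have "\<bar>u z - h z\<bar> \<le> U + B" for z using u[of z] h[of z] by linarith
    from power_mono[OF this abs_ge_zero, of _ 2] show "AE z in \<rho>. norm ((u z - h z)\<^sup>2) \<le> (U + B)\<^sup>2" by simp
  qed auto
  have i': "integrable \<rho> (\<lambda>z. \<bar>f z - g z\<bar>)"
  proof (rule integrable_const_bound[of _ "2 * B"])
    have "\<bar>f z - g z\<bar> \<le> 2 * B" for z using f[of z] g[of z] by linarith
    then show "AE z in \<rho>. norm \<bar>f z - g z\<bar> \<le> 2 * B" by simp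
  qed auto
  have "\<bar>(\<integral>z. (u z - f z)\<^sup>2 \<partial>\<rho>) - (\<integral>z. (u z - g z)\<^sup>2 \<partial>\<rho>)\<bar> = \<bar>\<integral>z. (u z - f z)\<^sup>2 - (u z - g z)\<^sup>2 \<partial>\<rho>\<bar>"
    using i[of f] i[of g] f g by simp
  also have "\<dots> \<le> (\<integral>z. \<bar>(u z - f z)\<^sup>2 - (u z - g z)\<^sup>2\<bar> \<partial>\<rho>)"
    by (rule integral_abs_bound)
  also have "\<dots> \<le> (\<integral>z. 2 * (U + B) * \<bar>f z - g z\<bar> \<partial>\<rho>)"
  proof (rule integral_mono)
    fix z
    have "(u z - f z)\<^sup>2 - (u z - g z)\<^sup>2 = (2 * u z - f z - g z) * (g z - f z)"
      by (simp add: power2_eq_square algebra_simps)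
    moreover have "\<bar>2 * u z - f z - g z\<bar> \<le> 2 * (U + B)" using u[of z] f[of z] g[of z] by (simp add: abs_le_iff)
    ultimately show "\<bar>(u z - f z)\<^sup>2 - (u z - g z)\<^sup>2\<bar> \<le> 2 * (U + B) * \<bar>f z - g z\<bar>"
      by (simp add: abs_mult abs_minus_commute[of "g z"] mult_right_mono)
  qed (use i[of f] i[of g] f g i' in auto)
  finally show ?thesis by simp
qed

text \<open>Expanding the risk along \<open>f + s * q\<close> bounds \<open>2 * s\<close> times the
  correlation by \<open>s\<^sup>2 + e\<close>. The choice \<open>s = sqrt e\<close>, with either
  sign, balances the two terms. For an exact minimiser this would be orthogonality of the
  residual.\<close>

lemma near_minimal_risk_residual:
  fixes f q u :: "'b \<Rightarrow> real"
  assumes "prob_space \<rho>" and [measurable]: "u \<in> borel_measurable \<rho>" "f \<in> borel_measurable \<rho>" "q \<in> borel_measurable \<rho>"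
    and u: "\<And>z. \<bar>u z\<bar> \<le> U" and f: "\<And>z. \<bar>f z\<bar> \<le> B" and q: "\<And>z. \<bar>q z\<bar> \<le> 1" and e: "0 < e"
    and min: "\<And>s. (\<integral>z. (u z - f z)\<^sup>2 \<partial>\<rho>) \<le> (\<integral>z. (u z - (f z + s * q z))\<^sup>2 \<partial>\<rho>) + e"
  shows "\<bar>\<integral>z. q z * (u z - f z) \<partial>\<rho>\<bar> \<le> sqrt e"
proof -
  interpret prob_space \<rho> by fact
  have uf: "\<bar>u z - f z\<bar> \<le> U + B" for z using u[of z] f[of z] by linarith
  have i1: "integrable \<rho> (\<lambda>z. (u z - f z)\<^sup>2)"
    using power_mono[OF uf abs_ge_zero, of _ 2] by (intro integrable_const_bound[of _ "(U + B)\<^sup>2"]) auto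
  have i2: "integrable \<rho> (\<lambda>z. q z * (u z - f z))"
  proof (rule integrable_const_bound[of _ "1 * (U + B)"])
    show "AE z in \<rho>. norm (q z * (u z - f z)) \<le> 1 * (U + B)"
      using mult_mono[OF q uf] by (intro AE_I2) (auto simp: abs_mult)
  qed auto
  have q2: "(q z)\<^sup>2 \<le> 1" for z using power_mono[OF q[of z] abs_ge_zero, of 2] by simp
  have i3: "integrable \<rho> (\<lambda>z. (q z)\<^sup>2)"
    using q2 by (intro integrable_const_bound[of _ 1]) auto
  have q3: "(\<integral>z. (q z)\<^sup>2 \<partial>\<rho>) \<le> 1"
    using i3 q2 by (intro integral_le_const) auto
  have key: "2 * s * (\<integral>z. q z * (u z - f z) \<partial>\<rho>) \<le> s\<^sup>2 + e" for s
  proof -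
    have "(\<integral>z. (u z - (f z + s * q z))\<^sup>2 \<partial>\<rho>) = (\<integral>z. (u z - f z)\<^sup>2 - 2 * s * (q z * (u z - f z)) + s\<^sup>2 * (q z)\<^sup>2 \<partial>\<rho>)"
      by (intro Bochner_Integration.integral_cong refl) (simp add: power2_eq_square algebra_simps)
    also have "\<dots> = (\<integral>z. (u z - f z)\<^sup>2 \<partial>\<rho>) - 2 * s * (\<integral>z. q z * (u z - f z) \<partial>\<rho>) + s\<^sup>2 * (\<integral>z. (q z)\<^sup>2 \<partial>\<rho>)"
      using i1 i2 i3 by simp
    finally show ?thesis
      using min[of s] mult_left_mono[OF q3, of "s\<^sup>2"] by simp
  qed
  have r: "sqrt e > 0" "sqrt e * sqrt e = e" using e by simp_all
  have "sqrt e * (\<integral>z. q z * (u z - f z) \<partial>\<rho>) \<le> sqrt e * sqrt e"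
    "sqrt e * (- (\<integral>z. q z * (u z - f z) \<partial>\<rho>)) \<le> sqrt e * sqrt e"
    using key[of "sqrt e"] key[of "- sqrt e"] e by simp_all
  then show ?thesis using r(1) by (simp only: mult_le_cancel_left_pos abs_le_iff)
qed

section \<open>Kernel ridge regression\<close>

definition krr :: "('x \<Rightarrow> 'x \<Rightarrow> real) \<Rightarrow> nat \<Rightarrow> real \<Rightarrow> (nat \<Rightarrow> 'x) \<Rightarrow> (nat \<Rightarrow> real) \<Rightarrow> 'x \<Rightarrow> real" where
  "krr k n lam xs u x = (\<Sum>i<n. krr_weights k n lam xs x i * u i)"

lemma krr_continuous:
  fixes k :: "'x::topological_space \<Rightarrow> 'x \<Rightarrow> real"
  assumes "pd_kernel k" "0 < lam" "0 < n" "\<And>y. continuous_on UNIV (\<lambda>x. k x y)"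
  shows "continuous_on UNIV (krr k n lam xs u)"
  unfolding krr_def by (intro continuous_intros krr_weights_continuous assms) simp

text \<open>The feature coefficients of a combination of kernel sections; the second series computes
  its squared RKHS norm.\<close>

lemma kernel_span_features:
  fixes e :: "nat \<Rightarrow> 'x \<Rightarrow> real" and N :: nat
  assumes e: "\<And>x y. (\<lambda>m. e m x * e m y) sums k x y"
  shows "(\<lambda>m. (\<Sum>j<N. \<beta> j * e m (ys j)) * e m x) sums (\<Sum>j<N. \<beta> j * k (ys j) x)"
    and "(\<lambda>m. (\<Sum>j<N. \<beta> j * e m (ys j))\<^sup>2) sums (\<Sum>i<N. \<Sum>j<N. \<beta> i * \<beta> j * k (ys i) (ys j))"
proof -
  have "(\<lambda>m. \<Sum>j<N. \<beta> j * (e m (ys j) * e m x)) sums (\<Sum>j<N. \<beta> j * k (ys j) x)"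
    by (intro sums_sum sums_mult e)
  then show "(\<lambda>m. (\<Sum>j<N. \<beta> j * e m (ys j)) * e m x) sums (\<Sum>j<N. \<beta> j * k (ys j) x)"
    by (simp only: sum_distrib_right mult.assoc)
  have "(\<lambda>m. \<Sum>i<N. \<Sum>j<N. \<beta> i * \<beta> j * (e m (ys i) * e m (ys j))) sums (\<Sum>i<N. \<Sum>j<N. \<beta> i * \<beta> j * k (ys i) (ys j))"
    by (intro sums_sum sums_mult e)
  then show "(\<lambda>m. (\<Sum>j<N. \<beta> j * e m (ys j))\<^sup>2) sums (\<Sum>i<N. \<Sum>j<N. \<beta> i * \<beta> j * k (ys i) (ys j))"
    by (simp add: power2_eq_square sum_product ac_simps)
qed

text \<open>The coefficients of the regressor in a feature expansion of the kernel; \<open>s\<close> is its squared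
  RKHS norm. Testing the optimality condition \<open>n \<lambda> c\<^sub>i = u\<^sub>i - krr(x\<^sub>i)\<close> against the regressor itself
  and against a competitor \<open>g\<close> gives the two a priori bounds.\<close>

lemma krr_coefficients:
  fixes e :: "nat \<Rightarrow> 'x \<Rightarrow> real"
  assumes k: "pd_kernel k" and e: "\<And>x y. (\<lambda>m. e m x * e m y) sums k x y"
    and lam: "0 < lam" and n: "0 < n"
  obtains a s where "\<And>x. (\<lambda>m. a m * e m x) sums krr k n lam xs u x" and "(\<lambda>m. (a m)\<^sup>2) sums s"
    and "(\<Sum>i<n. (krr k n lam xs u (xs i))\<^sup>2) / real n \<le> (\<Sum>i<n. (u i)\<^sup>2) / real n"
    and "lam * s \<le> (\<Sum>i<n. (u i)\<^sup>2) / real n"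
    and "\<And>(N::nat) \<beta> ys g. (\<And>x. g x = (\<Sum>j<N. \<beta> j * k (ys j) x)) \<Longrightarrow>
      (\<Sum>i<n. (u i - krr k n lam xs u (xs i))\<^sup>2) / real n + lam * s
      \<le> (\<Sum>i<n. (u i - g (xs i))\<^sup>2) / real n + lam * (\<Sum>i<N. \<Sum>j<N. \<beta> i * \<beta> j * k (ys i) (ys j))"
proof -
  let ?f = "krr k n lam xs u"
  obtain c where f0: "\<And>x. (\<Sum>i<n. krr_weights k n lam xs x i * u i) = (\<Sum>j<n. c j * k x (xs j))"
    and c: "\<And>i. i < n \<Longrightarrow> (\<Sum>j<n. c j * k (xs i) (xs j)) + real n * lam * c i = u i"
    by (rule krr_representer[OF k lam n, where u=u and xs=xs]) (rule that)
  have f: "?f x = (\<Sum>j<n. c j * k x (xs j))" for x unfolding krr_def by (rule f0)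
  have c': "u i - ?f (xs i) = real n * lam * c i" if "i < n" for i
    using c[OF that] f[of "xs i"] by simp
  define a where "a m = (\<Sum>j<n. c j * e m (xs j))" for m
  define s where "s = (\<Sum>i<n. c i * ?f (xs i))"
  have af: "(\<lambda>m. a m * e m x) sums ?f x" for x
  proof -
    have "(\<lambda>m. \<Sum>j<n. c j * (e m x * e m (xs j))) sums (\<Sum>j<n. c j * k x (xs j))"
      by (intro sums_sum sums_mult e)
    then show ?thesis unfolding f by (simp add: a_def sum_distrib_left sum_distrib_right ac_simps)
  qed
  have as: "(\<lambda>m. (a m)\<^sup>2) sums s"
  proof -
    have "(\<lambda>m. \<Sum>i<n. c i * (a m * e m (xs i))) sums s"
      unfolding s_def by (intro sums_sum sums_mult af)
    moreover have "(\<Sum>i<n. c i * (a m * e m (xs i))) = (a m)\<^sup>2" for m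
      unfolding power2_eq_square by (subst (3) a_def) (simp add: sum_distrib_left ac_simps)
    ultimately show ?thesis by simp
  qed
  have test: "(\<Sum>i<n. (u i - ?f (xs i)) * g i) = real n * (lam * (\<Sum>i<n. c i * g i))" for g
    unfolding sum_distrib_left by (intro sum.cong refl) (simp add: c')
  have norm_eq: "(\<Sum>i<n. (u i - ?f (xs i)) * ?f (xs i)) = real n * (lam * s)"
    unfolding s_def by (rule test)
  have s0: "0 \<le> s" using as by (rule sums_le[OF _ sums_zero, rotated]) simp
  \<comment> \<open>Expand \<open>u\<close> as residual plus fit and drop the squared residuals; the
    cross term is the penalty by \<open>norm_eq\<close>.\<close>
  have "(\<Sum>i<n. (?f (xs i))\<^sup>2) + 2 * (real n * (lam * s)) \<le> (\<Sum>i<n. (u i)\<^sup>2)"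
  proof -
    have "(\<Sum>i<n. (u i)\<^sup>2) = (\<Sum>i<n. (u i - ?f (xs i))\<^sup>2 + 2 * ((u i - ?f (xs i)) * ?f (xs i)) + (?f (xs i))\<^sup>2)"
      by (intro sum.cong refl) (simp add: power2_eq_square algebra_simps)
    also have "\<dots> = (\<Sum>i<n. (u i - ?f (xs i))\<^sup>2) + 2 * (real n * (lam * s)) + (\<Sum>i<n. (?f (xs i))\<^sup>2)"
      by (simp add: sum.distrib norm_eq flip: sum_distrib_left)
    finally show ?thesis by (simp add: sum_nonneg)
  qed
  moreover have "0 \<le> real n * (lam * s)" "0 \<le> (\<Sum>i<n. (?f (xs i))\<^sup>2)" using s0 lam by (simp_all add: sum_nonneg)
  ultimately have "(\<Sum>i<n. (?f (xs i))\<^sup>2) \<le> (\<Sum>i<n. (u i)\<^sup>2)" "real n * (lam * s) \<le> (\<Sum>i<n. (u i)\<^sup>2)"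
    by linarith+
  then have bounds: "(\<Sum>i<n. (?f (xs i))\<^sup>2) / real n \<le> (\<Sum>i<n. (u i)\<^sup>2) / real n" "lam * s \<le> (\<Sum>i<n. (u i)\<^sup>2) / real n"
    using n by (simp_all add: field_simps)
  show ?thesis
  proof (rule that[OF af as bounds])
    fix N :: nat and \<beta> ys g
    assume g: "\<And>x. g x = (\<Sum>j<N. \<beta> j * k (ys j) x)"
    define t where "t = (\<Sum>i<N. \<Sum>j<N. \<beta> i * \<beta> j * k (ys i) (ys j))"
    define b where "b m = (\<Sum>j<N. \<beta> j * e m (ys j))" for m
    have bg: "(\<lambda>m. b m * e m x) sums g x" for x
      unfolding g b_def by (rule kernel_span_features(1)[OF e])
    have bt: "(\<lambda>m. (b m)\<^sup>2) sums t"
      unfolding t_def b_def by (rule kernel_span_features(2)[OF e])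
    define r where "r = (\<Sum>i<n. c i * g (xs i))"
    have abr: "(\<lambda>m. a m * b m) sums r"
    proof -
      have "(\<lambda>m. \<Sum>i<n. c i * (b m * e m (xs i))) sums r"
        unfolding r_def by (intro sums_sum sums_mult bg)
      then show ?thesis by (simp add: a_def sum_distrib_left ac_simps)
    qed
    \<comment> \<open>The squared RKHS norm of the difference between the regressor and
      \<open>g\<close>, in coordinates.\<close>
    have "(\<lambda>m. (a m)\<^sup>2 - 2 * (a m * b m) + (b m)\<^sup>2) sums (s - 2 * r + t)"
      by (intro sums_add sums_diff sums_mult as abr bt)
    moreover have "0 \<le> (a m)\<^sup>2 - 2 * (a m * b m) + (b m)\<^sup>2" for m
      using zero_le_power2[of "a m - b m"] by (simp add: power2_diff)
    ultimately have tri: "0 \<le> s - 2 * r + t" by (rule sums_le[OF _ sums_zero, rotated])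
    have "(\<Sum>i<n. (u i - g (xs i))\<^sup>2) = (\<Sum>i<n. (u i - ?f (xs i))\<^sup>2 + 2 * ((u i - ?f (xs i)) * ?f (xs i))
        - 2 * ((u i - ?f (xs i)) * g (xs i)) + (?f (xs i) - g (xs i))\<^sup>2)"
      by (intro sum.cong refl) (simp add: power2_eq_square algebra_simps)
    also have "\<dots> = (\<Sum>i<n. (u i - ?f (xs i))\<^sup>2) + 2 * (real n * (lam * s)) - 2 * (real n * (lam * r))
        + (\<Sum>i<n. (?f (xs i) - g (xs i))\<^sup>2)"
      unfolding r_def by (simp add: sum.distrib sum_subtractf norm_eq test flip: sum_distrib_left)
    also have "\<dots> \<ge> (\<Sum>i<n. (u i - ?f (xs i))\<^sup>2) + real n * (lam * s - lam * t)"
    proof -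
      have "0 \<le> real n * (lam * (s - 2 * r + t))" using tri lam by simp
      moreover have "0 \<le> (\<Sum>i<n. (?f (xs i) - g (xs i))\<^sup>2)" by (simp add: sum_nonneg)
      ultimately show ?thesis by (simp add: algebra_simps)
    qed
    finally have *: "(\<Sum>i<n. (u i - ?f (xs i))\<^sup>2) + real n * (lam * s - lam * t) \<le> (\<Sum>i<n. (u i - g (xs i))\<^sup>2)" .
    then have "((\<Sum>i<n. (u i - ?f (xs i))\<^sup>2) + real n * (lam * s - lam * t)) / real n \<le> (\<Sum>i<n. (u i - g (xs i))\<^sup>2) / real n"
      by (rule divide_right_mono) simp
    then show "(\<Sum>i<n. (u i - ?f (xs i))\<^sup>2) / real n + lam * s
      \<le> (\<Sum>i<n. (u i - g (xs i))\<^sup>2) / real n + lam * (\<Sum>i<N. \<Sum>j<N. \<beta> i * \<beta> j * k (ys i) (ys j))"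
      using n by (simp add: t_def add_divide_distrib)
  qed
qed

text \<open>The response \<open>u\<close> is adjoined to the kernel features as coordinate \<open>0\<close>, so that residuals
  \<open>u - f\<close> of kernel functions \<open>f\<close> become linear in the features.\<close>

definition resp_features :: "('z \<Rightarrow> real) \<Rightarrow> (nat \<Rightarrow> 'x \<Rightarrow> real) \<Rightarrow> ('z \<Rightarrow> 'x) \<Rightarrow> nat \<Rightarrow> 'z \<Rightarrow> real" where
  "resp_features u e T m z = (case m of 0 \<Rightarrow> u z | Suc j \<Rightarrow> e j (T z))"

lemma resp_features_sums:
  assumes "(\<lambda>m. a m * e m (T z)) sums f"
  shows "(\<lambda>m. case_nat p a m * resp_features u e T m z) sums (p * u z + f)"
  using sums_Suc[of "\<lambda>m. case_nat p a m * resp_features u e T m z" f] assms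
  by (simp add: resp_features_def add.commute)

lemma case_nat_square_sums:
  fixes a :: "nat \<Rightarrow> real"
  assumes "(\<lambda>m. (a m)\<^sup>2) sums s"
  shows "(\<lambda>m. (case_nat p a m)\<^sup>2) sums (p\<^sup>2 + s)"
  using sums_Suc[of "\<lambda>m. (case_nat p a m)\<^sup>2" s] assms by (simp add: add.commute)

section \<open>Transfer between empirical and population second moments\<close>

text \<open>The Hilbert-Schmidt norm of empirical minus population second moment matrix, cut to
  \<open>L\<close> coordinates and not divided by \<open>n\<close>.\<close>

definition gram_deviation :: "'z measure \<Rightarrow> (nat \<Rightarrow> 'z \<Rightarrow> real) \<Rightarrow> nat \<Rightarrow> (nat \<Rightarrow> 'z) \<Rightarrow> nat \<Rightarrow> real" where
  "gram_deviation \<rho> F n zs L =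
    L2_set (\<lambda>(m, m'). \<Sum>i<n. F m (zs i) * F m' (zs i) - (\<integral>z. F m z * F m' z \<partial>\<rho>)) ({..<L} \<times> {..<L})"

text \<open>Observations are abstract points \<open>z\<close> with input \<open>T z\<close>, so that
  any function on them can serve as the response; later these are indicators of the output.\<close>

locale krr_sample = prob_space \<rho> for \<rho> :: "'z measure" +
  fixes k :: "'x::metric_space \<Rightarrow> 'x \<Rightarrow> real" and e :: "nat \<Rightarrow> 'x \<Rightarrow> real" and T :: "'z \<Rightarrow> 'x"
    and K :: real
  assumes k: "pd_kernel k" and ksums: "\<And>x y. (\<lambda>m. e m x * e m y) sums k x y"
    and e_cont: "\<And>m. continuous_on UNIV (e m)" and k_cont: "\<And>y. continuous_on UNIV (\<lambda>x. k x y)"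
    and k_bound: "\<And>x. k x x \<le> K" and T[measurable]: "T \<in> measurable \<rho> borel"
begin

lemma continuous_measurable [measurable (raw)]:
  "continuous_on UNIV g \<Longrightarrow> (\<lambda>z. g (T z)) \<in> borel_measurable \<rho>" for g :: "'x \<Rightarrow> real"
  by (rule measurable_compose[OF T borel_measurable_continuous_onI])

lemma resp_features_measurable [measurable]:
  assumes [measurable]: "u \<in> borel_measurable \<rho>"
  shows "resp_features u e T m \<in> borel_measurable \<rho>"
  unfolding resp_features_def using e_cont by (cases m) simp_all

lemma resp_features_bound:
  assumes "\<And>z. \<bar>u z\<bar> \<le> U"
  shows "(\<Sum>m<L. (resp_features u e T m z)\<^sup>2) \<le> U\<^sup>2 + K"
proof -
  have "(\<Sum>m<L. (resp_features u e T m z)\<^sup>2) \<le> (\<Sum>m<Suc L. (resp_features u e T m z)\<^sup>2)" by simp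
  also have "\<dots> = (u z)\<^sup>2 + (\<Sum>m<L. e m (T z) * e m (T z))"
    by (subst sum.lessThan_Suc_shift) (simp add: resp_features_def power2_eq_square)
  also have "(\<Sum>m<L. e m (T z) * e m (T z)) \<le> k (T z) (T z)"
    using sum_le_suminf[OF sums_summable[OF ksums], of "{..<L}" "T z" "T z"] sums_unique[OF ksums, of "T z" "T z"]
    by simp
  also have "\<dots> \<le> K" by (rule k_bound)
  also have "(u z)\<^sup>2 \<le> U\<^sup>2" using power_mono[OF assms[of z] abs_ge_zero, of 2] by simp
  finally show ?thesis by simp
qed

text \<open>Meant for two values of \<open>p\<close>: 0 gives second moments of kernel functions, -1
  gives squared residuals.\<close>

lemma deviation:
  assumes u[measurable]: "u \<in> borel_measurable \<rho>" and U: "\<And>z. \<bar>u z\<bar> \<le> U"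
    and zs: "\<And>i. zs i \<in> space \<rho>" and n: "0 < n"
    and dev: "\<And>L. gram_deviation \<rho> (resp_features u e T) n zs L \<le> real n * \<Delta>"
    and a: "(\<lambda>m. (a m)\<^sup>2) sums s" and f: "\<And>x. (\<lambda>m. a m * e m x) sums f x" and [measurable]: "(\<lambda>z. f (T z)) \<in> borel_measurable \<rho>"
  shows "\<bar>(\<Sum>i<n. (p * u (zs i) + f (T (zs i)))\<^sup>2) / real n - (\<integral>z. (p * u z + f (T z))\<^sup>2 \<partial>\<rho>)\<bar> \<le> \<Delta> * (p\<^sup>2 + s)"
  by (rule quadratic_deviation[where F="resp_features u e T" and d="case_nat p a" and B="U\<^sup>2 + K"])
    (use prob_space_axioms U zs n dev[unfolded gram_deviation_def] case_nat_square_sums[OF a] f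
      in \<open>auto intro!: resp_features_bound resp_features_sums\<close>)

text \<open>The a priori bounds control the empirical second moment of the fit and, through
  \<open>lam * s\<close>, the cost \<open>\<Delta> * s\<close> of passing to the population. The
  responses \<open>v\<close> are arbitrary numbers, since the bound is later read as a statement
  about a quadratic form in \<open>v\<close>.\<close>

lemma krr_stable:
  assumes u[measurable]: "u \<in> borel_measurable \<rho>" and U: "\<And>z. \<bar>u z\<bar> \<le> U"
    and zs: "\<And>i. zs i \<in> space \<rho>" and n: "0 < n" and lam: "0 < lam" and \<Delta>: "0 \<le> \<Delta>"
    and dev: "\<And>L. gram_deviation \<rho> (resp_features u e T) n zs L \<le> real n * \<Delta>"
  shows "(\<integral>z. (krr k n lam (\<lambda>i. T (zs i)) v (T z))\<^sup>2 \<partial>\<rho>) \<le> (1 + \<Delta> / lam) * ((\<Sum>i<n. (v i)\<^sup>2) / real n)"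
proof -
  let ?f = "krr k n lam (\<lambda>i. T (zs i)) v" and ?E = "(\<Sum>i<n. (v i)\<^sup>2) / real n"
  obtain a s where f: "\<And>x. (\<lambda>m. a m * e m x) sums ?f x" and a: "(\<lambda>m. (a m)\<^sup>2) sums s"
    and b: "(\<Sum>i<n. (?f (T (zs i)))\<^sup>2) / real n \<le> ?E" "lam * s \<le> ?E"
    by (rule krr_coefficients[OF k ksums lam n, where xs="\<lambda>i. T (zs i)" and u=v]) (rule that)
  have "(\<lambda>z. ?f (T z)) \<in> borel_measurable \<rho>"
    by (intro continuous_measurable krr_continuous k lam n k_cont)
  from deviation[OF u U zs n dev a f this, of 0]
  have "(\<integral>z. (?f (T z))\<^sup>2 \<partial>\<rho>) \<le> ?E + \<Delta> * s" using b(1) by simp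
  also have "\<Delta> * s \<le> \<Delta> / lam * ?E"
    using mult_left_mono[OF b(2), of "\<Delta> / lam"] \<Delta> lam by simp
  finally show ?thesis unfolding distrib_right by simp
qed

text \<open>From population to sample for the regressor, optimality on the sample, and back to the
  population for the competitor \<open>g\<close>. The two passages cost
  \<open>\<Delta> * (1 + s)\<close> and \<open>\<Delta> * (1 + t)\<close>. Only the first involves
  the sample-dependent \<open>s\<close>, known merely to satisfy
  \<open>lam * s \<le> U\<^sup>2\<close>.\<close>

lemma krr_risk_le:
  fixes N :: nat
  assumes u[measurable]: "u \<in> borel_measurable \<rho>" and U: "\<And>z. \<bar>u z\<bar> \<le> U"
    and zs: "\<And>i. zs i \<in> space \<rho>" and n: "0 < n" and lam: "0 < lam" and \<Delta>: "0 \<le> \<Delta>"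
    and dev: "\<And>L. gram_deviation \<rho> (resp_features u e T) n zs L \<le> real n * \<Delta>"
    and g: "\<And>x. g x = (\<Sum>j<N. \<beta> j * k (ys j) x)"
  defines "t \<equiv> (\<Sum>i<N. \<Sum>j<N. \<beta> i * \<beta> j * k (ys i) (ys j))"
  shows "(\<integral>z. (u z - krr k n lam (\<lambda>i. T (zs i)) (\<lambda>i. u (zs i)) (T z))\<^sup>2 \<partial>\<rho>)
    \<le> (\<integral>z. (u z - g (T z))\<^sup>2 \<partial>\<rho>) + (lam * t + \<Delta> * (1 + t) + \<Delta> + \<Delta> / lam * U\<^sup>2)"
proof -
  let ?f = "krr k n lam (\<lambda>i. T (zs i)) (\<lambda>i. u (zs i))"
  obtain a s where f: "\<And>x. (\<lambda>m. a m * e m x) sums ?f x" and a: "(\<lambda>m. (a m)\<^sup>2) sums s"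
    and s: "lam * s \<le> (\<Sum>i<n. (u (zs i))\<^sup>2) / real n"
    and opt: "(\<Sum>i<n. (u (zs i) - ?f (T (zs i)))\<^sup>2) / real n + lam * s
      \<le> (\<Sum>i<n. (u (zs i) - g (T (zs i)))\<^sup>2) / real n + lam * t"
    unfolding t_def
    by (rule krr_coefficients[OF k ksums lam n, where xs="\<lambda>i. T (zs i)" and u="\<lambda>i. u (zs i)"])
      (use g in \<open>blast intro: that\<close>)
  define b where "b m = (\<Sum>j<N. \<beta> j * e m (ys j))" for m
  have bg: "(\<lambda>m. b m * e m x) sums g x" for x
    unfolding g b_def by (rule kernel_span_features(1)[OF ksums])
  have bt: "(\<lambda>m. (b m)\<^sup>2) sums t"
    unfolding t_def b_def by (rule kernel_span_features(2)[OF ksums])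
  have fm: "(\<lambda>z. ?f (T z)) \<in> borel_measurable \<rho>"
    by (intro continuous_measurable krr_continuous k lam n k_cont)
  have "continuous_on UNIV (\<lambda>x. k y x)" for y
    using k_cont[of y] by (simp add: pd_kernel_sym[OF k, of y])
  then have gm: "(\<lambda>z. g (T z)) \<in> borel_measurable \<rho>"
    unfolding g by (intro continuous_measurable continuous_intros)
  have neg: "((-1) * x + y)\<^sup>2 = (x - y)\<^sup>2" for x y :: real by (simp add: power2_eq_square algebra_simps)
  have s0: "0 \<le> s" using a by (rule sums_le[OF _ sums_zero, rotated]) simp
  have "(\<Sum>i<n. (u (zs i))\<^sup>2) \<le> real n * U\<^sup>2"
    using sum_bounded_above[of "{..<n}" "\<lambda>i. (u (zs i))\<^sup>2" "U\<^sup>2"] power_mono[OF U abs_ge_zero, of _ 2] by simp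
  then have "(\<Sum>i<n. (u (zs i))\<^sup>2) / real n \<le> U\<^sup>2" using n by (simp add: field_simps)
  with s have "lam * s \<le> U\<^sup>2" by simp
  then have "\<Delta> * s \<le> \<Delta> / lam * U\<^sup>2"
    using mult_left_mono[of "lam * s" "U\<^sup>2" "\<Delta> / lam"] \<Delta> lam by simp
  moreover have "(\<integral>z. (u z - ?f (T z))\<^sup>2 \<partial>\<rho>) \<le> (\<Sum>i<n. (u (zs i) - ?f (T (zs i)))\<^sup>2) / real n + \<Delta> * (1 + s)"
    using deviation[OF u U zs n dev a f fm, of "-1"] unfolding neg by simp
  moreover have "(\<Sum>i<n. (u (zs i) - g (T (zs i)))\<^sup>2) / real n \<le> (\<integral>z. (u z - g (T z))\<^sup>2 \<partial>\<rho>) + \<Delta> * (1 + t)"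
    using deviation[OF u U zs n dev bt bg gm, of "-1"] unfolding neg by simp
  moreover have "0 \<le> lam * s" using s0 lam by simp
  ultimately show ?thesis using opt by (simp add: distrib_left)
qed

end

section \<open>Consistency of scalar regression\<close>

text \<open>Three losses of \<open>e / 3\<close>: a bounded Borel function with almost minimal risk,
  a continuous function close to it in L1 of the input distribution, and a uniformly close
  combination of kernel sections by universality.\<close>

lemma near_optimal_kernel_function:
  fixes k :: "'x::metric_space \<Rightarrow> 'x \<Rightarrow> real" and u :: "'z \<Rightarrow> real"
  assumes "prob_space \<rho>" and T[measurable]: "T \<in> measurable \<rho> borel" and u[measurable]: "u \<in> borel_measurable \<rho>"
    and U: "\<And>z. \<bar>u z\<bar> \<le> U" and k: "universal_kernel k" and e: "0 < e"
  obtains N :: nat and \<beta> ys where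
    "\<And>g. g \<in> borel_measurable borel \<Longrightarrow> \<exists>B. \<forall>x. \<bar>g x\<bar> \<le> B \<Longrightarrow>
      (\<integral>z. (u z - (\<Sum>j<N. \<beta> j * k (ys j) (T z)))\<^sup>2 \<partial>\<rho>) \<le> (\<integral>z. (u z - g (T z))\<^sup>2 \<partial>\<rho>) + e"
proof -
  interpret prob_space \<rho> by fact
  define R where "R g = (\<integral>z. (u z - g (T z))\<^sup>2 \<partial>\<rho>)" for g
  define G :: "('x \<Rightarrow> real) set" where "G = {g. g \<in> borel_measurable borel \<and> (\<exists>B. \<forall>x. \<bar>g x\<bar> \<le> B)}"
  have bdd: "bdd_below (R ` G)"
    by (rule bdd_belowI2[of _ 0]) (simp add: R_def)
  have ne: "G \<noteq> {}" by (auto simp: G_def intro!: exI[of _ "\<lambda>_. 0"])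
  obtain g where g: "g \<in> G" "R g < Inf (R ` G) + e / 3"
    using cInf_lessD[of "R ` G" "Inf (R ` G) + e / 3"] ne e by auto
  then obtain B0 where gm[measurable]: "g \<in> borel_measurable borel" and B0: "\<And>x. \<bar>g x\<bar> \<le> B0" by (auto simp: G_def)
  define B where "B = max B0 1"
  have B: "0 < B" "\<And>x. \<bar>g x\<bar> \<le> B" using B0 by (auto simp: B_def intro: order_trans max.cobounded1)
  have U0: "0 \<le> U" using U[of undefined] by linarith
  \<comment> \<open>The Lipschitz constant of the risk in L1 from
    \<open>squared_risk_diff_le\<close>; \<open>B + 1\<close> bounds the kernel function too, as it
    stays within \<delta> \<le> 1 of \<open>p\<close>.\<close>
  define D where "D = 2 * (U + (B + 1))"
  have D: "0 < D" using B U0 by (simp add: D_def)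
  let ?M = "distr \<rho> borel T"
  obtain p where pc: "continuous_on UNIV p" and pB: "\<And>x. \<bar>p x\<bar> \<le> B" and p: "(\<integral>x. \<bar>p x - g x\<bar> \<partial>?M) < e / (3 * D)"
    using L1_approx_continuous[of ?M g B "e / (3 * D)"] prob_space_distr[OF T] gm B D e by auto
  have pm[measurable]: "p \<in> borel_measurable borel" by (rule borel_measurable_continuous_onI[OF pc])
  define \<delta> where "\<delta> = min 1 (e / (3 * D))"
  have \<delta>: "0 < \<delta>" using e D by (simp add: \<delta>_def)
  have "\<forall>e>0. \<exists>(n::nat) c xs. \<forall>x. \<bar>p x - (\<Sum>i<n. c i * k (xs i) x)\<bar> < e"
    using k pc unfolding universal_kernel_def by blast
  then obtain N :: nat and \<beta> ys where g0: "\<And>x. \<bar>p x - (\<Sum>j<N. \<beta> j * k (ys j) x)\<bar> < \<delta>"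
    using \<delta> by blast
  define g0 where "g0 x = (\<Sum>j<N. \<beta> j * k (ys j) x)" for x
  have "continuous_on UNIV (k y)" for y
    using k continuous_on_compose2[of UNIV "\<lambda>(x, y). k x y" UNIV "\<lambda>x. (y, x)"]
    by (simp add: universal_kernel_def continuous_on_Pair)
  then have g0m[measurable]: "g0 \<in> borel_measurable borel"
    unfolding g0_def by (intro borel_measurable_continuous_onI continuous_intros)
  have g0B: "\<bar>g0 x\<bar> \<le> B + 1" for x
    using g0[of x] pB[of x] unfolding g0_def[symmetric] \<delta>_def by linarith
  have pB1: "\<bar>p x\<bar> \<le> B + 1" "\<bar>g x\<bar> \<le> B + 1" for x using pB[of x] B(2)[of x] by linarith+
  have "R p - R g \<le> D * (\<integral>z. \<bar>p (T z) - g (T z)\<bar> \<partial>\<rho>)"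
    using squared_risk_diff_le[OF \<open>prob_space \<rho>\<close> u, of "\<lambda>z. p (T z)" "\<lambda>z. g (T z)" U "B + 1"] U pB1
    by (simp add: R_def D_def abs_le_iff)
  also have "(\<integral>z. \<bar>p (T z) - g (T z)\<bar> \<partial>\<rho>) = (\<integral>x. \<bar>p x - g x\<bar> \<partial>?M)"
    by (simp add: integral_distr)
  also have "D * \<dots> \<le> D * (e / (3 * D))" using p D by (intro mult_left_mono) auto
  also have "\<dots> = e / 3" using D by simp
  finally have 1: "R p - R g \<le> e / 3" .
  have "R g0 - R p \<le> D * (\<integral>z. \<bar>g0 (T z) - p (T z)\<bar> \<partial>\<rho>)"
    using squared_risk_diff_le[OF \<open>prob_space \<rho>\<close> u, of "\<lambda>z. g0 (T z)" "\<lambda>z. p (T z)" U "B + 1"] U pB1 g0B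
    by (simp add: R_def D_def abs_le_iff)
  also have "(\<integral>z. \<bar>g0 (T z) - p (T z)\<bar> \<partial>\<rho>) \<le> e / (3 * D)"
  proof (rule integral_le_const)
    have le: "\<bar>g0 x - p x\<bar> \<le> e / (3 * D)" for x
      using g0[of x] unfolding g0_def[symmetric] \<delta>_def by linarith
    then show "AE z in \<rho>. \<bar>g0 (T z) - p (T z)\<bar> \<le> e / (3 * D)" by simp
    show "integrable \<rho> (\<lambda>z. \<bar>g0 (T z) - p (T z)\<bar>)"
      by (rule integrable_const_bound[of _ "e / (3 * D)"]) (simp_all add: le)
  qed
  also have "D * (e / (3 * D)) = e / 3" using D by simp
  finally have 2: "R g0 - R p \<le> e / 3" using D by simp
  show ?thesis
  proof (rule that)
    fix f :: "'x \<Rightarrow> real" assume "f \<in> borel_measurable borel" "\<exists>B. \<forall>x. \<bar>f x\<bar> \<le> B"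
    then have "Inf (R ` G) \<le> R f"
      using bdd by (intro cInf_lower) (auto simp: G_def)
    then show "(\<integral>z. (u z - (\<Sum>j<N. \<beta> j * k (ys j) (T z)))\<^sup>2 \<partial>\<rho>) \<le> (\<integral>z. (u z - f (T z))\<^sup>2 \<partial>\<rho>) + e"
      using 1 2 g(2) unfolding R_def g0_def by linarith
  qed
qed

locale krr_iid = krr_sample \<rho> k e T K + P: prob_space P
  for \<rho> :: "'z measure" and k :: "'x::metric_space \<Rightarrow> 'x \<Rightarrow> real" and e T K and P :: "'o measure" +
  fixes Z :: "nat \<Rightarrow> 'o \<Rightarrow> 'z"
  assumes compact_X: "compact (UNIV :: 'x set)" and universal: "universal_kernel k"
    and indep: "P.indep_vars (\<lambda>_. \<rho>) Z UNIV" and distr_Z: "\<And>i. distr P \<rho> (Z i) = \<rho>"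
begin

abbreviation rate :: "nat \<Rightarrow> real" where "rate n \<equiv> real n powr (-1/4)"

abbreviation est :: "'o \<Rightarrow> nat \<Rightarrow> (nat \<Rightarrow> real) \<Rightarrow> 'x \<Rightarrow> real" where
  "est w n v \<equiv> krr k n (rate n) (\<lambda>i. T (Z i w)) v"

lemma Z_space: "w \<in> space P \<Longrightarrow> Z i w \<in> space \<rho>"
  using indep by (auto simp: P.indep_vars_def dest: measurable_space)

text \<open>Since n^(3/4) is \<open>n * rate n\<close>, the averaged deviation is eventually below
  any multiple of the regularisation parameter.\<close>

lemma gram_deviation_rate:
  assumes u: "u \<in> borel_measurable \<rho>" and U: "\<And>z. \<bar>u z\<bar> \<le> U"
  shows "AE w in P. \<forall>\<eta>>0. \<exists>n0>0. \<forall>n\<ge>n0. \<forall>L.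
    gram_deviation \<rho> (resp_features u e T) n (\<lambda>i. Z i w) L \<le> real n * (\<eta> * rate n)"
proof -
  have "AE w in P. \<forall>\<eta>>0. \<exists>n0. \<forall>n\<ge>n0. \<forall>L.
    gram_deviation \<rho> (resp_features u e T) n (\<lambda>i. Z i w) L \<le> \<eta> * real n powr (3/4)"
    unfolding gram_deviation_def
    by (rule P.gram_strong_law_rate[OF indep distr_Z resp_features_measurable[OF u] resp_features_bound[OF U]])
  then show ?thesis
  proof (rule AE_mp, intro AE_I2 impI allI)
    fix w and \<eta> :: real
    assume "0 < \<eta>" and "\<forall>\<eta>>0. \<exists>n0. \<forall>n\<ge>n0. \<forall>L.
      gram_deviation \<rho> (resp_features u e T) n (\<lambda>i. Z i w) L \<le> \<eta> * real n powr (3/4)"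
    then obtain n0 where n0: "\<And>n L. n0 \<le> n \<Longrightarrow>
      gram_deviation \<rho> (resp_features u e T) n (\<lambda>i. Z i w) L \<le> \<eta> * real n powr (3/4)" by blast
    have "real n powr (3/4) = real n * rate n" if "0 < n" for n
    proof -
      have "real n powr (3/4) = real n powr 1 * rate n" unfolding powr_add[symmetric] by simp
      then show ?thesis using that by simp
    qed
    then have "gram_deviation \<rho> (resp_features u e T) n (\<lambda>i. Z i w) L \<le> real n * (\<eta> * rate n)"
      if "Suc n0 \<le> n" for n L
      using n0[of n L] that by (simp add: mult.left_commute[of _ \<eta>])
    then show "\<exists>n0>0. \<forall>n\<ge>n0. \<forall>L.
      gram_deviation \<rho> (resp_features u e T) n (\<lambda>i. Z i w) L \<le> real n * (\<eta> * rate n)"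
      by blast
  qed
qed

text \<open>\<open>krr_stable\<close> with deviation \<open>rate n\<close>, so that its factor 1 +
  \<Delta> / \<lambda> is 2. The response coordinate is filled with the zero function, and one null
  set serves all \<open>v\<close>.\<close>

lemma est_stable:
  "AE w in P. \<exists>n0>0. \<forall>n\<ge>n0. \<forall>v. (\<integral>z. (est w n v (T z))\<^sup>2 \<partial>\<rho>) \<le> 2 * ((\<Sum>i<n. (v i)\<^sup>2) / real n)"
proof (rule AE_mp[OF gram_deviation_rate[of "\<lambda>_. 0" 0]])
  show "AE w in P. (\<forall>\<eta>>0. \<exists>n0>0. \<forall>n\<ge>n0. \<forall>L.
      gram_deviation \<rho> (resp_features (\<lambda>_. 0) e T) n (\<lambda>i. Z i w) L \<le> real n * (\<eta> * rate n)) \<longrightarrow>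
    (\<exists>n0>0. \<forall>n\<ge>n0. \<forall>v. (\<integral>z. (est w n v (T z))\<^sup>2 \<partial>\<rho>) \<le> 2 * ((\<Sum>i<n. (v i)\<^sup>2) / real n))"
  proof (intro AE_I2 impI)
    fix w
    assume w: "w \<in> space P" and "\<forall>\<eta>>0. \<exists>n0>0. \<forall>n\<ge>n0. \<forall>L.
      gram_deviation \<rho> (resp_features (\<lambda>_. 0) e T) n (\<lambda>i. Z i w) L \<le> real n * (\<eta> * rate n)"
    then obtain n0 :: nat where n0: "0 < n0" "\<And>n L. n0 \<le> n \<Longrightarrow>
      gram_deviation \<rho> (resp_features (\<lambda>_. 0) e T) n (\<lambda>i. Z i w) L \<le> real n * (1 * rate n)"
      by (meson zero_less_one)
    show "\<exists>n0>0. \<forall>n\<ge>n0. \<forall>v. (\<integral>z. (est w n v (T z))\<^sup>2 \<partial>\<rho>) \<le> 2 * ((\<Sum>i<n. (v i)\<^sup>2) / real n)"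
    proof (intro exI[of _ n0] conjI allI impI)
      fix n v assume n: "n0 \<le> n"
      then have "0 < n" using n0(1) by simp
      then show "(\<integral>z. (est w n v (T z))\<^sup>2 \<partial>\<rho>) \<le> 2 * ((\<Sum>i<n. (v i)\<^sup>2) / real n)"
        using krr_stable[of "\<lambda>_. 0" 0 "\<lambda>i. Z i w" n "rate n" "1 * rate n" v] n0(2)[OF n] Z_space[OF w] by simp
    qed (use n0 in auto)
  qed
qed simp_all

text \<open>A competitor is fixed first, so its squared norm \<open>t\<close> stays constant while n
  grows. The risk is then within \<open>\<epsilon>\<^sup>2\<close> of that of every bounded Borel
  function, in particular of each perturbation of the regressor by a multiple of \<open>q\<close>.
  The threshold does not depend on \<open>q\<close>.\<close>

proposition est_consistent:
  assumes u[measurable]: "u \<in> borel_measurable \<rho>" and U: "\<And>z. \<bar>u z\<bar> \<le> U"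
  shows "AE w in P. \<forall>\<epsilon>>0. \<exists>n0. \<forall>n\<ge>n0. \<forall>q. q \<in> borel_measurable borel \<longrightarrow> (\<forall>x. \<bar>q x\<bar> \<le> 1) \<longrightarrow>
    \<bar>\<integral>z. q (T z) * (u z - est w n (\<lambda>i. u (Z i w)) (T z)) \<partial>\<rho>\<bar> \<le> \<epsilon>"
proof (rule AE_mp[OF gram_deviation_rate[OF u U]], intro AE_I2 impI allI)
  fix w and \<epsilon> :: real
  assume w: "w \<in> space P" and \<epsilon>: "0 < \<epsilon>" and dev: "\<forall>\<eta>>0. \<exists>n0>0. \<forall>n\<ge>n0. \<forall>L.
    gram_deviation \<rho> (resp_features u e T) n (\<lambda>i. Z i w) L \<le> real n * (\<eta> * rate n)"
  have \<epsilon>2: "0 < \<epsilon>\<^sup>2 / 2" using \<epsilon> by simp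
  obtain N :: nat and \<beta> ys where opt: "\<And>g. g \<in> borel_measurable borel \<Longrightarrow> \<exists>B. \<forall>x. \<bar>g x\<bar> \<le> B \<Longrightarrow>
      (\<integral>z. (u z - (\<Sum>j<N. \<beta> j * k (ys j) (T z)))\<^sup>2 \<partial>\<rho>) \<le> (\<integral>z. (u z - g (T z))\<^sup>2 \<partial>\<rho>) + \<epsilon>\<^sup>2 / 2"
    by (rule near_optimal_kernel_function[OF prob_space_axioms T u U universal \<epsilon>2]) (rule that)
  define t where "t = (\<Sum>i<N. \<Sum>j<N. \<beta> i * \<beta> j * k (ys i) (ys j))"
  have t: "0 \<le> t" unfolding t_def by (rule pd_kernelD[OF k])
  \<comment> \<open>The one error term that does not shrink with \<open>rate n\<close> is \<Delta> /
    \<lambda> times \<open>U\<^sup>2\<close>, that is \<open>\<eta> * U\<^sup>2\<close>; this choice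
    makes it at most \<open>\<epsilon>\<^sup>2 / 4\<close>.\<close>
  define \<eta> where "\<eta> = min 1 (\<epsilon>\<^sup>2 / (4 * (U\<^sup>2 + 1)))"
  have U2: "0 < U\<^sup>2 + 1" by (rule add_nonneg_pos) simp_all
  have \<eta>: "0 < \<eta>" "\<eta> \<le> 1" using \<epsilon> U2 by (simp_all add: \<eta>_def)
  have "\<eta> * U\<^sup>2 \<le> \<epsilon>\<^sup>2 / (4 * (U\<^sup>2 + 1)) * (U\<^sup>2 + 1)"
    unfolding \<eta>_def by (intro mult_mono) auto
  also have "\<dots> = \<epsilon>\<^sup>2 / 4" using U2 by (simp add: field_simps)
  finally have \<eta>U: "\<eta> * U\<^sup>2 \<le> \<epsilon>\<^sup>2 / 4" .
  obtain n1 where n1: "0 < n1" "\<And>n L. n1 \<le> n \<Longrightarrow>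
      gram_deviation \<rho> (resp_features u e T) n (\<lambda>i. Z i w) L \<le> real n * (\<eta> * rate n)"
    using dev \<eta>(1) by meson
  \<comment> \<open>With \<eta> \<le> 1 the remaining terms add up to at most
    \<open>rate n * (2 * t + 2)\<close>.\<close>
  have "\<forall>\<^sub>F n in sequentially. rate n * (2 * t + 2) \<le> \<epsilon>\<^sup>2 / 4"
  proof -
    have "(\<lambda>n. rate n * (2 * t + 2)) \<longlonglongrightarrow> 0" by real_asymp
    then have "\<forall>\<^sub>F n in sequentially. rate n * (2 * t + 2) < \<epsilon>\<^sup>2 / 4"
      using \<epsilon> by (intro order_tendstoD(2)) auto
    then show ?thesis by (rule eventually_mono) simp
  qed
  then obtain n2 where n2: "\<And>n. n2 \<le> n \<Longrightarrow> rate n * (2 * t + 2) \<le> \<epsilon>\<^sup>2 / 4"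
    unfolding eventually_sequentially by blast
  show "\<exists>n0. \<forall>n\<ge>n0. \<forall>q. q \<in> borel_measurable borel \<longrightarrow> (\<forall>x. \<bar>q x\<bar> \<le> 1) \<longrightarrow>
    \<bar>\<integral>z. q (T z) * (u z - est w n (\<lambda>i. u (Z i w)) (T z)) \<partial>\<rho>\<bar> \<le> \<epsilon>"
  proof (intro exI[of _ "max n1 n2"] allI impI)
    fix n and q :: "'x \<Rightarrow> real"
    assume n: "max n1 n2 \<le> n" and q[measurable]: "q \<in> borel_measurable borel" and q1: "\<forall>x. \<bar>q x\<bar> \<le> 1"
    let ?f = "est w n (\<lambda>i. u (Z i w))"
    have n0: "0 < n" and lam: "0 < rate n" using n n1(1) by auto
    have fc: "continuous_on UNIV ?f" by (intro krr_continuous k lam n0 k_cont)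
    then have fm[measurable]: "?f \<in> borel_measurable borel" by (rule borel_measurable_continuous_onI)
    have "bounded (range ?f)" by (intro compact_imp_bounded compact_continuous_image fc compact_X)
    then obtain B where B: "\<And>x. \<bar>?f x\<bar> \<le> B" by (auto simp: bounded_iff)
    have "rate n * t + \<eta> * rate n * (1 + t) + \<eta> * rate n + \<eta> * rate n / rate n * U\<^sup>2
        \<le> rate n * (2 * t + 2) + \<eta> * U\<^sup>2"
      using mult_right_mono[OF \<eta>(2), of "rate n * (2 + t)"] t lam by (simp add: algebra_simps)
    also have "\<dots> \<le> \<epsilon>\<^sup>2 / 2" using n2[of n] n \<eta>U by simp
    finally have err: "rate n * t + \<eta> * rate n * (1 + t) + \<eta> * rate n + \<eta> * rate n / rate n * U\<^sup>2 \<le> \<epsilon>\<^sup>2 / 2" .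
    have "(\<integral>z. (u z - ?f (T z))\<^sup>2 \<partial>\<rho>) \<le> (\<integral>z. (u z - (\<Sum>j<N. \<beta> j * k (ys j) (T z)))\<^sup>2 \<partial>\<rho>)
        + (rate n * t + \<eta> * rate n * (1 + t) + \<eta> * rate n + \<eta> * rate n / rate n * U\<^sup>2)"
      unfolding t_def using n \<eta>(1)
      by (intro krr_risk_le[OF u U Z_space[OF w] n0 lam _ n1(2)]) simp_all
    with err have "(\<integral>z. (u z - ?f (T z))\<^sup>2 \<partial>\<rho>) \<le> (\<integral>z. (u z - (\<Sum>j<N. \<beta> j * k (ys j) (T z)))\<^sup>2 \<partial>\<rho>) + \<epsilon>\<^sup>2 / 2"
      by linarith
    then have min: "(\<integral>z. (u z - ?f (T z))\<^sup>2 \<partial>\<rho>) \<le> (\<integral>z. (u z - g (T z))\<^sup>2 \<partial>\<rho>) + \<epsilon>\<^sup>2"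
      if "g \<in> borel_measurable borel" "\<exists>B. \<forall>x. \<bar>g x\<bar> \<le> B" for g
      using opt[OF that] by linarith
    have "\<bar>\<integral>z. q (T z) * (u z - ?f (T z)) \<partial>\<rho>\<bar> \<le> sqrt (\<epsilon>\<^sup>2)"
    proof (rule near_minimal_risk_residual[OF prob_space_axioms u _ _ U, where B=B])
      fix s
      have "\<bar>?f x + s * q x\<bar> \<le> B + \<bar>s\<bar>" for x
        using abs_triangle_ineq[of "?f x" "s * q x"] B[of x] mult_left_mono[of "\<bar>q x\<bar>" 1 "\<bar>s\<bar>"] q1
        by (simp add: abs_mult)
      then show "(\<integral>z. (u z - ?f (T z))\<^sup>2 \<partial>\<rho>) \<le> (\<integral>z. (u z - (?f (T z) + s * q (T z)))\<^sup>2 \<partial>\<rho>) + \<epsilon>\<^sup>2"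
        by (intro min[of "\<lambda>x. ?f x + s * q x"]) (measurable, blast)
    qed (use B q1 \<epsilon> fm q in \<open>auto intro!: measurable_compose[OF T]\<close>)
    then show "\<bar>\<integral>z. q (T z) * (u z - ?f (T z)) \<partial>\<rho>\<bar> \<le> \<epsilon>" using \<epsilon> by simp
  qed
qed

end

section \<open>Consistency of the surrogate loss\<close>

lemma (in prob_space) square_integral_le:
  fixes f :: "'a \<Rightarrow> real"
  assumes "integrable M f" "integrable M (\<lambda>x. (f x)\<^sup>2)"
  shows "(\<integral>x. f x \<partial>M)\<^sup>2 \<le> (\<integral>x. (f x)\<^sup>2 \<partial>M)"
  using variance_positive[of f] variance_eq[OF assms] by simp

text \<open>Each point is assigned to the first of finitely many \<delta>-balls that contains its
  image; taking the least index makes the cells disjoint and Borel.\<close>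

lemma step_approximation:
  fixes \<Psi> :: "real \<Rightarrow> 'h::real_normed_vector"
  assumes cont: "continuous_on UNIV \<Psi>" and comp: "compact (range \<Psi>)" and \<delta>: "0 < \<delta>"
  obtains M :: nat and v :: "nat \<Rightarrow> 'h" and A :: "nat \<Rightarrow> real set"
  where "\<And>m. A m \<in> sets borel" and "\<And>y. norm (\<Psi> y - (\<Sum>m<M. indicator (A m) y *\<^sub>R v m)) < \<delta>"
proof -
  obtain F where F: "finite F" "range \<Psi> \<subseteq> (\<Union>x\<in>F. ball x \<delta>)"
    using comp \<delta> unfolding compact_eq_totally_bounded by blast
  obtain M :: nat and v where v: "F = v ` {i. i < M}" using finite_imp_nat_seg_image_inj_on[OF F(1)] by blast
  have ex: "\<exists>m<M. norm (\<Psi> y - v m) < \<delta>" for y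
    using subsetD[OF F(2), of "\<Psi> y"] unfolding v by (auto simp: dist_norm norm_minus_commute)
  define I where "I y = (LEAST m. norm (\<Psi> y - v m) < \<delta>)" for y
  have I: "norm (\<Psi> y - v (I y)) < \<delta>" "I y < M" for y
    using LeastI_ex[of "\<lambda>m. norm (\<Psi> y - v m) < \<delta>"] ex[of y]
      le_less_trans[OF Least_le[of "\<lambda>m. norm (\<Psi> y - v m) < \<delta>"]] by (auto simp: I_def)
  have before: "\<not> norm (\<Psi> y - v j) < \<delta>" if "j < I y" for j y
    using that unfolding I_def by (rule not_less_Least)
  define D where "D m = {y. norm (\<Psi> y - v m) < \<delta>}" for m
  have Dm: "D m \<in> sets borel" for m
    unfolding D_def by (intro borel_open open_Collect_less continuous_intros cont)
  show ?thesis
  proof (rule that)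
    fix m
    have "{y. I y = m} = D m \<inter> (\<Inter>j\<in>{..<m}. - D j)"
    proof (intro set_eqI iffI)
      fix y assume "y \<in> {y. I y = m}"
      then show "y \<in> D m \<inter> (\<Inter>j\<in>{..<m}. - D j)"
        using I(1)[of y] before[of _ y] by (auto simp: D_def)
    next
      fix y assume "y \<in> D m \<inter> (\<Inter>j\<in>{..<m}. - D j)"
      then have y: "norm (\<Psi> y - v m) < \<delta>" "\<And>j. j < m \<Longrightarrow> \<not> norm (\<Psi> y - v j) < \<delta>" by (auto simp: D_def)
      have "I y = m"
        unfolding I_def
      proof (rule Least_equality[where P="\<lambda>m. norm (\<Psi> y - v m) < \<delta>", OF y(1)])
        show "m \<le> j" if "norm (\<Psi> y - v j) < \<delta>" for j using y(2)[of j] that by (cases "j < m") auto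
      qed
      then show "y \<in> {y. I y = m}" by simp
    qed
    then show "{y. I y = m} \<in> sets borel"
      using Dm by (cases "m = 0") (auto intro!: sets.Int sets.finite_INT borel_comp)
  next
    fix y
    have "(\<Sum>m<M. indicator {y. I y = m} y *\<^sub>R v m) = (\<Sum>m<M. if m = I y then v m else 0)"
      by (intro sum.cong) auto
    also have "\<dots> = v (I y)" using I(2) by simp
    finally show "norm (\<Psi> y - (\<Sum>m<M. indicator {y. I y = m} y *\<^sub>R v m)) < \<delta>" using I(1) by simp
  qed
qed

text \<open>Monotonicity reduces all positive reals to the countably many 1 / (j + 1). It is needed
  where the construction, such as a step approximation, depends on \<epsilon> and so brings its own
  null set.\<close>

lemma AE_all_positive_reals:
  fixes Q :: "real \<Rightarrow> 'a \<Rightarrow> bool"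
  assumes ev: "\<And>\<epsilon>. 0 < \<epsilon> \<Longrightarrow> AE w in M. Q \<epsilon> w" and mono: "\<And>\<epsilon> \<epsilon>' w. \<epsilon> \<le> \<epsilon>' \<Longrightarrow> Q \<epsilon> w \<Longrightarrow> Q \<epsilon>' w"
  shows "AE w in M. \<forall>\<epsilon>>0. Q \<epsilon> w"
proof -
  have "AE w in M. \<forall>j::nat. Q (1 / real (Suc j)) w"
    unfolding AE_all_countable by (intro allI ev) simp
  then show ?thesis
  proof (rule AE_mp, intro AE_I2 impI allI)
    fix w and \<epsilon> :: real assume Q: "\<forall>j. Q (1 / real (Suc j)) w" and "0 < \<epsilon>"
    obtain j where "1 / real (Suc j) < \<epsilon>" using nat_approx_posE[OF \<open>0 < \<epsilon>\<close>] by blast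
    then show "Q \<epsilon> w" using Q mono less_imp_le by blast
  qed
qed

context krr_iid
begin

lemma continuous_bounded:
  fixes g :: "'x \<Rightarrow> real"
  assumes "continuous_on UNIV g"
  obtains B where "0 < B" "\<And>x. \<bar>g x\<bar> \<le> B"
proof -
  have "bounded (range g)" by (intro compact_imp_bounded compact_continuous_image assms compact_X)
  then obtain B where "0 < B" "\<forall>y\<in>range g. norm y \<le> B" unfolding bounded_pos by blast
  then show ?thesis using that by auto
qed

lemma integrable_bounded_mult:
  fixes f :: "'z \<Rightarrow> real" and g :: "'x \<Rightarrow> real"
  assumes g: "continuous_on UNIV g" and [measurable]: "f \<in> borel_measurable \<rho>" and f: "\<And>z. \<bar>f z\<bar> \<le> B"
  shows "integrable \<rho> (\<lambda>z. g (T z) * f z)"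
proof -
  obtain C where C: "0 < C" "\<And>x. \<bar>g x\<bar> \<le> C" by (rule continuous_bounded[OF g]) (rule that)
  have [measurable]: "(\<lambda>z. g (T z)) \<in> borel_measurable \<rho>" by (rule continuous_measurable[OF g])
  show ?thesis
  proof (rule integrable_const_bound[of _ "C * B"])
    show "AE z in \<rho>. norm (g (T z) * f z) \<le> C * B"
      using C f by (auto simp: abs_mult intro!: AE_I2 mult_mono)
  qed simp
qed

lemma integrable_continuous: "continuous_on UNIV g \<Longrightarrow> integrable \<rho> (\<lambda>z. g (T z))" for g :: "'x \<Rightarrow> real"
  using integrable_bounded_mult[of g "\<lambda>_. 1" 1] by simp

lemma weights_continuous:
  "0 < n \<Longrightarrow> i < n \<Longrightarrow> continuous_on UNIV (\<lambda>x. krr_weights k n (rate n) (\<lambda>i. T (Z i w)) x i)"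
  by (intro krr_weights_continuous k k_cont) simp_all

text \<open>Stability carries over to Hilbert space valued responses, because it states that a quadratic
  form in the responses is positive semidefinite.\<close>

lemma weighted_sum_norm_le:
  fixes r :: "nat \<Rightarrow> 'h::real_inner"
  assumes n: "0 < n"
    and stable: "\<And>v. (\<integral>z. (est w n v (T z))\<^sup>2 \<partial>\<rho>) \<le> 2 * ((\<Sum>i<n. (v i)\<^sup>2) / real n)"
    and r: "\<And>i. norm (r i) \<le> \<delta>"
  shows "(\<integral>z. norm (\<Sum>i<n. krr_weights k n (rate n) (\<lambda>i. T (Z i w)) (T z) i *\<^sub>R r i) \<partial>\<rho>) \<le> 2 * \<delta>"
proof -
  define \<alpha> where "\<alpha> i x = krr_weights k n (rate n) (\<lambda>i. T (Z i w)) x i" for i x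
  have \<alpha>c: "continuous_on UNIV (\<alpha> i)" if "i < n" for i
    unfolding \<alpha>_def[abs_def] by (rule weights_continuous[OF n that])
  define G where "G x = norm (\<Sum>i<n. \<alpha> i x *\<^sub>R r i)" for x
  have Gc: "continuous_on UNIV G" unfolding G_def by (intro continuous_intros \<alpha>c) simp
  define S where "S i j = (\<integral>z. \<alpha> i (T z) * \<alpha> j (T z) \<partial>\<rho>)" for i j
  \<comment> \<open>The matrix of the form that \<open>stable\<close> declares nonnegative.\<close>
  define N where "N i j = (if i = j then 2 / real n else 0) - S i j" for i j
  have int: "integrable \<rho> (\<lambda>z. \<alpha> i (T z) * \<alpha> j (T z))" if "i < n" "j < n" for i j
    using that by (intro integrable_continuous continuous_intros \<alpha>c)
  have S_sum: "(\<integral>z. (\<Sum>i<n. \<Sum>j<n. \<alpha> i (T z) * \<alpha> j (T z) * c i j) \<partial>\<rho>) = (\<Sum>i<n. \<Sum>j<n. S i j * c i j)" for c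
  proof -
    have "(\<integral>z. (\<Sum>i<n. \<Sum>j<n. \<alpha> i (T z) * \<alpha> j (T z) * c i j) \<partial>\<rho>) =
        (\<Sum>i<n. \<integral>z. (\<Sum>j<n. \<alpha> i (T z) * \<alpha> j (T z) * c i j) \<partial>\<rho>)"
      by (intro Bochner_Integration.integral_sum Bochner_Integration.integrable_sum integrable_mult_left int) simp_all
    also have "\<dots> = (\<Sum>i<n. \<Sum>j<n. \<integral>z. \<alpha> i (T z) * \<alpha> j (T z) * c i j \<partial>\<rho>)"
      by (intro sum.cong refl Bochner_Integration.integral_sum integrable_mult_left int) simp_all
    finally show ?thesis by (simp add: S_def)
  qed
  have N_sum: "(\<Sum>i<n. \<Sum>j<n. N i j * c i j) = 2 / real n * (\<Sum>i<n. c i i) - (\<Sum>i<n. \<Sum>j<n. S i j * c i j)" for c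
  proof -
    have "N i j * c i j = (if i = j then 2 / real n * c i i else 0) - S i j * c i j" for i j
      by (simp add: N_def algebra_simps)
    then show ?thesis by (simp add: sum_subtractf sum_distrib_left)
  qed
  have "0 \<le> (\<Sum>i<n. \<Sum>j<n. N i j * (r i \<bullet> r j))"
  proof (rule psd_form_inner_nonneg)
    fix c :: "nat \<Rightarrow> real"
    have "(\<Sum>i<n. \<Sum>j<n. S i j * (c i * c j)) = (\<integral>z. (est w n c (T z))\<^sup>2 \<partial>\<rho>)"
      unfolding S_sum[symmetric]
      by (intro Bochner_Integration.integral_cong refl) (simp add: krr_def \<alpha>_def power2_eq_square sum_product ac_simps)
    also have "\<dots> \<le> 2 * ((\<Sum>i<n. (c i)\<^sup>2) / real n)" by (rule stable)
    finally show "0 \<le> (\<Sum>i<n. \<Sum>j<n. N i j * (c i * c j))" unfolding N_sum by (simp add: power2_eq_square)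
  qed simp
  then have "(\<Sum>i<n. \<Sum>j<n. S i j * (r i \<bullet> r j)) \<le> 2 / real n * (\<Sum>i<n. r i \<bullet> r i)" unfolding N_sum by simp
  also have "\<dots> \<le> 2 / real n * (real n * \<delta>\<^sup>2)"
  proof (intro mult_left_mono)
    have "r i \<bullet> r i \<le> \<delta>\<^sup>2" for i
      using power_mono[OF r norm_ge_zero, of i 2] by (simp add: power2_norm_eq_inner)
    then show "(\<Sum>i<n. r i \<bullet> r i) \<le> real n * \<delta>\<^sup>2" using sum_bounded_above[of "{..<n}" "\<lambda>i. r i \<bullet> r i"] by simp
  qed simp
  also have "\<dots> = 2 * \<delta>\<^sup>2" using n by simp
  also have "(\<Sum>i<n. \<Sum>j<n. S i j * (r i \<bullet> r j)) = (\<integral>z. (G (T z))\<^sup>2 \<partial>\<rho>)"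
    unfolding S_sum[symmetric]
    by (intro Bochner_Integration.integral_cong refl)
      (simp add: G_def power2_norm_eq_inner inner_sum_left inner_sum_right sum_distrib_left inner_commute ac_simps)
  finally have "(\<integral>z. (G (T z))\<^sup>2 \<partial>\<rho>) \<le> 2 * \<delta>\<^sup>2" .
  moreover have "(\<integral>z. G (T z) \<partial>\<rho>)\<^sup>2 \<le> (\<integral>z. (G (T z))\<^sup>2 \<partial>\<rho>)"
    by (intro square_integral_le integrable_continuous continuous_intros Gc)
  moreover have "2 * \<delta>\<^sup>2 \<le> (2 * \<delta>)\<^sup>2" by (simp add: power_mult_distrib)
  ultimately have "(\<integral>z. G (T z) \<partial>\<rho>)\<^sup>2 \<le> (2 * \<delta>)\<^sup>2" by linarith
  moreover have "0 \<le> 2 * \<delta>" using order_trans[OF norm_ge_zero[of "r 0"] r[of 0]] by simp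
  ultimately have "(\<integral>z. G (T z) \<partial>\<rho>) \<le> 2 * \<delta>" by (rule power2_le_imp_le)
  then show ?thesis unfolding G_def \<alpha>_def .
qed

section \<open>Bounds, measurability and integrability of the loss\<close>

lemma loss_bounded:
  fixes \<Psi> :: "real \<Rightarrow> 'h::real_inner" and V :: "'h \<Rightarrow> 'h"
  assumes comp: "compact (range \<Psi>)" and V: "bounded_linear V"
  obtains C where "0 < C" "\<And>y x. \<bar>\<Psi> y \<bullet> V x\<bar> \<le> C * norm x" "\<And>y y'. \<bar>\<Psi> y \<bullet> V (\<Psi> y')\<bar> \<le> C"
proof -
  obtain R where R: "0 < R" "\<And>y. norm (\<Psi> y) \<le> R"
    using compact_imp_bounded[OF comp] unfolding bounded_pos by auto
  obtain CV where CV: "0 < CV" "\<And>x. norm (V x) \<le> norm x * CV" using bounded_linear.pos_bounded[OF V] by blast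
  have ip: "\<bar>\<Psi> y \<bullet> V x\<bar> \<le> R * CV * norm x" for x y
  proof -
    have "\<bar>\<Psi> y \<bullet> V x\<bar> \<le> norm (\<Psi> y) * norm (V x)" by (rule Cauchy_Schwarz_ineq2)
    also have "\<dots> \<le> R * (norm x * CV)" using R CV by (intro mult_mono) auto
    finally show ?thesis by (simp add: ac_simps)
  qed
  show ?thesis
  \<comment> \<open>The factor R + 1 dominates both 1 and \<open>norm (\<Psi> y')\<close>, so one
    constant serves both bounds.\<close>
  proof (rule that[of "R * CV * (R + 1)"])
    show "0 < R * CV * (R + 1)" using R(1) CV(1) by simp
    have pos: "0 < R * CV" using R(1) CV(1) by simp
    have "R * CV * 1 \<le> R * CV * (R + 1)" using pos R(1) by (intro mult_left_mono) auto
    then show "\<bar>\<Psi> y \<bullet> V x\<bar> \<le> R * CV * (R + 1) * norm x" for x y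
      using order_trans[OF ip mult_right_mono[OF _ norm_ge_zero]] by simp
    have "R * CV * norm (\<Psi> y') \<le> R * CV * (R + 1)" for y'
      using pos R(2)[of y'] by (intro mult_left_mono) auto
    then show "\<bar>\<Psi> y \<bullet> V (\<Psi> y')\<bar> \<le> R * CV * (R + 1)" for y y'
      using order_trans[OF ip] by blast
  qed
qed

lemma continuous_inner_measurable:
  fixes \<Psi> :: "real \<Rightarrow> 'h::real_inner"
  assumes "continuous_on UNIV \<Psi>"
  shows "(\<lambda>y. \<Psi> y \<bullet> x) \<in> borel_measurable borel"
  by (intro borel_measurable_continuous_onI continuous_intros assms)

text \<open>The loss is a continuous real function on the plane, so only scalar measurability has to
  be checked.\<close>

lemma loss_measurable:
  fixes \<Psi> :: "real \<Rightarrow> 'h::real_inner" and V :: "'h \<Rightarrow> 'h"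
  assumes \<Psi>c: "continuous_on UNIV \<Psi>" and V: "bounded_linear V"
    and Y: "Y \<in> borel_measurable \<rho>" and h: "h \<in> borel_measurable borel"
  shows "(\<lambda>z. \<Psi> (h (T z)) \<bullet> V (\<Psi> (Y z))) \<in> borel_measurable \<rho>"
proof -
  have "(\<lambda>p. \<Psi> (fst p) \<bullet> V (\<Psi> (snd p))) \<in> borel_measurable (borel :: (real \<times> real) measure)"
    by (intro borel_measurable_continuous_onI continuous_on_inner bounded_linear.continuous_on[OF V]
        continuous_on_compose2[OF \<Psi>c] continuous_intros) auto
  from measurable_compose[OF borel_measurable_Pair[OF measurable_compose[OF T h] Y] this]
  show ?thesis by simp
qed

lemma loss_integrable:
  fixes \<Psi> :: "real \<Rightarrow> 'h::real_inner" and V :: "'h \<Rightarrow> 'h"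
  assumes \<Psi>c: "continuous_on UNIV \<Psi>" and comp: "compact (range \<Psi>)" and V: "bounded_linear V"
    and Y: "Y \<in> borel_measurable \<rho>" and h: "h \<in> borel_measurable borel"
  shows "integrable \<rho> (\<lambda>z. \<Psi> (h (T z)) \<bullet> V (\<Psi> (Y z)))"
proof -
  obtain C where C: "0 < C" "\<And>y x. \<bar>\<Psi> y \<bullet> V x\<bar> \<le> C * norm x" "\<And>y y'. \<bar>\<Psi> y \<bullet> V (\<Psi> y')\<bar> \<le> C"
    by (rule loss_bounded[OF comp V]) (rule that)
  show ?thesis
    by (rule integrable_const_bound[of _ C]) (use C loss_measurable[OF \<Psi>c V Y h] in auto)
qed

lemma weighted_loss_measurable:
  fixes \<Psi> :: "real \<Rightarrow> 'h::real_inner" and n :: nat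
  assumes \<Psi>c: "continuous_on UNIV \<Psi>" and h: "h \<in> borel_measurable borel"
  shows "(\<lambda>x. \<Sum>i<n. krr_weights k n (rate n) (\<lambda>i. T (Z i w)) x i * (\<Psi> (h x) \<bullet> v i)) \<in> borel_measurable borel"
proof (intro borel_measurable_sum borel_measurable_times)
  fix i assume "i \<in> {..<n}"
  then show "(\<lambda>x. krr_weights k n (rate n) (\<lambda>i. T (Z i w)) x i) \<in> borel_measurable borel"
    by (intro borel_measurable_continuous_onI weights_continuous) auto
  show "(\<lambda>x. \<Psi> (h x) \<bullet> v i) \<in> borel_measurable borel"
    by (rule measurable_compose[OF h continuous_inner_measurable[OF \<Psi>c]])
qed

lemma weighted_loss_integrable:
  fixes \<Psi> :: "real \<Rightarrow> 'h::real_inner" and V :: "'h \<Rightarrow> 'h" and n :: nat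
  assumes \<Psi>c: "continuous_on UNIV \<Psi>" and comp: "compact (range \<Psi>)" and V: "bounded_linear V"
    and h: "h \<in> borel_measurable borel"
  shows "integrable \<rho> (\<lambda>z. \<Sum>i<n. krr_weights k n (rate n) (\<lambda>i. T (Z i w)) (T z) i * (\<Psi> (h (T z)) \<bullet> V (v i)))"
proof -
  obtain C where C: "0 < C" "\<And>y x. \<bar>\<Psi> y \<bullet> V x\<bar> \<le> C * norm x" "\<And>y y'. \<bar>\<Psi> y \<bullet> V (\<Psi> y')\<bar> \<le> C"
    by (rule loss_bounded[OF comp V]) (rule that)
  show ?thesis
  proof (intro Bochner_Integration.integrable_sum integrable_bounded_mult)
    fix i assume "i \<in> {..<n}"
    then show "continuous_on UNIV (\<lambda>x. krr_weights k n (rate n) (\<lambda>i. T (Z i w)) x i)"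
      by (intro weights_continuous) auto
    show "(\<lambda>z. \<Psi> (h (T z)) \<bullet> V (v i)) \<in> borel_measurable \<rho>"
      by (rule measurable_compose[OF T measurable_compose[OF h continuous_inner_measurable[OF \<Psi>c]]])
    show "\<bar>\<Psi> (h (T z)) \<bullet> V (v i)\<bar> \<le> C * norm (v i)" for z by (rule C(2))
  qed
qed

text \<open>Substitute the step approximation of \<Psi>(Y). The weights act linearly on responses,
  so each cell contributes the residual of the scalar regression of its indicator, tested against
  the function \<open>\<Psi> (h x) \<bullet> V (v m)\<close> of the input. The remainder enters once
  through the weights, where stability controls it, and once directly.\<close>

proposition weighted_loss_consistent:
  fixes \<Psi> :: "real \<Rightarrow> 'h::real_inner" and V :: "'h \<Rightarrow> 'h" and Y :: "'z \<Rightarrow> real"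
  assumes \<Psi>c: "continuous_on UNIV \<Psi>" and comp: "compact (range \<Psi>)" and V: "bounded_linear V"
    and Y[measurable]: "Y \<in> borel_measurable \<rho>"
  shows "AE w in P. \<forall>\<epsilon>>0. \<exists>n0. \<forall>n\<ge>n0. \<forall>h. h \<in> borel_measurable borel \<longrightarrow>
    \<bar>\<integral>z. (\<Sum>i<n. krr_weights k n (rate n) (\<lambda>i. T (Z i w)) (T z) i * (\<Psi> (h (T z)) \<bullet> V (\<Psi> (Y (Z i w)))))
      - \<Psi> (h (T z)) \<bullet> V (\<Psi> (Y z)) \<partial>\<rho>\<bar> \<le> \<epsilon>"
proof (rule AE_all_positive_reals)
  fix \<epsilon> :: real assume \<epsilon>: "0 < \<epsilon>"
  interpret V: bounded_linear V by fact
  obtain C where C: "0 < C" and ip: "\<And>y x. \<bar>\<Psi> y \<bullet> V x\<bar> \<le> C * norm x"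
    by (rule loss_bounded[OF comp V]) (rule that)
  note [measurable] = continuous_inner_measurable[OF \<Psi>c]
  \<comment> \<open>The remainder costs \<open>C * (2 * \<delta>)\<close> through the weights and
    \<open>C * \<delta>\<close> directly, together \<open>\<epsilon> / 2\<close>.\<close>
  define \<delta> where "\<delta> = \<epsilon> / (6 * C)"
  have \<delta>: "0 < \<delta>" using \<epsilon> C by (simp add: \<delta>_def)
  obtain M :: nat and v A where A[measurable]: "\<And>m. A m \<in> sets borel"
    and approx: "\<And>y. norm (\<Psi> y - (\<Sum>m<M. indicator (A m) y *\<^sub>R v m)) < \<delta>"
    by (rule step_approximation[OF \<Psi>c comp \<delta>]) (rule that)
  define r where "r y = \<Psi> y - (\<Sum>m<M. indicator (A m) y *\<^sub>R v m)" for y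
  define u where "u m z = (indicator (A m) (Y z) :: real)" for m z
  have um[measurable]: "u m \<in> borel_measurable \<rho>" for m unfolding u_def by measurable
  have u1: "\<bar>u m z\<bar> \<le> 1" for m z by (simp add: u_def indicator_def)
  have split: "\<Psi> (Y z) = (\<Sum>m<M. u m z *\<^sub>R v m) + r (Y z)" for z by (simp add: r_def u_def)
  \<comment> \<open>Dividing by \<open>Q\<close> brings all \<open>M\<close> test functions into
    [-1, 1], as \<open>est_consistent\<close> demands; the summand 1 keeps \<open>Q\<close>
    positive.\<close>
  define Q where "Q = C * (\<Sum>m<M. norm (v m)) + 1"
  have Q: "0 < Q" using C by (auto simp: Q_def intro!: add_nonneg_pos mult_nonneg_nonneg sum_nonneg)
  have Qb: "\<bar>\<Psi> y \<bullet> V (v m)\<bar> \<le> Q" if "m < M" for y m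
  proof -
    have "norm (v m) \<le> (\<Sum>m<M. norm (v m))" using that by (intro member_le_sum) auto
    then have "C * norm (v m) \<le> C * (\<Sum>m<M. norm (v m))" using C by (intro mult_left_mono) auto
    then show ?thesis using ip[of y "v m"] by (simp add: Q_def)
  qed
  \<comment> \<open>The \<open>M\<close> cells then cost at most \<open>\<epsilon> / 2\<close>;
    \<open>M + 1\<close> avoids division by zero.\<close>
  define \<epsilon>1 where "\<epsilon>1 = \<epsilon> / (2 * (real M + 1) * Q)"
  have \<epsilon>1: "0 < \<epsilon>1" using \<epsilon> Q by (simp add: \<epsilon>1_def)
  have "AE w in P. \<forall>m. \<forall>\<epsilon>>0. \<exists>n0. \<forall>n\<ge>n0. \<forall>q. q \<in> borel_measurable borel \<longrightarrow> (\<forall>x. \<bar>q x\<bar> \<le> 1) \<longrightarrow>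
    \<bar>\<integral>z. q (T z) * (u m z - est w n (\<lambda>i. u m (Z i w)) (T z)) \<partial>\<rho>\<bar> \<le> \<epsilon>"
    unfolding AE_all_countable using est_consistent[OF um u1] by blast
  with est_stable show "AE w in P. \<exists>n0. \<forall>n\<ge>n0. \<forall>h. h \<in> borel_measurable borel \<longrightarrow>
    \<bar>\<integral>z. (\<Sum>i<n. krr_weights k n (rate n) (\<lambda>i. T (Z i w)) (T z) i * (\<Psi> (h (T z)) \<bullet> V (\<Psi> (Y (Z i w)))))
      - \<Psi> (h (T z)) \<bullet> V (\<Psi> (Y z)) \<partial>\<rho>\<bar> \<le> \<epsilon>"
  proof (eventually_elim)
    case (elim w)
    obtain n1 where n1: "0 < n1" "\<And>n v. n1 \<le> n \<Longrightarrow> (\<integral>z. (est w n v (T z))\<^sup>2 \<partial>\<rho>) \<le> 2 * ((\<Sum>i<n. (v i)\<^sup>2) / real n)"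
      using elim(1) by blast
    have "\<forall>m. \<exists>n0. \<forall>n\<ge>n0. \<forall>q. q \<in> borel_measurable borel \<longrightarrow> (\<forall>x. \<bar>q x\<bar> \<le> 1) \<longrightarrow>
      \<bar>\<integral>z. q (T z) * (u m z - est w n (\<lambda>i. u m (Z i w)) (T z)) \<partial>\<rho>\<bar> \<le> \<epsilon>1"
      using elim(2) \<epsilon>1 by blast
    from choice[OF this] obtain n2 where "\<forall>m. \<forall>n\<ge>n2 m. \<forall>q. q \<in> borel_measurable borel \<longrightarrow> (\<forall>x. \<bar>q x\<bar> \<le> 1) \<longrightarrow>
      \<bar>\<integral>z. q (T z) * (u m z - est w n (\<lambda>i. u m (Z i w)) (T z)) \<partial>\<rho>\<bar> \<le> \<epsilon>1" ..
    then have n2: "n2 m \<le> n \<Longrightarrow> q \<in> borel_measurable borel \<Longrightarrow> (\<forall>x. \<bar>q x\<bar> \<le> 1) \<Longrightarrow>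
      \<bar>\<integral>z. q (T z) * (u m z - est w n (\<lambda>i. u m (Z i w)) (T z)) \<partial>\<rho>\<bar> \<le> \<epsilon>1" for m n q
      by blast
    show ?case
    proof (intro exI[of _ "n1 + (\<Sum>m<M. n2 m)"] allI impI)
      fix n and h :: "'x \<Rightarrow> real"
      assume n: "n1 + (\<Sum>m<M. n2 m) \<le> n" and h[measurable]: "h \<in> borel_measurable borel"
      have n0: "0 < n" "n1 \<le> n" using n n1(1) by auto
      have n2n: "n2 m \<le> n" if "m < M" for m
        using member_le_sum[of m "{..<M}" n2] that n by simp
      define \<alpha> where "\<alpha> i x = krr_weights k n (rate n) (\<lambda>i. T (Z i w)) x i" for i x
      have \<alpha>c: "continuous_on UNIV (\<alpha> i)" if "i < n" for i
        unfolding \<alpha>_def[abs_def] by (rule weights_continuous[OF n0(1) that])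
      define b where "b z x = \<Psi> (h (T z)) \<bullet> V x" for z x
      have bm[measurable]: "(\<lambda>z. b z x) \<in> borel_measurable \<rho>" for x
        unfolding b_def by measurable
      have bb: "\<bar>b z x\<bar> \<le> C * norm x" for z x unfolding b_def by (rule ip)
      have b_add: "b z (x + y) = b z x + b z y" and b_scale: "b z (c *\<^sub>R x) = c * b z x"
        and b_sum: "b z (sum f I) = (\<Sum>i\<in>I. b z (f i))" for z x y c and f :: "nat \<Rightarrow> 'h" and I
        by (simp_all add: b_def V.add V.scaleR V.sum inner_add_right inner_sum_right)
      let ?ra = "\<lambda>z. \<Sum>i<n. \<alpha> i (T z) *\<^sub>R r (Y (Z i w))"
      let ?e = "\<lambda>m z. est w n (\<lambda>i. u m (Z i w)) (T z)"
      have decomp: "(\<Sum>i<n. \<alpha> i (T z) * b z (\<Psi> (Y (Z i w)))) - b z (\<Psi> (Y z)) =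
          (b z (?ra z) - b z (r (Y z))) - (\<Sum>m<M. b z (v m) * (u m z - ?e m z))" for z
      proof -
        have "(\<Sum>i<n. \<alpha> i (T z) * b z (\<Psi> (Y (Z i w)))) =
            (\<Sum>i<n. \<alpha> i (T z) * (\<Sum>m<M. u m (Z i w) * b z (v m))) + b z (?ra z)"
          by (simp add: split b_add b_scale b_sum distrib_left sum.distrib)
        also have "(\<Sum>i<n. \<alpha> i (T z) * (\<Sum>m<M. u m (Z i w) * b z (v m))) = (\<Sum>m<M. b z (v m) * ?e m z)"
          unfolding krr_def sum_distrib_left by (subst sum.swap) (simp add: \<alpha>_def ac_simps)
        finally show ?thesis
          by (simp add: split b_add b_scale b_sum right_diff_distrib sum_subtractf mult.commute)
      qed
      have i1: "integrable \<rho> (\<lambda>z. b z (v m) * (u m z - ?e m z))" if "m < M" for m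
      proof -
        have "integrable \<rho> (\<lambda>z. 1 * (b z (v m) * u m z))"
        proof (rule integrable_bounded_mult[of "\<lambda>_. 1" "\<lambda>z. b z (v m) * u m z" "C * norm (v m) * 1"])
          show "\<bar>b z (v m) * u m z\<bar> \<le> C * norm (v m) * 1" for z
            unfolding abs_mult by (intro mult_mono bb u1) (use C in auto)
        qed (auto)
        moreover have "integrable \<rho> (\<lambda>z. ?e m z * b z (v m))"
          by (intro integrable_bounded_mult[where B="C * norm (v m)", OF krr_continuous] k k_cont bm bb)
            (use n0 in auto)
        ultimately show ?thesis by (simp add: right_diff_distrib mult.commute)
      qed
      have i2: "integrable \<rho> (\<lambda>z. b z (?ra z))"
      proof -
        have "integrable \<rho> (\<lambda>z. \<Sum>i<n. \<alpha> i (T z) * b z (r (Y (Z i w))))"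
          unfolding b_def \<alpha>_def by (rule weighted_loss_integrable[OF \<Psi>c comp V h])
        then show ?thesis by (simp only: b_sum b_scale)
      qed
      have rY: "(\<lambda>z. b z (r (Y z))) \<in> borel_measurable \<rho>"
      proof -
        have "b z (r (Y z)) = \<Psi> (h (T z)) \<bullet> V (\<Psi> (Y z)) - (\<Sum>m<M. u m z * b z (v m))" for z
          by (simp add: r_def u_def b_def V.diff V.sum V.scaleR inner_diff_right inner_sum_right)
        then show ?thesis using loss_measurable[OF \<Psi>c V Y h] by simp
      qed
      have brY: "\<bar>b z (r y)\<bar> \<le> C * \<delta>" for z y
        using order_trans[OF bb mult_left_mono[OF less_imp_le[OF approx[of y, folded r_def]], of "C"]] C by simp
      have i3: "integrable \<rho> (\<lambda>z. b z (r (Y z)))"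
        using rY brY by (intro integrable_const_bound[of _ "C * \<delta>"]) auto
      have e1: "\<bar>\<integral>z. b z (v m) * (u m z - ?e m z) \<partial>\<rho>\<bar> \<le> Q * \<epsilon>1" if m: "m < M" for m
      proof -
        have "\<bar>\<integral>z. (\<Psi> (h (T z)) \<bullet> V (v m) / Q) * (u m z - ?e m z) \<partial>\<rho>\<bar> \<le> \<epsilon>1"
        proof (rule n2[OF n2n[OF m], of "\<lambda>x. \<Psi> (h x) \<bullet> V (v m) / Q"])
          show "(\<lambda>x. \<Psi> (h x) \<bullet> V (v m) / Q) \<in> borel_measurable borel" by measurable
          show "\<forall>x. \<bar>\<Psi> (h x) \<bullet> V (v m) / Q\<bar> \<le> 1" using Qb[OF m] Q by simp
        qed
        then have "\<bar>(\<integral>z. b z (v m) * (u m z - ?e m z) \<partial>\<rho>) / Q\<bar> \<le> \<epsilon>1" by (simp add: b_def)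
        then show ?thesis using Q by (simp add: field_simps)
      qed
      have e2: "\<bar>\<integral>z. b z (?ra z) \<partial>\<rho>\<bar> \<le> C * (2 * \<delta>)"
      proof -
        have "\<bar>\<integral>z. b z (?ra z) \<partial>\<rho>\<bar> \<le> (\<integral>z. \<bar>b z (?ra z)\<bar> \<partial>\<rho>)" by (rule integral_abs_bound)
        also have "\<dots> \<le> (\<integral>z. C * norm (?ra z) \<partial>\<rho>)"
          by (intro integral_mono integrable_abs i2 bb integrable_mult_right
              integrable_continuous[of "\<lambda>x. norm (\<Sum>i<n. \<alpha> i x *\<^sub>R r (Y (Z i w)))"] continuous_intros \<alpha>c) simp
        also have "\<dots> = C * (\<integral>z. norm (?ra z) \<partial>\<rho>)" by simp
        also have "\<dots> \<le> C * (2 * \<delta>)"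
          unfolding \<alpha>_def using C approx[folded r_def]
          by (intro mult_left_mono weighted_sum_norm_le[OF n0(1) n1(2)[OF n0(2)]]) (auto intro: less_imp_le)
        finally show ?thesis .
      qed
      have e3: "\<bar>\<integral>z. b z (r (Y z)) \<partial>\<rho>\<bar> \<le> C * \<delta>"
        using order_trans[OF integral_abs_bound[of \<rho> "\<lambda>z. b z (r (Y z))"] integral_le_const[OF integrable_abs[OF i3]]] brY
        by simp
      have "\<bar>\<integral>z. (\<Sum>i<n. \<alpha> i (T z) * b z (\<Psi> (Y (Z i w)))) - b z (\<Psi> (Y z)) \<partial>\<rho>\<bar>
          = \<bar>(\<integral>z. b z (?ra z) \<partial>\<rho>) - (\<integral>z. b z (r (Y z)) \<partial>\<rho>) - (\<Sum>m<M. \<integral>z. b z (v m) * (u m z - ?e m z) \<partial>\<rho>)\<bar>"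
      proof -
        have "integrable \<rho> (\<lambda>z. \<Sum>m<M. b z (v m) * (u m z - ?e m z))"
          by (rule Bochner_Integration.integrable_sum) (rule i1, simp)
        moreover have "(\<integral>z. (\<Sum>m<M. b z (v m) * (u m z - ?e m z)) \<partial>\<rho>) =
            (\<Sum>m<M. \<integral>z. b z (v m) * (u m z - ?e m z) \<partial>\<rho>)"
          by (rule Bochner_Integration.integral_sum) (rule i1, simp)
        ultimately show ?thesis
          unfolding decomp by (simp only: Bochner_Integration.integral_diff
              Bochner_Integration.integrable_diff i2 i3)
      qed
      also have "\<dots> \<le> C * (2 * \<delta>) + C * \<delta> + (\<Sum>m<M. \<bar>\<integral>z. b z (v m) * (u m z - ?e m z) \<partial>\<rho>\<bar>)"
        using e2 e3 sum_abs[of "\<lambda>m. \<integral>z. b z (v m) * (u m z - ?e m z) \<partial>\<rho>" "{..<M}"] by linarith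
      also have "(\<Sum>m<M. \<bar>\<integral>z. b z (v m) * (u m z - ?e m z) \<partial>\<rho>\<bar>) \<le> real M * (Q * \<epsilon>1)"
        using sum_bounded_above[of "{..<M}" "\<lambda>m. \<bar>\<integral>z. b z (v m) * (u m z - ?e m z) \<partial>\<rho>\<bar>" "Q * \<epsilon>1"] e1 by simp
      also have "real M * (Q * \<epsilon>1) = real M / (real M + 1) * (\<epsilon> / 2)" using Q by (simp add: \<epsilon>1_def)
      also have "\<dots> \<le> 1 * (\<epsilon> / 2)" using \<epsilon> by (intro mult_right_mono) auto
      also have "C * (2 * \<delta>) + C * \<delta> + 1 * (\<epsilon> / 2) = \<epsilon>" using C by (simp add: \<delta>_def field_simps)
      finally show "\<bar>\<integral>z. (\<Sum>i<n. krr_weights k n (rate n) (\<lambda>i. T (Z i w)) (T z) i * (\<Psi> (h (T z)) \<bullet> V (\<Psi> (Y (Z i w)))))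
        - \<Psi> (h (T z)) \<bullet> V (\<Psi> (Y z)) \<partial>\<rho>\<bar> \<le> \<epsilon>" by (simp add: b_def \<alpha>_def)
    qed
  qed
next
  fix \<epsilon> \<epsilon>' w assume "\<epsilon> \<le> (\<epsilon>' :: real)"
  then show "\<exists>n0. \<forall>n\<ge>n0. \<forall>h. h \<in> borel_measurable borel \<longrightarrow>
    \<bar>\<integral>z. (\<Sum>i<n. krr_weights k n (rate n) (\<lambda>i. T (Z i w)) (T z) i * (\<Psi> (h (T z)) \<bullet> V (\<Psi> (Y (Z i w)))))
      - \<Psi> (h (T z)) \<bullet> V (\<Psi> (Y z)) \<partial>\<rho>\<bar> \<le> \<epsilon>'"
    if "\<exists>n0. \<forall>n\<ge>n0. \<forall>h. h \<in> borel_measurable borel \<longrightarrow>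
    \<bar>\<integral>z. (\<Sum>i<n. krr_weights k n (rate n) (\<lambda>i. T (Z i w)) (T z) i * (\<Psi> (h (T z)) \<bullet> V (\<Psi> (Y (Z i w)))))
      - \<Psi> (h (T z)) \<bullet> V (\<Psi> (Y z)) \<partial>\<rho>\<bar> \<le> \<epsilon>"
    using that by (meson order_trans)
qed

end

section \<open>The multitask estimator\<close>

theorem theorem2:
  fixes \<rho>X :: "'x::metric_space measure"
    and \<rho> :: "'t::finite \<Rightarrow> ('x \<times> real) measure"
    and C :: "(real^'t) set" and a b :: real
    and k :: "'x \<Rightarrow> 'x \<Rightarrow> real"
    and l :: "real \<Rightarrow> real \<Rightarrow> real"
    and psi :: "real \<Rightarrow> 'h::{real_inner,complete_space}" and V :: "'h \<Rightarrow> 'h"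
    and evl :: "'h \<Rightarrow> real \<Rightarrow> real"
    and P :: "'o measure" and Z :: "'t \<Rightarrow> nat \<Rightarrow> 'o \<Rightarrow> 'x \<times> real"
    and fhat :: "('t \<Rightarrow> nat) \<Rightarrow> 'o \<Rightarrow> 'x \<Rightarrow> real^'t"
  assumes X_compact: "compact (UNIV :: 'x set)"
    and ab: "a < b"
    and C_compact: "compact C" and C_ne: "C \<noteq> {}"
    and C_sub: "C \<subseteq> {c. \<forall>t. c $ t \<in> {a..b}}"
    and \<rho>X_prob: "prob_space \<rho>X" and \<rho>X_sets: "sets \<rho>X = sets borel"
    and \<rho>_prob: "\<And>t. prob_space (\<rho> t)"
    and \<rho>_sets: "\<And>t. sets (\<rho> t) = sets (restrict_space borel (UNIV \<times> {a..b}))"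
    and \<rho>_marginal: "\<And>t. distr (\<rho> t) borel fst = \<rho>X"
    and k_pd: "pd_kernel k" and k_univ: "universal_kernel k"
    and l_SELF: "SELF {a..b} l psi V evl"
    and P_prob: "prob_space P"
    and Z_indep: "prob_space.indep_vars P (\<lambda>ti::'t \<times> nat. \<rho> (fst ti)) (\<lambda>ti. Z (fst ti) (snd ti)) UNIV"
    and Z_distr: "\<And>t i. distr P (\<rho> t) (Z t i) = \<rho> t"
    and fhat_in: "\<And>N w x. fhat N w x \<in> C"
    and fhat_min: "\<And>N w x c. c \<in> C \<Longrightarrow>
                     mtl_objective k l N Z w x (fhat N w x) \<le> mtl_objective k l N Z w x c"
    and fhat_meas: "\<And>N w. fhat N w \<in> borel_measurable borel"
  shows "AE w in P. \<forall>e>0. \<exists>M. \<forall>N. M \<le> Min (range N) \<longrightarrow>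
           \<bar>mtl_risk \<rho> l (fhat N w)
             - (INF f\<in>{f. f \<in> borel_measurable borel \<and> (\<forall>x. f x \<in> C)}. mtl_risk \<rho> l f)\<bar> < e"
proof -
  interpret \<rho>X: prob_space \<rho>X by fact
  interpret P: prob_space P by fact
  have kc: "continuous_on UNIV (\<lambda>(x, y). k x y)" using k_univ by (simp add: universal_kernel_def)
  obtain e where e_cont: "\<And>m. continuous_on UNIV (e m)" and e: "\<And>x y. (\<lambda>m::nat. e m x * e m y) sums k x y"
    by (rule pd_kernel_features[OF X_compact k_pd kc]) (rule that)
  have "continuous_on UNIV (\<lambda>x. k x x)"
    using continuous_on_compose2[OF kc, of UNIV "\<lambda>x. (x, x)"] by (simp add: continuous_on_Pair)
  then have "bounded (range (\<lambda>x. k x x))"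
    by (intro compact_imp_bounded compact_continuous_image X_compact)
  then obtain K where K: "\<And>x. k x x \<le> K" unfolding bounded_iff by (auto simp: abs_le_iff)
  have kx: "continuous_on UNIV (\<lambda>x. k x y)" for y
    using continuous_on_compose2[OF kc, of UNIV "\<lambda>x. (x, y)"] by (simp add: continuous_on_Pair)
  \<comment> \<open>Clamping to [a, b] extends \<open>psi\<close> continuously to the real line, so
    the regression results apply to arbitrary real-valued \<open>h\<close>. The range remains the
    compact image of [a, b].\<close>
  define \<Psi> where "\<Psi> y = psi (max a (min b y))" for y
  have self: "continuous_on {a..b} psi" "bounded_linear V" "\<And>c y. c \<in> {a..b} \<Longrightarrow> y \<in> {a..b} \<Longrightarrow> l c y = \<Psi> c \<bullet> V (\<Psi> y)"
    using l_SELF by (auto simp: SELF_def \<Psi>_def max_def min_def)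
  have \<Psi>c: "continuous_on UNIV \<Psi>"
    unfolding \<Psi>_def using ab by (intro continuous_on_compose2[OF self(1)] continuous_intros) auto
  have "\<Psi> y \<in> psi ` {a..b}" for y
    unfolding \<Psi>_def using ab by (intro imageI) auto
  moreover have "psi y = \<Psi> y" if "y \<in> {a..b}" for y
    using that by (auto simp: \<Psi>_def max_def min_def)
  ultimately have "range \<Psi> = psi ` {a..b}"
    by (intro equalityI subsetI) (auto simp del: atLeastAtMost_iff)
  then have \<Psi>k: "compact (range \<Psi>)" using self(1) by (simp add: compact_continuous_image)
  have sp: "space (\<rho> t) = UNIV \<times> {a..b}" for t
    using sets_eq_imp_space_eq[OF \<rho>_sets[of t]] by (simp add: space_restrict_space)
  have fst_m: "fst \<in> measurable (\<rho> t) borel" and snd_m: "snd \<in> borel_measurable (\<rho> t)" for t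
    by (simp_all add: measurable_cong_sets[OF \<rho>_sets refl] measurable_restrict_space1
        borel_measurable_continuous_onI continuous_on_fst continuous_on_snd)
  have iid: "krr_iid (\<rho> t) k e fst K P (Z t)" for t
  proof -
    interpret \<rho>: prob_space "\<rho> t" by (rule \<rho>_prob)
    have "P.indep_vars (\<lambda>_. \<rho> t) (Z t) UNIV"
      using P.indep_vars_reindex[of "Pair t", OF _ P.indep_vars_subset[OF Z_indep]] by (simp add: inj_on_def)
    then show ?thesis
      by unfold_locales (use k_pd e e_cont kx K fst_m X_compact k_univ Z_distr in auto)
  qed
  \<comment> \<open>One task's part of the objective, with the extended loss in place of
    \<open>l\<close>.\<close>
  define F where "F N t w x c = (\<Sum>i<N t. krr_weights k (N t) (real (N t) powr (-1/4)) (\<lambda>j. fst (Z t j w)) x i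
      * (\<Psi> c \<bullet> V (\<Psi> (snd (Z t i w)))))" for N t w x c
  have "AE w in P. \<forall>t\<in>UNIV. \<forall>\<epsilon>>0. \<exists>n0. \<forall>n\<ge>n0. \<forall>h. h \<in> borel_measurable borel \<longrightarrow>
    \<bar>\<integral>z. (\<Sum>i<n. krr_weights k n (real n powr (-1/4)) (\<lambda>i. fst (Z t i w)) (fst z) i * (\<Psi> (h (fst z)) \<bullet> V (\<Psi> (snd (Z t i w)))))
      - \<Psi> (h (fst z)) \<bullet> V (\<Psi> (snd z)) \<partial>\<rho> t\<bar> \<le> \<epsilon>"
    by (subst AE_finite_all, simp, intro ballI,
        rule krr_iid.weighted_loss_consistent[OF iid \<Psi>c \<Psi>k self(2) snd_m])
  then show ?thesis
  proof (rule AE_mp, intro AE_I2 impI allI)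
    fix w and \<epsilon> :: real
    assume w: "w \<in> space P" and \<epsilon>: "0 < \<epsilon>"
      and cons: "\<forall>t\<in>UNIV. \<forall>\<epsilon>>0. \<exists>n0. \<forall>n\<ge>n0. \<forall>h. h \<in> borel_measurable borel \<longrightarrow>
    \<bar>\<integral>z. (\<Sum>i<n. krr_weights k n (real n powr (-1/4)) (\<lambda>i. fst (Z t i w)) (fst z) i * (\<Psi> (h (fst z)) \<bullet> V (\<Psi> (snd (Z t i w)))))
      - \<Psi> (h (fst z)) \<bullet> V (\<Psi> (snd z)) \<partial>\<rho> t\<bar> \<le> \<epsilon>"
    have Zs: "snd (Z t i w) \<in> {a..b}" for t i
      using krr_iid.Z_space[OF iid w, of t i] by (auto simp: sp)
    \<comment> \<open>Risk and surrogate are exchanged twice, at the cost of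
      \<open>2 * \<epsilon>1\<close>, strictly less than \<epsilon>.\<close>
    define \<epsilon>1 where "\<epsilon>1 = \<epsilon> / 4"
    have \<epsilon>1: "0 < \<epsilon>1" using \<epsilon> by (simp add: \<epsilon>1_def)
    have "\<forall>t. \<exists>n0. \<forall>n\<ge>n0. \<forall>h. h \<in> borel_measurable borel \<longrightarrow>
      \<bar>\<integral>z. (\<Sum>i<n. krr_weights k n (real n powr (-1/4)) (\<lambda>i. fst (Z t i w)) (fst z) i * (\<Psi> (h (fst z)) \<bullet> V (\<Psi> (snd (Z t i w)))))
        - \<Psi> (h (fst z)) \<bullet> V (\<Psi> (snd z)) \<partial>\<rho> t\<bar> \<le> \<epsilon>1"
      using cons \<epsilon>1 by blast
    from choice[OF this] obtain n0 where n0: "\<forall>t. \<forall>n\<ge>n0 t. \<forall>h. h \<in> borel_measurable borel \<longrightarrow>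
      \<bar>\<integral>z. (\<Sum>i<n. krr_weights k n (real n powr (-1/4)) (\<lambda>i. fst (Z t i w)) (fst z) i * (\<Psi> (h (fst z)) \<bullet> V (\<Psi> (snd (Z t i w)))))
        - \<Psi> (h (fst z)) \<bullet> V (\<Psi> (snd z)) \<partial>\<rho> t\<bar> \<le> \<epsilon>1" ..
    let ?A = "{f. f \<in> borel_measurable borel \<and> (\<forall>x. f x \<in> C)}"
    show "\<exists>M. \<forall>N. M \<le> Min (range N) \<longrightarrow>
      \<bar>mtl_risk \<rho> l (fhat N w) - (INF f\<in>?A. mtl_risk \<rho> l f)\<bar> < \<epsilon>"
    proof (intro exI[of _ "Max (range n0)"] allI impI)
      fix N :: "'t \<Rightarrow> nat" assume "Max (range n0) \<le> Min (range N)"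
      then have N: "n0 t \<le> N t" for t
        by (meson Max_ge Min_le UNIV_I finite_class.finite_UNIV finite_imageI image_eqI order_trans)
      have coord: "f x $ t \<in> {a..b}" if "f \<in> ?A" for f x t using that C_sub by auto
      have coord_m: "(\<lambda>x. f x $ t) \<in> borel_measurable borel" if "f \<in> ?A" for f t
      proof -
        have "(\<lambda>c::real^'t. c $ t) \<in> borel_measurable borel"
          by (intro borel_measurable_continuous_onI continuous_intros)
        then show ?thesis using that by (auto intro: measurable_compose)
      qed
      \<comment> \<open>\<open>C\<close> couples the tasks, so \<open>fhat\<close> minimises only
        the sum over tasks at each input. The common input marginal \<open>\<rho>X\<close> is what
        allows this pointwise inequality to be integrated for all tasks at once.\<close>
      define S where "S f = (\<Sum>t\<in>UNIV. \<integral>x. F N t w x (f x $ t) \<partial>\<rho>X)" for f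
      have Fm: "(\<lambda>x. F N t w x (f x $ t)) \<in> borel_measurable borel" if "f \<in> ?A" for f t
        unfolding F_def by (rule krr_iid.weighted_loss_measurable[OF iid \<Psi>c coord_m[OF that]])
      have Fi: "integrable (\<rho> t) (\<lambda>z. F N t w (fst z) (f (fst z) $ t))" if "f \<in> ?A" for f t
        unfolding F_def by (rule krr_iid.weighted_loss_integrable[OF iid \<Psi>c \<Psi>k self(2) coord_m[OF that]])
      have FiX: "integrable \<rho>X (\<lambda>x. F N t w x (f x $ t))" if "f \<in> ?A" for f t
        unfolding \<rho>_marginal[of t, symmetric] by (subst integrable_distr_eq[OF fst_m Fm[OF that]]) (rule Fi[OF that])
      have risk: "\<bar>mtl_risk \<rho> l f - S f / real CARD('t)\<bar> \<le> \<epsilon>1" if f: "f \<in> ?A" for f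
      proof -
        define R where "R t = (\<integral>z. l (f (fst z) $ t) (snd z) \<partial>\<rho> t)" for t
        define G where "G t = (\<integral>x. F N t w x (f x $ t) \<partial>\<rho>X)" for t
        have "\<bar>G t - R t\<bar> \<le> \<epsilon>1" for t
        proof -
          have "R t = (\<integral>z. \<Psi> (f (fst z) $ t) \<bullet> V (\<Psi> (snd z)) \<partial>\<rho> t)"
            unfolding R_def using coord[OF f] by (intro Bochner_Integration.integral_cong refl self(3)) (auto simp: sp)
          moreover have "G t = (\<integral>z. F N t w (fst z) (f (fst z) $ t) \<partial>\<rho> t)"
            unfolding G_def \<rho>_marginal[of t, symmetric] by (rule integral_distr[OF fst_m Fm[OF f]])
          moreover have "integrable (\<rho> t) (\<lambda>z. \<Psi> (f (fst z) $ t) \<bullet> V (\<Psi> (snd z)))"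
            by (rule krr_iid.loss_integrable[OF iid \<Psi>c \<Psi>k self(2) snd_m coord_m[OF f]])
          ultimately have "G t - R t = (\<integral>z. F N t w (fst z) (f (fst z) $ t) - \<Psi> (f (fst z) $ t) \<bullet> V (\<Psi> (snd z)) \<partial>\<rho> t)"
            by (simp only: Bochner_Integration.integral_diff[OF Fi[OF f]])
          then show ?thesis
            using n0[rule_format, OF N[of t] coord_m[OF f, of t]] by (simp only: F_def)
        qed
        then have "\<bar>\<Sum>t\<in>UNIV. R t - G t\<bar> \<le> real CARD('t) * \<epsilon>1"
          using order_trans[OF sum_abs sum_bounded_above[of UNIV "\<lambda>t. \<bar>R t - G t\<bar>" \<epsilon>1]] by (simp add: abs_minus_commute)
        moreover have "mtl_risk \<rho> l f - S f / real CARD('t) = (\<Sum>t\<in>UNIV. R t - G t) / real CARD('t)"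
          by (simp add: mtl_risk_def S_def R_def G_def sum_subtractf diff_divide_distrib)
        ultimately show ?thesis by (simp add: abs_divide field_simps)
      qed
      have fhat: "fhat N w \<in> ?A" using fhat_in fhat_meas by auto
      have S_min: "S (fhat N w) \<le> S f" if f: "f \<in> ?A" for f
      proof -
        have obj: "mtl_objective k l N Z w x (g x) = (\<Sum>t\<in>UNIV. F N t w x (g x $ t))" if "g \<in> ?A" for g x
          unfolding mtl_objective_def F_def using self(3)[OF coord[OF that] Zs] by (intro sum.cong refl) simp
        have "(\<integral>x. (\<Sum>t\<in>UNIV. F N t w x (fhat N w x $ t)) \<partial>\<rho>X) \<le> (\<integral>x. (\<Sum>t\<in>UNIV. F N t w x (f x $ t)) \<partial>\<rho>X)"
          using fhat_min[of "f _" N w] f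
          by (intro integral_mono Bochner_Integration.integrable_sum FiX[OF f] FiX[OF fhat])
            (auto simp flip: obj[OF f] obj[OF fhat])
        then show ?thesis
          unfolding S_def using FiX[OF f] FiX[OF fhat] by simp
      qed
      have opt: "mtl_risk \<rho> l (fhat N w) - 2 * \<epsilon>1 \<le> mtl_risk \<rho> l f" if f: "f \<in> ?A" for f
      proof -
        have "S (fhat N w) / real CARD('t) \<le> S f / real CARD('t)"
          by (intro divide_right_mono S_min f) simp
        then show ?thesis using risk[OF f] risk[OF fhat] by linarith
      qed
      \<comment> \<open>\<open>opt\<close> also supplies the lower bound on the risks that the
        infimum requires.\<close>
      have "(INF f\<in>?A. mtl_risk \<rho> l f) \<le> mtl_risk \<rho> l (fhat N w)"
        using opt fhat by (intro cINF_lower bdd_belowI2) auto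
      moreover have "mtl_risk \<rho> l (fhat N w) - 2 * \<epsilon>1 \<le> (INF f\<in>?A. mtl_risk \<rho> l f)"
        using opt fhat by (intro cINF_greatest) auto
      ultimately show "\<bar>mtl_risk \<rho> l (fhat N w) - (INF f\<in>?A. mtl_risk \<rho> l f)\<bar> < \<epsilon>"
        using \<epsilon> unfolding \<epsilon>1_def by linarith
    qed
  qed
qed

end
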